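(* Let $\lambda\in\mathfrak h^*$ and let $\mathbb V^\lambda$ be a highest weight $\mathfrak g$-module with highest weight $\lambda$, whose highest weight space $\mathbb V^\lambda_\lambda$ is spanned by $v_\lambda$. For $J\subset I$ set $\operatorname{wt}_J\mathbb V^\lambda:=\operatorname{wt}\mathbb V^\lambda\cap(\lambda-\mathbb Z_+\Delta_J)$. Then there exists a unique subset $J(\mathbb V^\lambda)\subset I$ such that for every $J\subset I$ the following are equivalent: (a) $J\subset J(\mathbb V^\lambda)$; (b) $\operatorname{wt}_J\mathbb V^\lambda$ is finite; (c) $\operatorname{wt}_J\mathbb V^\lambda$ is $W_J$-stable; (d) $\operatorname{wt}\mathbb V^\lambda$ is $W_J$-stable. Moreover, $$J(\mathbb V^\lambda)=\{i\in J_\lambda : (x^-_{\alpha_i})^{\lambda(h_i)+1}v_\lambda=0\},\qquad J_\lambda:=\{i\in I:\lambda(h_i)\in\mathbb Z_+\}.$$ In particular, if $\mathbb V^\lambda$ is a parabolic Verma module $M(\lambda,J')$ with $J'\subset J_\lambda$, then $J(\mathbb V^\lambda)=J'$; and if $\mathbb V^\lambda$ is the simple module $L(\lambda)$, then $J(\mathbb V^\lambda)=J_\lambda$.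
   Context: $\mathfrak g$ is a complex finite-dimensional semisimple Lie algebra with fixed triangular decomposition $\mathfrak g=\mathfrak n^+\oplus\mathfrak h\oplus\mathfrak n^-$, root system $\Phi\subset\mathfrak h^*$, simple roots $\Delta=\{\alpha_i:i\in I\}$, Chevalley generators $x^\pm_{\alpha_i}\in\mathfrak n^\pm$ with $[x^+_{\alpha_i},x^-_{\alpha_j}]=\delta_{ij}h_i$ ($h_i$ the simple coroots, $\alpha_i(h_i)=2$), and Weyl group $W$. For $J\subset I$: $\Delta_J=\{\alpha_j:j\in J\}$, $W_J\subset W$ is generated by the simple reflections $s_j$, $j\in J$, and $\mathfrak g_J$ is the subalgebra generated by $x^\pm_{\alpha_j}$, $j\in J$. $\mathbb Z_+=\{0,1,2,\dots\}$, and $\mathbb Z_+\Delta_J$ is the set of finite $\mathbb Z_+$-linear combinations of $\Delta_J$. $M(\lambda)$ is the Verma module of highest weight $\lambda\in\mathfrak h^*$. A highest weight module $\mathbb V^\lambda$ is a nonzero quotient of $M(\lambda)$; $L(\lambda)$ is the unique simple quotient. $\operatorname{wt}M$ is the set of weights of an $\mathfrak h$-weight module $M$. For $J'\subset J_\lambda$, the parabolic Verma module is $M(\lambda,J'):=U(\mathfrak g)\otimes_{U(\mathfrak p_{J'})}L_{J'}(\lambda)$, where $\mathfrak p_{J'}=\mathfrak g_{J'}+\mathfrak h+\mathfrak n^+$ and $L_{J'}(\lambda)$ is the finite-dimensional simple $(\mathfrak h+\mathfrak g_{J'})$-module of highest weight $\lambda$, on which the nilradical of $\mathfrak p_{J'}$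 acts by $0$. Equivalently, $M(\lambda,J')$ is the quotient of $M(\lambda)$ by the submodule generated by $(x^-_{\alpha_j})^{\lambda(h_j)+1}m_\lambda$, $j\in J'$, where $m_\lambda$ is a highest weight vector. *)

theory Defs
  imports Complex_Main "HOL-Library.Poly_Mapping"
begin

section \<open>Complex Lie algebras and their modules\<close>

text \<open>The underlying vector space of a Lie algebra or of a module is a whole type; subalgebras,
  ideals and submodules are sets.\<close>

locale lie_algebra = vector_space scale
  for scale :: "complex \<Rightarrow> 'g::ab_group_add \<Rightarrow> 'g" +
  fixes brk :: "'g \<Rightarrow> 'g \<Rightarrow> 'g"
  assumes brk_add_left: "brk (x + y) z = brk x z + brk y z"
    and brk_scale_left: "brk (scale c x) y = scale c (brk x y)"
    and brk_add_right: "brk x (y + z) = brk x y + brk x z"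
    and brk_scale_right: "brk x (scale c y) = scale c (brk x y)"
    and brk_self: "brk x x = 0"
    and jacobi: "brk x (brk y z) + brk y (brk z x) + brk z (brk x y) = 0"
begin

definition lie_subalgebra :: "'g set \<Rightarrow> bool" where
  "lie_subalgebra S \<longleftrightarrow> subspace S \<and> (\<forall>x\<in>S. \<forall>y\<in>S. brk x y \<in> S)"

definition lie_ideal :: "'g set \<Rightarrow> bool" where
  "lie_ideal S \<longleftrightarrow> subspace S \<and> (\<forall>x. \<forall>y\<in>S. brk x y \<in> S)"

definition derived_algebra :: "'g set \<Rightarrow> 'g set" where
  "derived_algebra S = span {brk x y | x y. x \<in> S \<and> y \<in> S}"

definition solvable :: "'g set \<Rightarrow> bool" where
  "solvable S \<longleftrightarrow> (\<exists>n. (derived_algebra ^^ n) S = {0})"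

definition semisimple :: bool where
  "semisimple \<longleftrightarrow> (\<forall>S. lie_ideal S \<and> solvable S \<longrightarrow> S = {0})"

text \<open>Over the complex numbers, semisimplicity of an operator is diagonalisability.\<close>

definition ad_semisimple :: "'g \<Rightarrow> bool" where
  "ad_semisimple x \<longleftrightarrow> span {y. \<exists>c. brk x y = scale c y} = UNIV"

definition toral :: "'g set \<Rightarrow> bool" where
  "toral T \<longleftrightarrow> lie_subalgebra T \<and> (\<forall>x\<in>T. \<forall>y\<in>T. brk x y = 0) \<and> (\<forall>x\<in>T. ad_semisimple x)"

text \<open>In a semisimple Lie algebra the Cartan subalgebras are the maximal toral subalgebras.\<close>

definition cartan_subalgebra :: "'g set \<Rightarrow> bool" where
  "cartan_subalgebra H \<longleftrightarrow> toral H \<and> (\<forall>T. toral T \<and> H \<subseteq> T \<longrightarrow> T = H)"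

end

locale lie_module = lie_algebra scale brk + V: vector_space vscale
  for scale :: "complex \<Rightarrow> 'g::ab_group_add \<Rightarrow> 'g"
    and brk :: "'g \<Rightarrow> 'g \<Rightarrow> 'g"
    and vscale :: "complex \<Rightarrow> 'v::ab_group_add \<Rightarrow> 'v" +
  fixes act :: "'g \<Rightarrow> 'v \<Rightarrow> 'v"
  assumes act_add_left: "act (x + y) v = act x v + act y v"
    and act_scale_left: "act (scale c x) v = vscale c (act x v)"
    and act_add_right: "act x (v + w) = act x v + act x w"
    and act_scale_right: "act x (vscale c v) = vscale c (act x v)"
    and act_brk: "act (brk x y) v = act x (act y v) - act y (act x v)"
begin

definition submodule :: "'v set \<Rightarrow> bool" where
  "submodule S \<longleftrightarrow> V.subspace S \<and> (\<forall>x. \<forall>v\<in>S. act x v \<in> S)"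

definition simple_module :: bool where
  "simple_module \<longleftrightarrow> (UNIV :: 'v set) \<noteq> {0} \<and> (\<forall>S. submodule S \<longrightarrow> S = {0} \<or> S = UNIV)"

end


section \<open>Weights, roots and the Weyl group\<close>

text \<open>The dual space of a subspace \<open>H\<close>: linear functionals on \<open>H\<close>, extended by \<open>0\<close> outside \<open>H\<close>
  so that a functional is determined by its values on \<open>H\<close>. This convention is preserved by
  pointwise linear combinations.\<close>

definition dual_space ::
    "(complex \<Rightarrow> 'g::ab_group_add \<Rightarrow> 'g) \<Rightarrow> 'g set \<Rightarrow> ('g \<Rightarrow> complex) set" where
  "dual_space scale H = {mu. (\<forall>x\<in>H. \<forall>y\<in>H. mu (x + y) = mu x + mu y) \<and>
      (\<forall>c. \<forall>x\<in>H. mu (scale c x) = c * mu x) \<and> (\<forall>x. x \<notin> H \<longrightarrow> mu x = 0)}"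

definition weight_space ::
    "'g set \<Rightarrow> (complex \<Rightarrow> 'v \<Rightarrow> 'v) \<Rightarrow> ('g \<Rightarrow> 'v \<Rightarrow> 'v) \<Rightarrow> ('g \<Rightarrow> complex) \<Rightarrow> 'v set" where
  "weight_space H vscale act mu = {v. \<forall>x\<in>H. act x v = vscale (mu x) v}"

definition weights ::
    "(complex \<Rightarrow> 'g::ab_group_add \<Rightarrow> 'g) \<Rightarrow> 'g set \<Rightarrow> (complex \<Rightarrow> 'v::zero \<Rightarrow> 'v) \<Rightarrow>
      ('g \<Rightarrow> 'v \<Rightarrow> 'v) \<Rightarrow> ('g \<Rightarrow> complex) set" where
  "weights scale H vscale act = {mu \<in> dual_space scale H. weight_space H vscale act mu \<noteq> {0}}"

definition roots ::
    "(complex \<Rightarrow> 'g::ab_group_add \<Rightarrow> 'g) \<Rightarrow> ('g \<Rightarrow> 'g \<Rightarrow> 'g) \<Rightarrow> 'g set \<Rightarrow> ('g \<Rightarrow> complex) set" where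
  "roots scale brk H = weights scale H scale brk - {\<lambda>x. 0}"

text \<open>The cone \<open>\<int>\<^sub>+\<Delta>\<^sub>J\<close>, for finite \<open>J\<close>.\<close>

definition nonneg_cone :: "('i \<Rightarrow> 'g \<Rightarrow> complex) \<Rightarrow> 'i set \<Rightarrow> ('g \<Rightarrow> complex) set" where
  "nonneg_cone alpha J = {\<lambda>x. \<Sum>j\<in>J. of_nat (c j) * alpha j x | c :: 'i \<Rightarrow> nat. True}"

definition weights_below :: "('i \<Rightarrow> 'g \<Rightarrow> complex) \<Rightarrow> ('g \<Rightarrow> complex) \<Rightarrow> 'i set \<Rightarrow> ('g \<Rightarrow> complex) set" where
  "weights_below alpha lam J = {\<lambda>x. lam x - beta x | beta. beta \<in> nonneg_cone alpha J}"

definition positive_roots ::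
    "(complex \<Rightarrow> 'g::ab_group_add \<Rightarrow> 'g) \<Rightarrow> ('g \<Rightarrow> 'g \<Rightarrow> 'g) \<Rightarrow> 'g set \<Rightarrow> 'i set \<Rightarrow>
      ('i \<Rightarrow> 'g \<Rightarrow> complex) \<Rightarrow> ('g \<Rightarrow> complex) set" where
  "positive_roots scale brk H I alpha = roots scale brk H \<inter> nonneg_cone alpha I"

definition nilradical_pos ::
    "(complex \<Rightarrow> 'g::ab_group_add \<Rightarrow> 'g) \<Rightarrow> ('g \<Rightarrow> 'g \<Rightarrow> 'g) \<Rightarrow> 'g set \<Rightarrow> 'i set \<Rightarrow>
      ('i \<Rightarrow> 'g \<Rightarrow> complex) \<Rightarrow> 'g set" where
  "nilradical_pos scale brk H I alpha =
     module.span scale (\<Union>beta\<in>positive_roots scale brk H I alpha. weight_space H scale brk beta)"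

definition nilradical_neg ::
    "(complex \<Rightarrow> 'g::ab_group_add \<Rightarrow> 'g) \<Rightarrow> ('g \<Rightarrow> 'g \<Rightarrow> 'g) \<Rightarrow> 'g set \<Rightarrow> 'i set \<Rightarrow>
      ('i \<Rightarrow> 'g \<Rightarrow> complex) \<Rightarrow> 'g set" where
  "nilradical_neg scale brk H I alpha =
     module.span scale
       (\<Union>beta\<in>positive_roots scale brk H I alpha. weight_space H scale brk (\<lambda>x. - beta x))"

definition simple_reflection ::
    "('i \<Rightarrow> 'g \<Rightarrow> complex) \<Rightarrow> ('i \<Rightarrow> 'g) \<Rightarrow> 'i \<Rightarrow> ('g \<Rightarrow> complex) \<Rightarrow> ('g \<Rightarrow> complex)" where
  "simple_reflection alpha h i mu = (\<lambda>x. mu x - mu (h i) * alpha i x)"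

lemma simple_reflection_involution:
  assumes "alpha i (h i) = 2"
  shows "simple_reflection alpha h i (simple_reflection alpha h i mu) = mu"
  using assms by (simp add: fun_eq_iff simple_reflection_def algebra_simps)

text \<open>The subgroup generated by the simple reflections in \<open>J\<close>. As these are involutions
  (given \<open>\<alpha>\<^sub>j(h\<^sub>j) = 2\<close>), no closure under inverses is needed.\<close>

inductive_set weyl_group ::
    "('i \<Rightarrow> 'g \<Rightarrow> complex) \<Rightarrow> ('i \<Rightarrow> 'g) \<Rightarrow> 'i set \<Rightarrow> (('g \<Rightarrow> complex) \<Rightarrow> ('g \<Rightarrow> complex)) set"
  for alpha :: "'i \<Rightarrow> 'g \<Rightarrow> complex" and h :: "'i \<Rightarrow> 'g" and J :: "'i set" where
  one: "id \<in> weyl_group alpha h J"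
| step: "j \<in> J \<Longrightarrow> w \<in> weyl_group alpha h J \<Longrightarrow> simple_reflection alpha h j \<circ> w \<in> weyl_group alpha h J"

definition weyl_stable ::
    "('i \<Rightarrow> 'g \<Rightarrow> complex) \<Rightarrow> ('i \<Rightarrow> 'g) \<Rightarrow> 'i set \<Rightarrow> ('g \<Rightarrow> complex) set \<Rightarrow> bool" where
  "weyl_stable alpha h J S \<longleftrightarrow> (\<forall>w\<in>weyl_group alpha h J. w ` S \<subseteq> S)"


section \<open>Semisimple Lie algebras with triangular decomposition and Chevalley generators\<close>

text \<open>Here \<open>H\<close> is the Cartan subalgebra, \<open>alpha i\<close> (\<open>i \<in> I\<close>) are the simple roots, \<open>xp i\<close> and
  \<open>xm i\<close> the Chevalley generators and \<open>h i\<close> the simple coroots. The condition \<open>generators\<close> is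
  part of what it means for \<open>xp\<close>, \<open>xm\<close> to be Chevalley generators.\<close>

locale semisimple_lie_algebra = lie_algebra scale brk
  for scale :: "complex \<Rightarrow> 'g::ab_group_add \<Rightarrow> 'g"
    and brk :: "'g \<Rightarrow> 'g \<Rightarrow> 'g" +
  fixes H :: "'g set"
    and I :: "'i set"
    and alpha :: "'i \<Rightarrow> 'g \<Rightarrow> complex"
    and xp xm h :: "'i \<Rightarrow> 'g"
  assumes finite_dimensional: "\<exists>B. finite B \<and> span B = UNIV"
    and semisimple: "semisimple"
    and cartan: "cartan_subalgebra H"
    and finite_index: "finite I"
    and simple_roots: "alpha ` I \<subseteq> roots scale brk H"
    and simple_roots_independent:
      "\<And>c. \<forall>x. (\<Sum>i\<in>I. c i * alpha i x) = 0 \<Longrightarrow> \<forall>i\<in>I. c i = 0"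
    and simple_roots_base:
      "\<And>beta. beta \<in> roots scale brk H \<Longrightarrow>
         beta \<in> nonneg_cone alpha I \<or> (\<lambda>x. - beta x) \<in> nonneg_cone alpha I"
    and triangular_decomposition:
      "\<And>x. \<exists>!(a, b, c). a \<in> nilradical_pos scale brk H I alpha \<and> b \<in> H \<and>
         c \<in> nilradical_neg scale brk H I alpha \<and> x = a + b + c"
    and xp_root_vector: "\<And>i. i \<in> I \<Longrightarrow> xp i \<in> weight_space H scale brk (alpha i)"
    and xm_root_vector: "\<And>i. i \<in> I \<Longrightarrow> xm i \<in> weight_space H scale brk (\<lambda>x. - alpha i x)"
    and coroot_in_H: "\<And>i. i \<in> I \<Longrightarrow> h i \<in> H"
    and coroot: "\<And>i. i \<in> I \<Longrightarrow> alpha i (h i) = 2"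
    and brk_xp_xm: "\<And>i j. i \<in> I \<Longrightarrow> j \<in> I \<Longrightarrow> brk (xp i) (xm j) = (if i = j then h i else 0)"
    and generators: "lie_subalgebra hull (xp ` I \<union> xm ` I) = UNIV"


section \<open>The universal enveloping algebra\<close>

text \<open>The free associative algebra on the set \<open>'g\<close> is the monoid algebra of the free monoid of
  words over \<open>'g\<close>.\<close>

datatype 'a fword = FWord "'a list"

instantiation fword :: (type) monoid_add
begin

definition zero_fword :: "'a fword" where
  "zero_fword = FWord []"

fun plus_fword :: "'a fword \<Rightarrow> 'a fword \<Rightarrow> 'a fword" where
  "plus_fword (FWord xs) (FWord ys) = FWord (xs @ ys)"

instance
proof
  fix a b c :: "'a fword"
  show "a + b + c = a + (b + c)"
    by (cases a; cases b; cases c) simp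
  show "0 + a = a"
    by (cases a) (simp add: zero_fword_def)
  show "a + 0 = a"
    by (cases a) (simp add: zero_fword_def)
qed

end

type_synonym 'g free_algebra = "'g fword \<Rightarrow>\<^sub>0 complex"

definition fgen :: "'g \<Rightarrow> 'g free_algebra" where
  "fgen x = Poly_Mapping.single (FWord [x]) 1"

definition fscalar :: "complex \<Rightarrow> 'g free_algebra" where
  "fscalar c = Poly_Mapping.single 0 c"

definition left_ideal :: "'r::ring_1 set \<Rightarrow> bool" where
  "left_ideal L \<longleftrightarrow> 0 \<in> L \<and> (\<forall>a\<in>L. \<forall>b\<in>L. a + b \<in> L) \<and> (\<forall>r. \<forall>a\<in>L. r * a \<in> L)"

definition two_sided_ideal :: "'r::ring_1 set \<Rightarrow> bool" where
  "two_sided_ideal L \<longleftrightarrow> left_ideal L \<and> (\<forall>r. \<forall>a\<in>L. a * r \<in> L)"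

text \<open>The universal enveloping algebra is the quotient of the free algebra by the following ideal:
  the first two kinds of relators make \<open>fgen\<close> linear (giving the tensor algebra), the third
  identifies commutators with Lie brackets.\<close>

definition uea_ideal ::
    "(complex \<Rightarrow> 'g::ab_group_add \<Rightarrow> 'g) \<Rightarrow> ('g \<Rightarrow> 'g \<Rightarrow> 'g) \<Rightarrow> 'g free_algebra set" where
  "uea_ideal scale brk = two_sided_ideal hull
     ({fgen (x + y) - fgen x - fgen y | x y. True} \<union>
      {fgen (scale c x) - fscalar c * fgen x | c x. True} \<union>
      {fgen x * fgen y - fgen y * fgen x - fgen (brk x y) | x y. True})"


section \<open>Verma modules, highest weight modules and parabolic Verma modules\<close>

text \<open>Left ideals of the enveloping algebra are the left ideals \<open>L\<close> of the free algebra containing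
  \<open>uea_ideal\<close>, and the enveloping algebra modulo \<open>L\<close> is the free algebra modulo \<open>L\<close>, with \<open>x\<close>
  acting as left multiplication by \<open>fgen x\<close>. A surjective homomorphism from this module with
  kernel \<open>K\<close> is given by the following maps with \<open>L \<subseteq> K\<close>; an isomorphism, by those with \<open>L = K\<close>.\<close>

definition surjection_with_kernel ::
    "(complex \<Rightarrow> 'v::ab_group_add \<Rightarrow> 'v) \<Rightarrow> ('g \<Rightarrow> 'v \<Rightarrow> 'v) \<Rightarrow>
      ('g free_algebra \<Rightarrow> 'v) \<Rightarrow> 'g free_algebra set \<Rightarrow> bool" where
  "surjection_with_kernel vscale act phi K \<longleftrightarrow>
     (\<forall>u w. phi (u + w) = phi u + phi w) \<and>
     (\<forall>c u. phi (fscalar c * u) = vscale c (phi u)) \<and>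
     (\<forall>x u. phi (fgen x * u) = act x (phi u)) \<and>
     surj phi \<and> {u. phi u = 0} = K"

text \<open>\<open>M(\<lambda>)\<close> is the enveloping algebra modulo the left ideal generated by \<open>\<nn>\<^sup>+\<close> and the
  elements \<open>x - \<lambda>(x)\<close>, \<open>x \<in> H\<close>.\<close>

definition verma_ideal ::
    "(complex \<Rightarrow> 'g::ab_group_add \<Rightarrow> 'g) \<Rightarrow> ('g \<Rightarrow> 'g \<Rightarrow> 'g) \<Rightarrow> 'g set \<Rightarrow> 'i set \<Rightarrow>
      ('i \<Rightarrow> 'g \<Rightarrow> complex) \<Rightarrow> ('g \<Rightarrow> complex) \<Rightarrow> 'g free_algebra set" where
  "verma_ideal scale brk H I alpha lam = left_ideal hull
     (uea_ideal scale brk \<union> fgen ` nilradical_pos scale brk H I alpha \<union>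
      {fgen x - fscalar (lam x) | x. x \<in> H})"

definition highest_weight_module ::
    "(complex \<Rightarrow> 'g::ab_group_add \<Rightarrow> 'g) \<Rightarrow> ('g \<Rightarrow> 'g \<Rightarrow> 'g) \<Rightarrow> 'g set \<Rightarrow> 'i set \<Rightarrow>
      ('i \<Rightarrow> 'g \<Rightarrow> complex) \<Rightarrow> ('g \<Rightarrow> complex) \<Rightarrow>
      (complex \<Rightarrow> 'v::ab_group_add \<Rightarrow> 'v) \<Rightarrow> ('g \<Rightarrow> 'v \<Rightarrow> 'v) \<Rightarrow> bool" where
  "highest_weight_module scale brk H I alpha lam vscale act \<longleftrightarrow>
     lie_module scale brk vscale act \<and> (UNIV :: 'v set) \<noteq> {0} \<and>
     (\<exists>phi K. surjection_with_kernel vscale act phi K \<and> verma_ideal scale brk H I alpha lam \<subseteq> K)"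

definition integral_nodes :: "'i set \<Rightarrow> ('i \<Rightarrow> 'g) \<Rightarrow> ('g \<Rightarrow> complex) \<Rightarrow> 'i set" where
  "integral_nodes I h lam = {i \<in> I. lam (h i) \<in> \<nat>}"

text \<open>For \<open>i\<close> in \<open>J\<^sub>\<lambda>\<close> this is \<open>\<lambda>(h\<^sub>i)\<close> as a natural number.\<close>

definition hw_label :: "('i \<Rightarrow> 'g) \<Rightarrow> ('g \<Rightarrow> complex) \<Rightarrow> 'i \<Rightarrow> nat" where
  "hw_label h lam i = (THE n. lam (h i) = of_nat n)"

text \<open>The submodule of \<open>M(\<lambda>)\<close> generated by the vectors \<open>(x\<^sup>-\<^sub>j)^(\<lambda>(h\<^sub>j)+1) m\<^sub>\<lambda>\<close>, \<open>j \<in> J'\<close>, pulled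
  back to the free algebra (\<open>m\<^sub>\<lambda>\<close> is the class of \<open>1\<close>).\<close>

definition parabolic_verma_ideal ::
    "(complex \<Rightarrow> 'g::ab_group_add \<Rightarrow> 'g) \<Rightarrow> ('g \<Rightarrow> 'g \<Rightarrow> 'g) \<Rightarrow> 'g set \<Rightarrow> 'i set \<Rightarrow>
      ('i \<Rightarrow> 'g \<Rightarrow> complex) \<Rightarrow> ('i \<Rightarrow> 'g) \<Rightarrow> ('i \<Rightarrow> 'g) \<Rightarrow> ('g \<Rightarrow> complex) \<Rightarrow> 'i set \<Rightarrow>
      'g free_algebra set" where
  "parabolic_verma_ideal scale brk H I alpha xm h lam J' = left_ideal hull
     (verma_ideal scale brk H I alpha lam \<union> {fgen (xm j) ^ (hw_label h lam j + 1) | j. j \<in> J'})"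

definition is_parabolic_verma_module ::
    "(complex \<Rightarrow> 'g::ab_group_add \<Rightarrow> 'g) \<Rightarrow> ('g \<Rightarrow> 'g \<Rightarrow> 'g) \<Rightarrow> 'g set \<Rightarrow> 'i set \<Rightarrow>
      ('i \<Rightarrow> 'g \<Rightarrow> complex) \<Rightarrow> ('i \<Rightarrow> 'g) \<Rightarrow> ('i \<Rightarrow> 'g) \<Rightarrow> ('g \<Rightarrow> complex) \<Rightarrow> 'i set \<Rightarrow>
      (complex \<Rightarrow> 'v::ab_group_add \<Rightarrow> 'v) \<Rightarrow> ('g \<Rightarrow> 'v \<Rightarrow> 'v) \<Rightarrow> bool" where
  "is_parabolic_verma_module scale brk H I alpha xm h lam J' vscale act \<longleftrightarrow>
     lie_module scale brk vscale act \<and>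
     (\<exists>phi. surjection_with_kernel vscale act phi
        (parabolic_verma_ideal scale brk H I alpha xm h lam J'))"

text \<open>\<open>L(\<lambda>)\<close> is the simple quotient of \<open>M(\<lambda>)\<close>, i.e. the simple highest weight module.\<close>

definition is_simple_highest_weight_module ::
    "(complex \<Rightarrow> 'g::ab_group_add \<Rightarrow> 'g) \<Rightarrow> ('g \<Rightarrow> 'g \<Rightarrow> 'g) \<Rightarrow> 'g set \<Rightarrow> 'i set \<Rightarrow>
      ('i \<Rightarrow> 'g \<Rightarrow> complex) \<Rightarrow> ('g \<Rightarrow> complex) \<Rightarrow>
      (complex \<Rightarrow> 'v::ab_group_add \<Rightarrow> 'v) \<Rightarrow> ('g \<Rightarrow> 'v \<Rightarrow> 'v) \<Rightarrow> bool" where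
  "is_simple_highest_weight_module scale brk H I alpha lam vscale act \<longleftrightarrow>
     highest_weight_module scale brk H I alpha lam vscale act \<and>
     lie_module.simple_module vscale act"


section \<open>The equivalences characterising the integrability set\<close>

definition weights_J ::
    "(complex \<Rightarrow> 'g::ab_group_add \<Rightarrow> 'g) \<Rightarrow> 'g set \<Rightarrow> ('i \<Rightarrow> 'g \<Rightarrow> complex) \<Rightarrow> ('g \<Rightarrow> complex) \<Rightarrow>
      (complex \<Rightarrow> 'v::zero \<Rightarrow> 'v) \<Rightarrow> ('g \<Rightarrow> 'v \<Rightarrow> 'v) \<Rightarrow> 'i set \<Rightarrow> ('g \<Rightarrow> complex) set" where
  "weights_J scale H alpha lam vscale act J =
     weights scale H vscale act \<inter> weights_below alpha lam J"

text \<open>\<open>J0\<close> is a subset of \<open>I\<close> for which (a) to (d) are equivalent for all \<open>J\<close>.\<close>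

definition is_integrability_set ::
    "(complex \<Rightarrow> 'g::ab_group_add \<Rightarrow> 'g) \<Rightarrow> 'g set \<Rightarrow> 'i set \<Rightarrow> ('i \<Rightarrow> 'g \<Rightarrow> complex) \<Rightarrow>
      ('i \<Rightarrow> 'g) \<Rightarrow> ('g \<Rightarrow> complex) \<Rightarrow>
      (complex \<Rightarrow> 'v::zero \<Rightarrow> 'v) \<Rightarrow> ('g \<Rightarrow> 'v \<Rightarrow> 'v) \<Rightarrow> 'i set \<Rightarrow> bool" where
  "is_integrability_set scale H I alpha h lam vscale act J0 \<longleftrightarrow>
     J0 \<subseteq> I \<and>
     (\<forall>J. J \<subseteq> I \<longrightarrow>
       (J \<subseteq> J0 \<longleftrightarrow> finite (weights_J scale H alpha lam vscale act J)) \<and>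
       (J \<subseteq> J0 \<longleftrightarrow> weyl_stable alpha h J (weights_J scale H alpha lam vscale act J)) \<and>
       (J \<subseteq> J0 \<longleftrightarrow> weyl_stable alpha h J (weights scale H vscale act)))"

end

(* Let J0 be the set of i in J_lambda with (x-_i)^(lambda(h_i)+1) v = 0.

   For i in J0 both x+_i and x-_i act locally nilpotently, by the Leibniz rule, so the sl2-theory
   of strings makes wt V stable under s_i; since weights determine the coefficients of the simple
   roots, wt_J V is W_J-stable for J inside J0. Conversely, if wt_J V is finite or W_J-stable, the
   sl2-string through v in direction alpha_j, j in J, must stop, and it stops after lambda(h_j) + 1 steps.
   For finiteness choose w in W_J inverting as many positive roots as possible. It sends each
   alpha_j, j in J, to a negative root; if mu = lambda - sum c_j alpha_j is a weight then so is
   w mu = w lambda + sum c_j (- w alpha_j), and w mu <= lambda bounds the c_j.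

   In the simple module (x-_i)^(lambda(h_i)+1) v is killed by all x+_j and generates a proper submodule, so it is 0.

   For M(lambda, J') one needs that (x-_i)^n v is nonzero when i is not in J'. Instead of invoking
   the PBW theorem, consider linear forms on words in the x-_j, with the transposed operators of
   x+_k and x-_j. The Lie algebra of pairs (x, operator) generated by the pairs of the Chevalley
   generators has a triangular decomposition of its own; comparing weights, every pair
   (0, T) in it kills the forms supported on powers of x-_i. On the forms killed by all such T the Lie algebra
   acts, and evaluation at the empty word gives functionals vanishing on the defining ideal of
   M(lambda, J') as long as the form vanishes on the words ending in (x-_j)^(lambda(h_j)+1), j in J'. The
   indicator function of (x-_i)^n is such a form. *)

theory Submission
  imports Defs "HOL-Library.Function_Algebras"
begin


section \<open>Weight vectors\<close>

text \<open>The defining ideals are hulls in the free algebra, and that a power of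
  \<open>xm i\<close> lies outside one of them is shown by a linear functional
  \<open>rep u \<xi> []\<close> in u that kills the ideal. The obstacle is that \<open>lower\<close>
  and \<open>raise\<close> on words respect the brackets of opposite generators and those with the
  Cartan subalgebra, but not the Serre relations that hold in the Lie algebra, so that the operators
  of the generators do not extend to a representation on all forms. The relation
  \<open>pair_alg\<close> therefore records every operator that an element can receive, and the
  pairs (0, T) measure the ambiguity. Passing from words to forms on words makes removing the
  ambiguity a matter of choosing a subspace; with words themselves one would have to divide and then
  show that enough survives. Forms supported on powers of i survive because, on them, the negative
  part of a pair acts only as a multiple of \<open>lower i\<close>, and the factor is the
  coefficient of \<open>xm i\<close> in the negative component of the element. This rests on the
  indecomposability of simple roots: brackets contribute neither to that coefficient nor to the
  operator.\<close>

lemma (in vector_space) independent_finite: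
  assumes "finite B" "span B = UNIV" "independent S"
  shows "finite S"
  using independent_span_bound[OF assms(1,3)] assms(2) by simp

context lie_module
begin

sublocale actm: module_hom vscale vscale "act x" for x
  by unfold_locales (auto simp: act_add_right act_scale_right)

lemma act_left_zero: "act 0 u = 0"
  using act_add_left[of 0 0 u] by simp

lemma act_left_uminus: "act (- x) u = - act x u"
  using act_add_left[of x "- x" u] by (simp add: act_left_zero eq_neg_iff_add_eq_0 add.commute)

lemma act_funpow_zero: "(act x ^^ k) 0 = 0"
  by (induction k) (auto simp: actm.zero)

lemma funpow_act_add: "(act x ^^ m) (a + b) = (act x ^^ m) a + (act x ^^ m) b"
  by (induction m) (auto simp: act_add_right)

lemma weight_space_subspace: "V.subspace (weight_space H vscale act mu)"
  by (auto simp: weight_space_def V.subspace_def actm.zero act_add_right act_scale_right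
      V.scale_right_distrib mult.commute)

text \<open>For a new summand b choose x in H that separates its weight from mu. The operator x -
  nu(b)(x) kills the b-term, rescales the other summands, and multiplies u by a nonzero scalar, so
  the shorter sum decides.\<close>

lemma weight_vector_sum_eq_zero:
  assumes "finite T" "\<And>a. a \<in> T \<Longrightarrow> a \<in> weight_space H vscale act (nu a)"
    "\<And>a. a \<in> T \<Longrightarrow> \<exists>x\<in>H. nu a x \<noteq> mu x"
    "u \<in> weight_space H vscale act mu" "u = (\<Sum>a\<in>T. vscale (r a) a)"
  shows "u = 0"
  using assms
proof (induction T arbitrary: r u rule: finite_induct)
  case empty
  then show ?case by simp
next
  case (insert b T)
  obtain x where x: "x \<in> H" "nu b x \<noteq> mu x" using insert.prems(2)[of b] by auto
  have 1: "act x u = vscale (mu x) u" using insert.prems(3) x by (simp add: weight_space_def)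
  have 2: "act x a = vscale (nu a x) a" if "a \<in> insert b T" for a
    using insert.prems(1)[OF that] x by (simp add: weight_space_def)
  have "vscale (mu x - nu b x) u = act x u - vscale (nu b x) u"
    by (simp add: 1 V.scale_left_diff_distrib)
  also have "\<dots> = (\<Sum>a\<in>insert b T. vscale (r a * (nu a x - nu b x)) a)"
    unfolding insert.prems(4) actm.sum V.scale_sum_right sum_subtractf[symmetric]
    by (rule sum.cong) (auto simp: act_scale_right 2 V.scale_left_diff_distrib right_diff_distrib mult.commute)
  also have "\<dots> = (\<Sum>a\<in>T. vscale (r a * (nu a x - nu b x)) a)"
    using insert.hyps by simp
  finally have e: "vscale (mu x - nu b x) u = (\<Sum>a\<in>T. vscale (r a * (nu a x - nu b x)) a)" .
  have "vscale (mu x - nu b x) u = 0"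
    using insert.IH[OF _ _ V.subspace_scale[OF weight_space_subspace insert.prems(3)] e] insert.prems(1,2)
    by blast
  then show ?case using x by simp
qed

lemma weight_vector_in_span_eq_zero:
  assumes u: "u \<in> weight_space H vscale act mu"
    and s: "u \<in> V.span (\<Union>nu\<in>S. weight_space H vscale act nu)"
    and d: "\<And>nu. nu \<in> S \<Longrightarrow> \<exists>x\<in>H. nu x \<noteq> mu x"
  shows "u = 0"
proof -
  obtain T r where T: "finite T" "T \<subseteq> (\<Union>nu\<in>S. weight_space H vscale act nu)"
    "u = (\<Sum>a\<in>T. vscale (r a) a)"
    using s unfolding V.span_explicit by auto
  obtain nu where "\<And>a. a \<in> T \<Longrightarrow> nu a \<in> S \<and> a \<in> weight_space H vscale act (nu a)"
    using T(2) by (metis UN_E subsetD)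
  with T u d show ?thesis using weight_vector_sum_eq_zero[of T H nu mu u r] by blast
qed

text \<open>Weight vectors for separated weights are independent. Applied to the set of roots and,
  in \<open>ad_root_vector_nilpotent\<close>, to an infinite string of weights.\<close>

lemma finite_weights:
  assumes fd: "finite B" "V.span B = UNIV"
    and d: "\<And>mu nu. mu \<in> S \<Longrightarrow> nu \<in> S \<Longrightarrow> mu \<noteq> nu \<Longrightarrow> \<exists>x\<in>H. mu x \<noteq> nu x"
    and ne: "\<And>mu. mu \<in> S \<Longrightarrow> \<exists>u. u \<noteq> 0 \<and> u \<in> weight_space H vscale act mu"
  shows "finite S"
proof -
  obtain y where y: "\<And>mu. mu \<in> S \<Longrightarrow> y mu \<noteq> 0 \<and> y mu \<in> weight_space H vscale act mu"
    using ne by metis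
  have key: "y mu \<notin> V.span (y ` (S - {mu}))" if "mu \<in> S" for mu
  proof
    assume "y mu \<in> V.span (y ` (S - {mu}))"
    moreover have "y ` (S - {mu}) \<subseteq> (\<Union>nu\<in>S - {mu}. weight_space H vscale act nu)"
      using y by auto
    ultimately have "y mu \<in> V.span (\<Union>nu\<in>S - {mu}. weight_space H vscale act nu)"
      using V.span_mono by blast
    with y[OF that] d[OF _ that] show False
      using weight_vector_in_span_eq_zero[of "y mu" H mu "S - {mu}"] by blast
  qed
  have inj: "inj_on y S"
    using key V.span_base by (intro inj_onI) (metis Diff_iff image_eqI singletonD)
  have "V.independent (y ` S)"
    unfolding V.dependent_def
  proof safe
    fix mu assume "mu \<in> S" "y mu \<in> V.span (y ` S - {y mu})"
    moreover have "y ` S - {y mu} \<subseteq> y ` (S - {mu})" by auto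
    ultimately show False using key V.span_mono by blast
  qed
  with fd have "finite (y ` S)" by (rule V.independent_finite)
  with inj show ?thesis using finite_imageD by blast
qed

section \<open>Weight shifts and local nilpotency\<close>

lemma weight_space_act:
  assumes "x \<in> weight_space H scale brk beta" "u \<in> weight_space H vscale act mu"
  shows "act x u \<in> weight_space H vscale act (\<lambda>y. mu y + beta y)"
  unfolding weight_space_def
proof safe
  fix y assume y: "y \<in> H"
  have "act y (act x u) = act (brk y x) u + act x (act y u)" by (simp add: act_brk)
  then show "act y (act x u) = vscale (mu y + beta y) (act x u)"
    using assms y by (simp add: weight_space_def act_scale_left act_scale_right V.scale_left_distrib)
qed

lemma weight_space_funpow:
  assumes "x \<in> weight_space H scale brk beta" "u \<in> weight_space H vscale act mu"
  shows "(act x ^^ k) u \<in> weight_space H vscale act (\<lambda>y. mu y + of_nat k * beta y)"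
proof (induction k)
  case (Suc k)
  show ?case using weight_space_act[OF assms(1) Suc] by (simp add: algebra_simps)
qed (use assms in simp)

text \<open>Leibniz rule by induction on k + n: x (y u) = [x, y] u + y (x u), and in each summand
  one of the two nilpotency orders has dropped by one.\<close>

lemma funpow_act_eq_zero:
  assumes "(act x ^^ k) u = 0" "(brk x ^^ n) y = 0"
  shows "(act x ^^ (k + n)) (act y u) = 0"
  using assms
proof (induction "k + n" arbitrary: k n u y)
  case 0
  then show ?case by (simp add: actm.zero)
next
  case (Suc m)
  have e: "act x (act y u) = act (brk x y) u + act y (act x u)" by (simp add: act_brk)
  have 1: "(act x ^^ m) (act (brk x y) u) = 0"
  proof (cases n)
    case 0
    then have "y = 0" using Suc.prems by simp
    then have "brk x y = 0" using brk_scale_right[of x 0 0] by simp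
    then show ?thesis by (simp add: act_left_zero act_funpow_zero)
  next
    case (Suc n')
    then show ?thesis using Suc.prems \<open>Suc m = k + n\<close> Suc.hyps(1)[of k n' u "brk x y"]
      by (simp add: funpow_Suc_right del: funpow.simps)
  qed
  have 2: "(act x ^^ m) (act y (act x u)) = 0"
  proof (cases k)
    case 0
    then have "u = 0" using Suc.prems by simp
    then show ?thesis by (simp add: actm.zero act_funpow_zero)
  next
    case (Suc k')
    then show ?thesis using Suc.prems \<open>Suc m = k + n\<close> Suc.hyps(1)[of k' n "act x u" y]
      by (simp add: funpow_Suc_right del: funpow.simps)
  qed
  show ?case
    unfolding Suc.hyps(2)[symmetric] funpow_Suc_right comp_def e funpow_act_add 1 2 by simp
qed

definition locally_nilpotent :: "'g \<Rightarrow> bool" where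
  "locally_nilpotent x \<longleftrightarrow> (\<forall>u. \<exists>k. (act x ^^ k) u = 0)"

lemma funpow_act_mono:
  assumes "(act x ^^ k) u = 0" "k \<le> l"
  shows "(act x ^^ l) u = 0"
proof -
  have "(act x ^^ ((l - k) + k)) u = 0" by (simp only: funpow_add comp_def assms(1) act_funpow_zero)
  then show ?thesis using assms(2) by simp
qed

lemma funpow_act_scale: "(act x ^^ m) (vscale c a) = vscale c ((act x ^^ m) a)"
  by (induction m) (auto simp: act_scale_right)

lemma nilpotent_vectors_subspace: "V.subspace {u. \<exists>k. (act x ^^ k) u = 0}"
  unfolding V.subspace_def
proof (safe, goal_cases)
  case 1
  show ?case using act_funpow_zero by auto
next
  case (2 a b k l)
  have "(act x ^^ (max k l)) (a + b) = 0"
    unfolding funpow_act_add using funpow_act_mono 2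
    by (metis add_0 max.cobounded1 max.cobounded2)
  then show ?case by blast
next
  case (3 c a k)
  then show ?case using funpow_act_scale by (metis V.scale_zero_right)
qed

text \<open>Reduces local nilpotency on a cyclic module to nilpotency on a generator.\<close>

lemma nilpotent_vectors_submodule:
  assumes "\<And>y. \<exists>n. (brk x ^^ n) y = 0"
  shows "submodule {u. \<exists>k. (act x ^^ k) u = 0}"
  unfolding submodule_def using nilpotent_vectors_subspace funpow_act_eq_zero assms by blast


section \<open>Strings of weights\<close>

context
  fixes e f k :: 'g
  assumes ef: "brk e f = k" and kf: "brk k f = scale (-2) f"
begin

lemma string_weight:
  assumes "act k w = vscale m w"
  shows "act k ((act f ^^ n) w) = vscale (m - 2 * of_nat n) ((act f ^^ n) w)"
proof (induction n)
  case (Suc n)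
  let ?u = "(act f ^^ n) w"
  have "act k (act f ?u) = act (brk k f) ?u + act f (act k ?u)" by (simp add: act_brk)
  also have "\<dots> = vscale (- 2 + (m - 2 * of_nat n)) (act f ?u)"
    unfolding Suc kf act_scale_left act_scale_right V.scale_left_distrib ..
  finally show ?case by (simp add: algebra_simps)
qed (use assms in simp)

lemma string_raise:
  assumes "act e w = 0" "act k w = vscale m w"
  shows "act e ((act f ^^ Suc n) w) = vscale (of_nat (Suc n) * (m - of_nat n)) ((act f ^^ n) w)"
proof (induction n)
  case 0
  have "act e (act f w) = act (brk e f) w + act f (act e w)" by (simp add: act_brk)
  then show ?case using assms by (simp add: ef actm.zero)
next
  case (Suc n)
  let ?u = "(act f ^^ Suc n) w"
  have "act e ((act f ^^ Suc (Suc n)) w) = act (brk e f) ?u + act f (act e ?u)" by (simp add: act_brk)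
  also have "\<dots> = vscale (m - 2 * of_nat (Suc n)) ?u
      + vscale (of_nat (Suc n) * (m - of_nat n)) ?u"
    unfolding ef string_weight[OF assms(2)] Suc act_scale_right by simp
  also have "\<dots> = vscale (of_nat (Suc (Suc n)) * (m - of_nat (Suc n))) ?u"
    unfolding V.scale_left_distrib[symmetric] by (rule arg_cong2[where f = vscale]) (auto simp: algebra_simps)
  finally show ?case .
qed

text \<open>Let f^(q+1) w be the first power that vanishes. Applying e to it gives (q+1)(m - q) f^q
  w = 0 with f^q w nonzero, whence m = q.\<close>

lemma primitive_vector_label:
  assumes "act e w = 0" "act k w = vscale m w" "w \<noteq> 0" "(act f ^^ n) w = 0"
  obtains q where "m = of_nat q" "(act f ^^ Suc q) w = 0" "\<And>i. i \<le> q \<Longrightarrow> (act f ^^ i) w \<noteq> 0"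
proof -
  define r where "r = (LEAST n. (act f ^^ n) w = 0)"
  have r: "(act f ^^ r) w = 0" "\<And>i. i < r \<Longrightarrow> (act f ^^ i) w \<noteq> 0"
    unfolding r_def using LeastI[of "\<lambda>n. (act f ^^ n) w = 0", OF assms(4)] not_less_Least by blast+
  then obtain q where q: "r = Suc q" using assms(3) by (cases r) auto
  have "vscale (of_nat (Suc q) * (m - of_nat q)) ((act f ^^ q) w) = 0"
    using string_raise[OF assms(1,2), of q] r(1) q by (simp add: actm.zero)
  then have "m = of_nat q" using r(2)[of q] q by (simp del: of_nat_Suc)
  with q r show ?thesis by (intro that) auto
qed

text \<open>Climb with e to the last nonzero vector w = e^p u. It is primitive of weight c + 2p, so
  this number is a natural q and f^i w is nonzero exactly for i \<le> q. If c = l is natural, then p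
  + l \<le> q, and p + l steps down from w end at the reflected weight. The triple is kept general
  so that (x-, x+, -h) can be inserted for negative c.\<close>

lemma reflected_string_vector:
  assumes ke: "brk k e = scale 2 e"
    and u: "u \<noteq> 0" "act k u = vscale c u" and e: "(act e ^^ n) u = 0" and f: "locally_nilpotent f"
  shows "c \<in> \<int> \<and> (\<forall>l. c = of_nat l \<longrightarrow> (\<exists>p. (act f ^^ (p + l)) ((act e ^^ p) u) \<noteq> 0))"
proof -
  define r where "r = (LEAST n. (act e ^^ n) u = 0)"
  have r: "(act e ^^ r) u = 0" "\<And>i. i < r \<Longrightarrow> (act e ^^ i) u \<noteq> 0"
    unfolding r_def using LeastI[of "\<lambda>n. (act e ^^ n) u = 0", OF e] not_less_Least by blast+
  then obtain p where p: "r = Suc p" using u(1) by (cases r) auto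
  let ?w = "(act e ^^ p) u"
  have kw: "act k ((act e ^^ i) u) = vscale (c + 2 * of_nat i) ((act e ^^ i) u)" for i
  proof (induction i)
    case (Suc i)
    let ?u = "(act e ^^ i) u"
    have "act k (act e ?u) = act (brk k e) ?u + act e (act k ?u)" by (simp add: act_brk)
    also have "\<dots> = vscale (2 + (c + 2 * of_nat i)) (act e ?u)"
      unfolding Suc ke act_scale_left act_scale_right V.scale_left_distrib[of 2 "c + 2 * of_nat i"] ..
    finally show ?case by (simp add: algebra_simps)
  qed (use u in simp)
  obtain n where n: "(act f ^^ n) ?w = 0" using f by (auto simp: locally_nilpotent_def)
  obtain q where q: "c + 2 * of_nat p = of_nat q" "\<And>i. i \<le> q \<Longrightarrow> (act f ^^ i) ?w \<noteq> 0"
  proof (rule primitive_vector_label[of ?w "c + 2 * of_nat p" n])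
    show "act e ?w = 0" "?w \<noteq> 0" using r p by auto
  qed (use kw n in auto)
  have "c = of_int (int q - 2 * int p)" using q(1) by (simp add: algebra_simps)
  moreover have "(act f ^^ (p + l)) ?w \<noteq> 0" if "c = of_nat l" for l
  proof -
    have "of_nat (l + 2 * p) = (of_nat q :: complex)" using q(1) that by simp
    then have "l + 2 * p = q" by (simp only: of_nat_eq_iff)
    then show ?thesis using q(2) by simp
  qed
  ultimately show ?thesis by (metis Ints_of_int)
qed

end

end


section \<open>Roots and the longest element\<close>

lemma (in lie_algebra) brk_swap: "brk y x = - brk x y"
proof -
  have "brk (x + y) (x + y) = 0" by (rule brk_self)
  then show ?thesis
    unfolding brk_add_left brk_add_right by (simp add: brk_self eq_neg_iff_add_eq_0 add.commute)
qed

lemma (in lie_algebra) adjoint_module: "lie_module scale brk scale brk"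
proof
  fix x y v
  have n: "brk a (- b) = - brk a b" for a b
    using brk_scale_right[of a "-1" b] by simp
  show "brk (brk x y) v = brk x (brk y v) - brk y (brk x v)"
    using jacobi[of x y v] brk_swap[of v "brk x y"] brk_swap[of v x]
    by (simp add: n algebra_simps)
qed (simp_all add: brk_add_left brk_scale_left brk_add_right brk_scale_right)

sublocale semisimple_lie_algebra \<subseteq> ad: lie_module scale brk scale brk
  by (rule adjoint_module)

lemma dual_space_add_mult:
  assumes "mu \<in> dual_space scale H" "nu \<in> dual_space scale H"
  shows "(\<lambda>x. mu x + c * nu x) \<in> dual_space scale H"
  using assms by (auto simp: dual_space_def algebra_simps)

lemma weyl_group_add_mult:
  assumes "w \<in> weyl_group alpha h J"
  shows "w (\<lambda>x. mu x + c * nu x) = (\<lambda>x. w mu x + c * w nu x)"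
  using assms by induction (auto simp: simple_reflection_def fun_eq_iff algebra_simps)

lemma weyl_group_sum:
  assumes w: "w \<in> weyl_group alpha h J" and "finite A"
  shows "w (\<lambda>x. mu x + (\<Sum>j\<in>A. c j * nu j x)) = (\<lambda>x. w mu x + (\<Sum>j\<in>A. c j * w (nu j) x))"
  using assms(2)
proof (induction A arbitrary: mu rule: finite_induct)
  case (insert a A)
  have "w (\<lambda>x. mu x + (\<Sum>j\<in>insert a A. c j * nu j x))
      = w (\<lambda>x. (mu x + c a * nu a x) + (\<Sum>j\<in>A. c j * nu j x))"
    using insert.hyps by (simp add: add.assoc)
  then show ?case
    unfolding insert.IH weyl_group_add_mult[OF w] using insert.hyps by (simp add: add.assoc)
qed simp

lemma weyl_group_uminus:
  assumes "w \<in> weyl_group alpha h J"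
  shows "w (\<lambda>x. - mu x) = (\<lambda>x. - w mu x)"
  using assms by induction (auto simp: simple_reflection_def fun_eq_iff)

text \<open>\<open>weyl_group\<close> is generated by multiplication on the left, whereas the
  maximality argument in \<open>longest_element\<close> multiplies on the right.\<close>

lemma weyl_group_comp_reflection:
  assumes "w \<in> weyl_group alpha h J" "j \<in> J"
  shows "w \<circ> simple_reflection alpha h j \<in> weyl_group alpha h J"
  using assms(1)
proof induction
  case one
  show ?case using weyl_group.step[OF assms(2) weyl_group.one] by simp
next
  case (step i w)
  then show ?case using weyl_group.step by (metis comp_assoc)
qed

lemma weyl_stableI:
  assumes "\<And>j mu. j \<in> J \<Longrightarrow> mu \<in> S \<Longrightarrow> simple_reflection alpha h j mu \<in> S"
  shows "weyl_stable alpha h J S"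
proof -
  have "w ` S \<subseteq> S" if "w \<in> weyl_group alpha h J" for w
    using that by induction (use assms in auto)
  then show ?thesis by (auto simp: weyl_stable_def)
qed

lemma weyl_stableD:
  assumes "weyl_stable alpha h J S" "j \<in> J" "mu \<in> S"
  shows "simple_reflection alpha h j mu \<in> S"
  using assms weyl_group.step[OF assms(2) weyl_group.one] by (auto simp: weyl_stable_def)

section \<open>Coefficients with respect to the simple roots, cones, and finiteness of the root
  system\<close>

context semisimple_lie_algebra
begin

text \<open>Complex coefficients over the whole of I give sums, differences and reflections one
  common form; the cone of a subset J is then singled out by vanishing coefficients.\<close>

definition root_comb :: "('i \<Rightarrow> complex) \<Rightarrow> 'g \<Rightarrow> complex" where
  "root_comb c = (\<lambda>x. \<Sum>i\<in>I. c i * alpha i x)"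

lemma H_subspace: "subspace H"
  using cartan by (simp add: cartan_subalgebra_def toral_def lie_subalgebra_def)

lemma H_commute: "x \<in> H \<Longrightarrow> y \<in> H \<Longrightarrow> brk x y = 0"
  using cartan by (simp add: cartan_subalgebra_def toral_def)

lemma alpha_dual: "i \<in> I \<Longrightarrow> alpha i \<in> dual_space scale H"
  using simple_roots by (auto simp: roots_def weights_def)

lemma roots_dual: "beta \<in> roots scale brk H \<Longrightarrow> beta \<in> dual_space scale H"
  by (auto simp: roots_def weights_def)

lemma alpha_outside: "i \<in> I \<Longrightarrow> x \<notin> H \<Longrightarrow> alpha i x = 0"
  using alpha_dual by (auto simp: dual_space_def)

text \<open>Equality is asked for on H only, because weight vectors determine their weights only
  there; off H the simple roots vanish by the convention of \<open>dual_space\<close>.\<close>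

lemma root_comb_inject:
  assumes "\<And>x. x \<in> H \<Longrightarrow> root_comb c x = root_comb d x" "i \<in> I"
  shows "c i = d i"
proof -
  have "(\<Sum>i\<in>I. (c i - d i) * alpha i x) = 0" for x
  proof (cases "x \<in> H")
    case True
    then show ?thesis using assms(1)[of x] by (simp add: root_comb_def left_diff_distrib sum_subtractf)
  qed (simp add: alpha_outside)
  then show ?thesis using simple_roots_independent[of "\<lambda>i. c i - d i"] assms(2) by simp
qed

lemma root_comb_add: "root_comb c x + root_comb d x = root_comb (\<lambda>i. c i + d i) x"
  by (simp add: root_comb_def sum.distrib distrib_right)

lemma root_comb_diff: "root_comb c x - root_comb d x = root_comb (\<lambda>i. c i - d i) x"
  by (simp add: root_comb_def sum_subtractf left_diff_distrib)

lemma root_comb_uminus: "- root_comb c x = root_comb (\<lambda>i. - c i) x"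
  by (simp add: root_comb_def sum_negf)

lemma root_comb_mult: "a * root_comb c x = root_comb (\<lambda>i. a * c i) x"
  by (simp add: root_comb_def sum_distrib_left mult.assoc)

lemma root_comb_zero: "root_comb (\<lambda>i. 0) x = 0"
  by (simp add: root_comb_def)

lemma root_comb_single:
  assumes "j \<in> I"
  shows "root_comb (\<lambda>i. if i = j then a else 0) x = a * alpha j x"
  using assms finite_index by (simp add: root_comb_def if_distrib[of "\<lambda>t. t * _"] cong: if_cong)

lemma nonneg_cone_iff:
  assumes "J \<subseteq> I"
  shows "beta \<in> nonneg_cone alpha J \<longleftrightarrow>
    (\<exists>c. beta = root_comb (\<lambda>i. of_nat (c i)) \<and> (\<forall>i. i \<notin> J \<longrightarrow> c i = 0))"
proof
  assume "beta \<in> nonneg_cone alpha J"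
  then obtain c where c: "beta = (\<lambda>x. \<Sum>j\<in>J. of_nat (c j) * alpha j x)" by (auto simp: nonneg_cone_def)
  let ?d = "\<lambda>i. if i \<in> J then c i else 0"
  have "beta = root_comb (\<lambda>i. of_nat (?d i))"
    unfolding c root_comb_def using assms finite_index by (intro ext sum.mono_neutral_cong_left) auto
  then show "\<exists>c. beta = root_comb (\<lambda>i. of_nat (c i)) \<and> (\<forall>i. i \<notin> J \<longrightarrow> c i = 0)"
    by (intro exI[of _ ?d]) auto
next
  assume "\<exists>c. beta = root_comb (\<lambda>i. of_nat (c i)) \<and> (\<forall>i. i \<notin> J \<longrightarrow> c i = 0)"
  then obtain c where c: "beta = root_comb (\<lambda>i. of_nat (c i))" "\<forall>i. i \<notin> J \<longrightarrow> c i = 0" by auto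
  have "beta = (\<lambda>x. \<Sum>j\<in>J. of_nat (c j) * alpha j x)"
    unfolding c(1) root_comb_def using assms finite_index c(2)
    by (intro ext sum.mono_neutral_cong_right) auto
  then show "beta \<in> nonneg_cone alpha J" by (auto simp: nonneg_cone_def)
qed

lemma alpha_root_comb:
  assumes i: "i \<in> I"
  shows "alpha i = root_comb (\<lambda>k. of_nat (if k = i then 1 else 0))"
proof -
  have "(\<lambda>k. of_nat (if k = i then 1 else 0)) = (\<lambda>k. if k = i then 1 else (0::complex))" by auto
  then show ?thesis by (simp only: fun_eq_iff root_comb_single[OF i] mult_1) simp
qed

lemma alpha_in_cone:
  assumes i: "i \<in> I"
  shows "alpha i \<in> nonneg_cone alpha I"
  unfolding nonneg_cone_iff[OF subset_refl] using i alpha_root_comb[OF i]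
  by (intro exI[of _ "\<lambda>k. if k = i then 1 else 0"]) auto

lemma cone_antisym:
  assumes "beta \<in> nonneg_cone alpha I" "(\<lambda>x. - beta x) \<in> nonneg_cone alpha I"
  shows "beta = (\<lambda>x. 0)"
proof -
  obtain c d where c: "beta = root_comb (\<lambda>i. of_nat (c i))" "(\<lambda>x. - beta x) = root_comb (\<lambda>i. of_nat (d i))"
    using assms nonneg_cone_iff[OF subset_refl] by blast
  have e: "root_comb (\<lambda>i. of_nat (c i + d i)) x = root_comb (\<lambda>i. 0) x" for x
  proof -
    have b1: "beta x = root_comb (\<lambda>i. of_nat (c i)) x" and b2: "- beta x = root_comb (\<lambda>i. of_nat (d i)) x"
      using c by metis+
    have "root_comb (\<lambda>i. of_nat (c i + d i)) x = beta x + - beta x"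
      by (simp only: of_nat_add root_comb_add[symmetric] b1[symmetric] b2[symmetric])
    then show ?thesis by (simp add: root_comb_zero)
  qed
  have "c i = 0" if "i \<in> I" for i
    using root_comb_inject[OF e that] unfolding of_nat_eq_0_iff by simp
  then show ?thesis by (simp add: c(1) root_comb_def)
qed

lemma root_nonzero: "beta \<in> roots scale brk H \<Longrightarrow> beta \<noteq> (\<lambda>x. 0)"
  by (simp add: roots_def)

lemma alpha_root: "i \<in> I \<Longrightarrow> alpha i \<in> roots scale brk H"
  using simple_roots by auto

lemma dual_space_eqI:
  assumes "mu \<in> dual_space scale H" "nu \<in> dual_space scale H" "\<And>x. x \<in> H \<Longrightarrow> mu x = nu x"
  shows "mu = nu"
proof
  fix x show "mu x = nu x" using assms by (cases "x \<in> H") (auto simp: dual_space_def)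
qed

lemma finite_roots: "finite (roots scale brk H)"
proof -
  obtain B where B: "finite B" "span B = UNIV" using finite_dimensional by auto
  show ?thesis
  proof (rule ad.finite_weights[OF B, of _ H])
    fix mu assume "mu \<in> roots scale brk H"
    then show "\<exists>u. u \<noteq> 0 \<and> u \<in> weight_space H scale brk mu"
      using ad.weight_space_subspace[of H mu] subspace_0 by (auto simp: roots_def weights_def)
  next
    fix mu nu assume "mu \<in> roots scale brk H" "nu \<in> roots scale brk H" "mu \<noteq> nu"
    then show "\<exists>x\<in>H. mu x \<noteq> nu x" using dual_space_eqI roots_dual by blast
  qed
qed

lemma H_weight_zero: "x \<in> H \<Longrightarrow> x \<in> weight_space H scale brk (\<lambda>x. 0)"
  by (simp add: weight_space_def H_commute)

lemma span_weight_vectors: "span (\<Union>mu. weight_space H scale brk mu) = UNIV"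
proof -
  let ?S = "span (\<Union>mu. weight_space H scale brk mu)"
  have "nilradical_pos scale brk H I alpha \<subseteq> ?S" "nilradical_neg scale brk H I alpha \<subseteq> ?S"
    unfolding nilradical_pos_def nilradical_neg_def by (rule span_mono, blast)+
  moreover have "H \<subseteq> ?S"
    by (intro subsetI span_base UN_I[of "\<lambda>x. 0"] H_weight_zero) auto
  ultimately have sub: "a + b + c \<in> ?S" if "a \<in> nilradical_pos scale brk H I alpha" "b \<in> H"
      "c \<in> nilradical_neg scale brk H I alpha" for a b c
    using that by (intro span_add) (rule subsetD, assumption, assumption)+
  have "x \<in> ?S" for x
    using ex1_implies_ex[OF triangular_decomposition[of x]] sub by auto
  then show ?thesis by (intro UNIV_eq_I[symmetric])
qed

text \<open>On a weight vector, powers that never vanish would have the infinitely many weights mu +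
  n gamma, which z separates. The nilpotent vectors form a subspace, and the weight vectors
  span.\<close>

lemma ad_root_vector_nilpotent:
  assumes x: "x \<in> weight_space H scale brk gamma" and z: "z \<in> H" "gamma z \<noteq> 0"
  shows "\<exists>n. (brk x ^^ n) y = 0"
proof -
  obtain B where B: "finite B" "span B = UNIV" using finite_dimensional by auto
  have w: "\<exists>n. (brk x ^^ n) y = 0" if y: "y \<in> weight_space H scale brk mu" for y mu
  proof (rule ccontr)
    assume ne: "\<nexists>n. (brk x ^^ n) y = 0"
    let ?nu = "\<lambda>n x. mu x + of_nat n * gamma x"
    have d: "k = l" if "?nu k z = ?nu l z" for k l using that z by simp
    have "finite (range ?nu)"
    proof (rule ad.finite_weights[OF B])
      fix m n assume "m \<in> range ?nu" "n \<in> range ?nu" "m \<noteq> n"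
      then obtain k l where kl: "m = ?nu k" "n = ?nu l" "k \<noteq> l" by auto
      then have "m z \<noteq> n z" using z by simp
      then show "\<exists>x\<in>H. m x \<noteq> n x" using z(1) by blast
    next
      fix m assume "m \<in> range ?nu"
      then obtain k where "m = ?nu k" by auto
      then show "\<exists>u. u \<noteq> 0 \<and> u \<in> weight_space H scale brk m"
        using ad.weight_space_funpow[OF x y, of k] ne by blast
    qed
    moreover have "inj ?nu"
    proof (rule injI)
      fix k l assume "?nu k = ?nu l"
      then show "k = l" by (intro d) (rule fun_cong)
    qed
    ultimately show False using finite_imageD by (metis infinite_UNIV_nat)
  qed
  have "span (\<Union>mu. weight_space H scale brk mu) \<subseteq> {y. \<exists>n. (brk x ^^ n) y = 0}"
    by (rule span_minimal[OF _ ad.nilpotent_vectors_subspace]) (use w in auto)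
  then show ?thesis using span_weight_vectors by auto
qed

lemma ad_xp_nilpotent: "i \<in> I \<Longrightarrow> \<exists>n. (brk (xp i) ^^ n) y = 0"
  by (rule ad_root_vector_nilpotent[OF xp_root_vector coroot_in_H]) (auto simp: coroot)

lemma ad_xm_nilpotent: "i \<in> I \<Longrightarrow> \<exists>n. (brk (xm i) ^^ n) y = 0"
  by (rule ad_root_vector_nilpotent[OF xm_root_vector coroot_in_H]) (auto simp: coroot)

lemma brk_H_xp: "i \<in> I \<Longrightarrow> x \<in> H \<Longrightarrow> brk x (xp i) = scale (alpha i x) (xp i)"
  using xp_root_vector by (simp add: weight_space_def)

lemma brk_H_xm: "i \<in> I \<Longrightarrow> x \<in> H \<Longrightarrow> brk x (xm i) = scale (- alpha i x) (xm i)"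
  using xm_root_vector by (simp add: weight_space_def)

lemma sl2_relations:
  assumes "i \<in> I"
  shows "brk (xp i) (xm i) = h i" "brk (h i) (xm i) = scale (-2) (xm i)" "brk (h i) (xp i) = scale 2 (xp i)"
  using assms brk_xp_xm brk_H_xp[OF assms coroot_in_H] brk_H_xm[OF assms coroot_in_H] coroot by auto

lemma sl2_relations_opposite:
  assumes "i \<in> I"
  shows "brk (xm i) (xp i) = - h i" "brk (- h i) (xp i) = scale (-2) (xp i)" "brk (- h i) (xm i) = scale 2 (xm i)"
  using sl2_relations[OF assms] brk_swap[of "xm i" "xp i"] ad.act_left_uminus by auto

lemma simple_reflection_root_comb:
  assumes "j \<in> I"
  shows "simple_reflection alpha h j (root_comb c) = root_comb (\<lambda>i. c i - (if i = j then root_comb c (h j) else 0))"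
  unfolding simple_reflection_def root_comb_diff[symmetric] root_comb_single[OF assms] by simp

lemma xm_nonzero: "i \<in> I \<Longrightarrow> xm i \<noteq> 0"
proof
  assume i: "i \<in> I" "xm i = 0"
  then have "h i = 0" using brk_xp_xm[of i i] ad.actm.zero by simp
  moreover have "alpha i (0 + 0) = alpha i 0 + alpha i 0"
    using alpha_dual[OF i(1)] subspace_0[OF H_subspace] unfolding dual_space_def by blast
  ultimately show False using coroot[OF i(1)] by simp
qed

end

locale semisimple_module =
  semisimple_lie_algebra scale brk H I alpha xp xm h + lie_module scale brk vscale act
  for scale :: "complex \<Rightarrow> 'g::ab_group_add \<Rightarrow> 'g" and brk :: "'g \<Rightarrow> 'g \<Rightarrow> 'g"
    and H :: "'g set" and I :: "'i set" and alpha :: "'i \<Rightarrow> 'g \<Rightarrow> complex" and xp xm h :: "'i \<Rightarrow> 'g"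
    and vscale :: "complex \<Rightarrow> 'v::ab_group_add \<Rightarrow> 'v" and act :: "'g \<Rightarrow> 'v \<Rightarrow> 'v"
begin

lemma weight_in_weights:
  assumes "mu \<in> dual_space scale H" "u \<in> weight_space H vscale act mu" "u \<noteq> 0"
  shows "mu \<in> weights scale H vscale act"
  using assms by (auto simp: weights_def)

lemma weights_obtain:
  assumes "mu \<in> weights scale H vscale act"
  obtains u where "u \<in> weight_space H vscale act mu" "u \<noteq> 0"
proof -
  have "0 \<in> weight_space H vscale act mu" using weight_space_subspace V.subspace_0 by blast
  with assms that show ?thesis by (auto simp: weights_def)
qed

text \<open>The triple (\<open>xp i\<close>, \<open>xm i\<close>, \<open>h i\<close>) shows that mu
  (h i) is an integer and settles the nonnegative case; the opposite triple with -\<open>h i\<close>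
  settles the negative one. The p steps in one direction are undone in the other, so p cancels from
  the weight that is reached.\<close>

lemma simple_reflection_weight:
  assumes i: "i \<in> I" and mu: "mu \<in> weights scale H vscale act"
    and e: "locally_nilpotent (xp i)" and f: "locally_nilpotent (xm i)"
  shows "simple_reflection alpha h i mu \<in> weights scale H vscale act"
proof -
  obtain u where u: "u \<in> weight_space H vscale act mu" "u \<noteq> 0" using weights_obtain[OF mu] .
  have mud: "mu \<in> dual_space scale H" using mu by (simp add: weights_def)
  have hu: "act (h i) u = vscale (mu (h i)) u" using u coroot_in_H[OF i] by (simp add: weight_space_def)
  obtain a b where a: "(act (xp i) ^^ a) u = 0" and b: "(act (xm i) ^^ b) u = 0"
    using e f unfolding locally_nilpotent_def by blast
  note down = reflected_string_vector[OF sl2_relations[OF i] u(2) hu a f]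
  have "act (- h i) u = vscale (- mu (h i)) u" by (simp add: act_left_uminus hu)
  note up = reflected_string_vector[OF sl2_relations_opposite[OF i] u(2) this b e]
  have refl: "simple_reflection alpha h i mu \<in> dual_space scale H"
    using dual_space_add_mult[OF mud alpha_dual[OF i], of "- mu (h i)"] by (simp add: simple_reflection_def)
  obtain z where z: "mu (h i) = of_int z" using down by (auto elim: Ints_cases)
  show ?thesis
  proof (cases "z \<ge> 0")
    case True
    then have z': "mu (h i) = of_nat (nat z)" using z by simp
    then obtain p where p: "(act (xm i) ^^ (p + nat z)) ((act (xp i) ^^ p) u) \<noteq> 0" using down by blast
    have "(act (xm i) ^^ (p + nat z)) ((act (xp i) ^^ p) u) \<in> weight_space H vscale act
        (\<lambda>y. (mu y + of_nat p * alpha i y) + of_nat (p + nat z) * (- alpha i y))"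
      by (intro weight_space_funpow xp_root_vector xm_root_vector i u)
    also have "(\<lambda>y. (mu y + of_nat p * alpha i y) + of_nat (p + nat z) * (- alpha i y))
        = simple_reflection alpha h i mu"
      by (simp add: simple_reflection_def z' fun_eq_iff algebra_simps)
    finally show ?thesis using weight_in_weights[OF refl _ p] by simp
  next
    case False
    then have z': "- mu (h i) = of_nat (nat (- z))" using z by simp
    then obtain p where p: "(act (xp i) ^^ (p + nat (- z))) ((act (xm i) ^^ p) u) \<noteq> 0" using up by blast
    have "(act (xp i) ^^ (p + nat (- z))) ((act (xm i) ^^ p) u) \<in> weight_space H vscale act
        (\<lambda>y. (mu y + of_nat p * (- alpha i y)) + of_nat (p + nat (- z)) * alpha i y)"
      by (intro weight_space_funpow xp_root_vector xm_root_vector i u)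
    also have "(\<lambda>y. (mu y + of_nat p * (- alpha i y)) + of_nat (p + nat (- z)) * alpha i y)
        = (\<lambda>y. mu y - (- of_nat (nat (- z))) * alpha i y)"
      by (simp add: fun_eq_iff algebra_simps)
    also have "\<dots> = simple_reflection alpha h i mu"
      unfolding z'[symmetric] by (simp add: simple_reflection_def)
    finally show ?thesis using weight_in_weights[OF refl _ p] by simp
  qed
qed

end

section \<open>The Weyl group acting on the roots\<close>

context semisimple_lie_algebra
begin

text \<open>Roots are the nonzero weights of the adjoint module, where root vectors act
  nilpotently.\<close>

lemma simple_reflection_root:
  assumes i: "i \<in> I" and b: "beta \<in> roots scale brk H"
  shows "simple_reflection alpha h i beta \<in> roots scale brk H"
proof -
  interpret adj: semisimple_module scale brk H I alpha xp xm h scale brk by unfold_locales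
  have "simple_reflection alpha h i beta \<in> weights scale H scale brk"
    using adj.simple_reflection_weight[OF i] ad_xp_nilpotent[OF i] ad_xm_nilpotent[OF i] b
    by (simp add: roots_def ad.locally_nilpotent_def)
  moreover have "simple_reflection alpha h i beta \<noteq> (\<lambda>x. 0)"
  proof
    assume e: "simple_reflection alpha h i beta = (\<lambda>x. 0)"
    have "beta (h i) = 0" using fun_cong[OF e, of "h i"] coroot[OF i] by (simp add: simple_reflection_def)
    then have "beta = (\<lambda>x. 0)" using e by (simp add: simple_reflection_def)
    then show False using root_nonzero[OF b] by simp
  qed
  ultimately show ?thesis by (simp add: roots_def)
qed

lemma weyl_group_root:
  assumes "w \<in> weyl_group alpha h J" "J \<subseteq> I" "beta \<in> roots scale brk H"
  shows "w beta \<in> roots scale brk H"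
  using assms by induction (auto simp: simple_reflection_root)

text \<open>The reflection changes only the coefficient at j, and beta has a positive coefficient
  somewhere else, which decides the sign of the new root. All natural multiples of alpha_j are
  excluded, as nothing has been said about which of them are roots.\<close>

lemma simple_reflection_positive_root:
  assumes j: "j \<in> I" and b: "beta \<in> positive_roots scale brk H I alpha"
    and ne: "\<And>a. beta \<noteq> (\<lambda>x. of_nat a * alpha j x)"
  shows "simple_reflection alpha h j beta \<in> positive_roots scale brk H I alpha"
proof -
  obtain c where c: "beta = root_comb (\<lambda>i. of_nat (c i))" "\<And>i. i \<notin> I \<Longrightarrow> c i = 0"
    using b nonneg_cone_iff[OF subset_refl] by (auto simp: positive_roots_def)
  obtain i where i: "i \<in> I" "i \<noteq> j" "c i \<noteq> 0"
  proof (rule ccontr)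
    assume n: "\<not> thesis"
    have "c i = 0" if "i \<noteq> j" for i using n \<open>\<And>i. i \<in> I \<Longrightarrow> i \<noteq> j \<Longrightarrow> c i \<noteq> 0 \<Longrightarrow> thesis\<close> c(2) that by blast
    then have "(\<lambda>i. of_nat (c i)) = (\<lambda>i. if i = j then of_nat (c j) else (0::complex))"
      by (intro ext) simp
    then have "root_comb (\<lambda>i. of_nat (c i)) = root_comb (\<lambda>i. if i = j then of_nat (c j) else 0)"
      by (rule arg_cong)
    also have "\<dots> = (\<lambda>x. of_nat (c j) * alpha j x)" by (rule ext) (rule root_comb_single[OF j])
    finally have "beta = (\<lambda>x. of_nat (c j) * alpha j x)" by (simp only: c(1))
    then show False using ne by blast
  qed
  let ?s = "simple_reflection alpha h j beta"
  have s: "?s \<in> roots scale brk H" using simple_reflection_root[OF j] b by (auto simp: positive_roots_def)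
  have "(\<lambda>x. - ?s x) \<notin> nonneg_cone alpha I"
  proof
    assume "(\<lambda>x. - ?s x) \<in> nonneg_cone alpha I"
    then obtain d where d: "(\<lambda>x. - ?s x) = root_comb (\<lambda>i. of_nat (d i))"
      using nonneg_cone_iff[OF subset_refl] by blast
    have "root_comb (\<lambda>i. - (of_nat (c i) - (if i = j then beta (h j) else 0))) x = root_comb (\<lambda>i. of_nat (d i)) x" for x
      unfolding d[symmetric] c(1) simple_reflection_root_comb[OF j] root_comb_uminus by simp
    from root_comb_inject[OF this i(1)] i(2) have "- of_nat (c i) = (of_nat (d i) :: complex)" by simp
    then have "of_nat (c i + d i) = (0::complex)" by (metis add.right_inverse of_nat_add)
    then show False unfolding of_nat_eq_0_iff using i by simp
  qed
  then show ?thesis using simple_roots_base[OF s] s by (auto simp: positive_roots_def)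
qed

text \<open>A Weyl group element inverting as many positive roots as possible plays the role of the
  longest element of \<open>W\<^sub>J\<close>.\<close>

lemma longest_element:
  assumes J: "J \<subseteq> I"
  obtains w where "w \<in> weyl_group alpha h J" "\<And>j. j \<in> J \<Longrightarrow> (\<lambda>x. - w (alpha j) x) \<in> nonneg_cone alpha I"
proof -
  let ?P = "positive_roots scale brk H I alpha"
  define N where "N w = {beta \<in> ?P. (\<lambda>x. - w beta x) \<in> nonneg_cone alpha I}" for w
  have fin: "finite ?P" using finite_roots by (simp add: positive_roots_def)
  have "\<exists>w. w \<in> weyl_group alpha h J \<and> (\<forall>w'. w' \<in> weyl_group alpha h J \<longrightarrow> card (N w') \<le> card (N w))"
  proof (rule ex_has_greatest_nat)
    show "id \<in> weyl_group alpha h J" by (rule weyl_group.one)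
    \<comment> \<open>The count is bounded by the number of positive roots, so a maximum
      exists.\<close>
    show "\<forall>w. w \<in> weyl_group alpha h J \<longrightarrow> card (N w) < Suc (card ?P)"
      using card_mono[OF fin] by (auto simp: N_def less_Suc_eq_le)
  qed
  then obtain w where w: "w \<in> weyl_group alpha h J"
    and max: "\<And>w'. w' \<in> weyl_group alpha h J \<Longrightarrow> card (N w') \<le> card (N w)" by blast
  have "(\<lambda>x. - w (alpha j) x) \<in> nonneg_cone alpha I" if j: "j \<in> J" for j
  proof (rule ccontr)
    assume neg: "(\<lambda>x. - w (alpha j) x) \<notin> nonneg_cone alpha I"
    have jI: "j \<in> I" using j J by auto
    let ?s = "simple_reflection alpha h j"
    have invol: "?s (?s mu) = mu" for mu by (rule simple_reflection_involution) (rule coroot[OF jI])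
    have sj: "?s (alpha j) = (\<lambda>x. - alpha j x)" by (simp add: simple_reflection_def coroot[OF jI] fun_eq_iff)
    have pos: "w (alpha j) \<in> nonneg_cone alpha I"
      using neg simple_roots_base[OF weyl_group_root[OF w J alpha_root[OF jI]]] by auto
    \<comment> \<open>If w alpha_j is positive, then w s_j inverts alpha_j and also s_j beta for
      each beta inverted by w, one root more than w does.\<close>
    have aN: "alpha j \<in> N (w \<circ> ?s)"
      using pos alpha_root[OF jI] alpha_in_cone[OF jI]
      by (simp add: N_def positive_roots_def sj weyl_group_uminus[OF w])
    have sN: "?s beta \<in> N (w \<circ> ?s)" if b: "beta \<in> N w" for beta
    proof -
      \<comment> \<open>A multiple of alpha_j would be sent by w into the positive cone, but w
        inverts beta.\<close>
      have "beta \<noteq> (\<lambda>x. of_nat a * alpha j x)" for a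
      proof
        assume e: "beta = (\<lambda>x. of_nat a * alpha j x)"
        have "w beta = (\<lambda>x. w (\<lambda>x. 0) x + of_nat a * w (alpha j) x)"
          using weyl_group_add_mult[OF w, of "\<lambda>x. 0" "of_nat a" "alpha j"] by (simp add: e)
        also have "w (\<lambda>x. 0) = (\<lambda>x. 0)"
          using weyl_group_add_mult[OF w, of "\<lambda>x. 0" "-1" "\<lambda>x. 0"] by simp
        finally have "w beta = (\<lambda>x. of_nat a * w (alpha j) x)" by simp
        moreover obtain c where "w (alpha j) = root_comb (\<lambda>i. of_nat (c i))"
          using pos nonneg_cone_iff[OF subset_refl] by blast
        ultimately have "w beta = root_comb (\<lambda>i. of_nat (if i \<in> I then a * c i else 0))"
          by (simp add: fun_eq_iff root_comb_mult) (simp add: root_comb_def)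
        then have "w beta \<in> nonneg_cone alpha I"
          unfolding nonneg_cone_iff[OF subset_refl] by (intro exI[of _ "\<lambda>i. if i \<in> I then a * c i else 0"]) simp
        moreover have "w beta \<noteq> (\<lambda>x. 0)"
          using b weyl_group_root[OF w J] root_nonzero by (auto simp: N_def positive_roots_def)
        ultimately show False using cone_antisym b by (auto simp: N_def)
      qed
      then show ?thesis
        using simple_reflection_positive_root[OF jI] b by (simp add: N_def invol)
    qed
    have "alpha j \<notin> ?s ` N w"
    proof
      assume "alpha j \<in> ?s ` N w"
      then have "?s (alpha j) \<in> N w" using invol by (metis imageE)
      then have "(\<lambda>x. - alpha j x) \<in> nonneg_cone alpha I" by (simp add: sj N_def positive_roots_def)
      then show False using cone_antisym[OF alpha_in_cone[OF jI]] root_nonzero[OF alpha_root[OF jI]] by blast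
    qed
    moreover have finN: "finite (N v)" for v using fin by (simp add: N_def)
    moreover have "inj_on ?s (N w)" using invol by (metis inj_onI)
    ultimately have "card (insert (alpha j) (?s ` N w)) = Suc (card (N w))"
      by (simp add: card_image)
    moreover have "card (insert (alpha j) (?s ` N w)) \<le> card (N (w \<circ> ?s))"
      using aN sN finN by (intro card_mono) auto
    ultimately show False using max[OF weyl_group_comp_reflection[OF w j]] by simp
  qed
  with w that show ?thesis by blast
qed

end


section \<open>Highest weight modules\<close>

context semisimple_module
begin

definition neg_word :: "'i list \<Rightarrow> 'v \<Rightarrow> 'v" where
  "neg_word is u = foldr (\<lambda>i. act (xm i)) is u"

lemma neg_word_simps [simp]:
  "neg_word [] u = u" "neg_word (i # is) u = act (xm i) (neg_word is u)"
  by (simp_all add: neg_word_def)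

text \<open>This is U(n-) u, as n- is generated by the \<open>xm i\<close>.\<close>

definition neg_span :: "'v \<Rightarrow> 'v set" where
  "neg_span u = V.span {neg_word is u | is. set is \<subseteq> I}"

lemma neg_word_in_span: "set is \<subseteq> I \<Longrightarrow> neg_word is u \<in> neg_span u"
  unfolding neg_span_def by (rule V.span_base) blast

lemma neg_span_subspace: "V.subspace (neg_span u)"
  by (simp add: neg_span_def)

lemma act_neg_span:
  assumes "\<And>is. set is \<subseteq> I \<Longrightarrow> act x (neg_word is u) \<in> neg_span u" "w \<in> neg_span u"
  shows "act x w \<in> neg_span u"
proof -
  have "V.subspace {w. act x w \<in> neg_span u}"
    using neg_span_subspace[of u] unfolding V.subspace_def
    by (auto simp: actm.zero act_add_right act_scale_right)
  then have "neg_span u \<subseteq> {w. act x w \<in> neg_span u}"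
    unfolding neg_span_def[of u] using assms(1)
    by (intro V.span_minimal) (auto simp: neg_span_def[symmetric])
  then show ?thesis using assms(2) by auto
qed

lemma neg_word_weight:
  assumes "u \<in> weight_space H vscale act mu" "set is \<subseteq> I"
  shows "neg_word is u \<in> weight_space H vscale act (\<lambda>x. mu x - root_comb (\<lambda>i. of_nat (count_list is i)) x)"
  using assms(2)
proof (induction "is")
  case Nil
  then show ?case using assms(1) by (simp add: root_comb_zero)
next
  case (Cons j js)
  then have j: "j \<in> I" and js: "set js \<subseteq> I" by auto
  have e: "(\<lambda>i. of_nat (count_list (j # js) i)) =
      (\<lambda>i. of_nat (count_list js i) + (if i = j then 1 else (0::complex)))" by auto
  have "root_comb (\<lambda>i. of_nat (count_list (j # js) i)) x =
      root_comb (\<lambda>i. of_nat (count_list js i)) x + alpha j x" for x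
    unfolding e root_comb_add[symmetric] root_comb_single[OF j] by simp
  then show ?case
    using weight_space_act[OF xm_root_vector[OF j] Cons.IH[OF js]] by (simp add: diff_diff_eq)
qed

text \<open>The stabiliser of a subspace is a Lie subalgebra, so by \<open>generators\<close> it is
  enough to check Chevalley generators. An \<open>xp i\<close> is moved through the word towards u,
  which it kills; each commutator on the way is 0 or a coroot acting by a scalar.\<close>

lemma primitive_submodule:
  assumes u: "u \<in> weight_space H vscale act mu" and e: "\<And>i. i \<in> I \<Longrightarrow> act (xp i) u = 0"
  shows "submodule (neg_span u)"
proof -
  let ?S = "neg_span u"
  define X where "X = {x. \<forall>w\<in>?S. act x w \<in> ?S}"
  have "lie_subalgebra X"
    using neg_span_subspace[of u]
    by (auto simp: X_def lie_subalgebra_def subspace_def act_left_zero act_add_left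
        act_scale_left act_brk V.subspace_0 V.subspace_add V.subspace_scale V.subspace_diff)
  moreover have xm: "xm i \<in> X" if "i \<in> I" for i
  proof -
    have "act (xm i) (neg_word is u) \<in> ?S" if "set is \<subseteq> I" for "is"
      using neg_word_in_span[of "i # is" u] that \<open>i \<in> I\<close> by simp
    then show ?thesis unfolding X_def using act_neg_span by blast
  qed
  moreover have "xp i \<in> X" if i: "i \<in> I" for i
  proof -
    have "act (xp i) (neg_word is u) \<in> ?S" if "set is \<subseteq> I" for "is"
      using that
    proof (induction "is")
      case Nil
      then show ?case using e[OF i] V.subspace_0[OF neg_span_subspace] by simp
    next
      case (Cons j js)
      then have j: "j \<in> I" and js: "set js \<subseteq> I" by auto
      let ?w = "neg_word js u"
      have "act (xp i) (act (xm j) ?w) = act (brk (xp i) (xm j)) ?w + act (xm j) (act (xp i) ?w)"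
        by (simp add: act_brk)
      moreover have "act (brk (xp i) (xm j)) ?w \<in> ?S"
        using neg_word_weight[OF u js] neg_word_in_span[OF js] coroot_in_H[OF i] brk_xp_xm[OF i j]
          V.subspace_scale[OF neg_span_subspace] V.subspace_0[OF neg_span_subspace]
        by (auto simp: weight_space_def act_left_zero)
      moreover have "act (xm j) (act (xp i) ?w) \<in> ?S" using xm[OF j] Cons.IH[OF js] by (auto simp: X_def)
      ultimately show ?case using V.subspace_add[OF neg_span_subspace] by simp
    qed
    then show ?thesis unfolding X_def using act_neg_span by blast
  qed
  ultimately have "lie_subalgebra hull (xp ` I \<union> xm ` I) \<subseteq> X" by (intro hull_minimal) auto
  then have "X = UNIV" using generators by auto
  then show ?thesis unfolding submodule_def X_def using neg_span_subspace by blast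
qed

lemma neg_span_weight:
  assumes u: "u \<in> weight_space H vscale act mu" and w: "w \<in> weight_space H vscale act nu"
    "w \<noteq> 0" "w \<in> neg_span u"
  obtains c where "\<And>x. x \<in> H \<Longrightarrow> nu x = mu x - root_comb (\<lambda>i. of_nat (c i)) x"
proof -
  let ?S = "{\<lambda>x. mu x - root_comb (\<lambda>i. of_nat (count_list is i)) x | is. set is \<subseteq> I}"
  have "{neg_word is u | is. set is \<subseteq> I} \<subseteq> (\<Union>nu\<in>?S. weight_space H vscale act nu)"
    using neg_word_weight[OF u] by blast
  then have sp: "w \<in> V.span (\<Union>nu\<in>?S. weight_space H vscale act nu)"
    using w(3) unfolding neg_span_def by (rule subsetD[OF V.span_mono])
  obtain nu' where "nu' \<in> ?S" "\<And>x. x \<in> H \<Longrightarrow> nu' x = nu x"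
    using weight_vector_in_span_eq_zero[OF w(1) sp] w(2) by blast
  moreover from this(1) obtain "is" where "nu' = (\<lambda>x. mu x - root_comb (\<lambda>i. of_nat (count_list is i)) x)"
    by blast
  ultimately show ?thesis using that[of "count_list is"] by simp
qed

end

text \<open>A nonzero quotient of M(\<lambda>) with v0 as the image of 1. Generation is phrased
  through submodules, so that a property preserved by the action can be checked on v0 alone.\<close>

locale highest_weight_setup = semisimple_module scale brk H I alpha xp xm h vscale act
  for scale :: "complex \<Rightarrow> 'g::ab_group_add \<Rightarrow> 'g" and brk :: "'g \<Rightarrow> 'g \<Rightarrow> 'g"
    and H :: "'g set" and I :: "'i set" and alpha :: "'i \<Rightarrow> 'g \<Rightarrow> complex" and xp xm h :: "'i \<Rightarrow> 'g"
    and vscale :: "complex \<Rightarrow> 'v::ab_group_add \<Rightarrow> 'v" and act :: "'g \<Rightarrow> 'v \<Rightarrow> 'v" +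
  fixes lam :: "'g \<Rightarrow> complex" and v0 :: 'v
  assumes lam_dual: "lam \<in> dual_space scale H"
    and v0_nonzero: "v0 \<noteq> 0"
    and v0_weight: "v0 \<in> weight_space H vscale act lam"
    and v0_primitive: "\<And>i. i \<in> I \<Longrightarrow> act (xp i) v0 = 0"
    and v0_generates: "\<And>S. submodule S \<Longrightarrow> v0 \<in> S \<Longrightarrow> S = UNIV"
begin

abbreviation wt :: "('g \<Rightarrow> complex) set" where
  "wt \<equiv> weights scale H vscale act"

abbreviation wt_on :: "'i set \<Rightarrow> ('g \<Rightarrow> complex) set" where
  "wt_on J \<equiv> weights_J scale H alpha lam vscale act J"

lemma v0_in_neg_span: "v0 \<in> neg_span v0"
  using neg_word_in_span[of "[]" v0] by simp

lemma neg_span_v0: "neg_span v0 = UNIV"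
  by (rule v0_generates[OF primitive_submodule[OF v0_weight v0_primitive] v0_in_neg_span])

lemma below_dual: "(\<lambda>x. lam x - root_comb c x) \<in> dual_space scale H"
proof -
  have "root_comb c \<in> dual_space scale H"
  proof -
    have "(\<lambda>x. \<Sum>i\<in>A. c i * alpha i x) \<in> dual_space scale H" if "finite A" "A \<subseteq> I" for A
      using that
    proof (induction A rule: finite_induct)
      case (insert a A)
      then show ?case
        using dual_space_add_mult[of "\<lambda>x. \<Sum>i\<in>A. c i * alpha i x" scale H "alpha a" "c a"] alpha_dual[of a]
        by (simp add: add.commute)
    qed (simp add: dual_space_def)
    then show ?thesis unfolding root_comb_def using finite_index by blast
  qed
  from dual_space_add_mult[OF lam_dual this, of "-1"] show ?thesis by simp
qed

lemma weight_below:
  assumes mu: "mu \<in> wt"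
  obtains c where "mu = (\<lambda>x. lam x - root_comb (\<lambda>i. of_nat (c i)) x)"
proof -
  obtain u where u: "u \<in> weight_space H vscale act mu" "u \<noteq> 0" using weights_obtain[OF mu] .
  obtain c where "\<And>x. x \<in> H \<Longrightarrow> mu x = lam x - root_comb (\<lambda>i. of_nat (c i)) x"
    using neg_span_weight[OF v0_weight u] neg_span_v0 by auto
  moreover have "mu \<in> dual_space scale H" using mu by (simp add: weights_def)
  ultimately have "mu = (\<lambda>x. lam x - root_comb (\<lambda>i. of_nat (c i)) x)"
    by (intro dual_space_eqI below_dual) auto
  then show ?thesis using that by blast
qed

lemma wt_on_iff:
  assumes "J \<subseteq> I"
  shows "mu \<in> wt_on J \<longleftrightarrow> mu \<in> wt \<and>
    (\<exists>c. mu = (\<lambda>x. lam x - root_comb (\<lambda>i. of_nat (c i)) x) \<and> (\<forall>i. i \<notin> J \<longrightarrow> c i = 0))"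
  unfolding weights_J_def weights_below_def Int_iff mem_Collect_eq nonneg_cone_iff[OF assms] by blast

lemma below_inject:
  assumes "(\<lambda>x. lam x - root_comb c x) = (\<lambda>x. lam x - root_comb d x)" "i \<in> I"
  shows "c i = d i"
proof (rule root_comb_inject[OF _ assms(2)])
  show "root_comb c x = root_comb d x" for x using fun_cong[OF assms(1), of x] by simp
qed

lemma lam_in_wt: "lam \<in> wt"
  using weight_in_weights[OF lam_dual v0_weight v0_nonzero] .

lemma lam_in_wt_on: "J \<subseteq> I \<Longrightarrow> lam \<in> wt_on J"
  unfolding wt_on_iff by (intro conjI lam_in_wt exI[of _ "\<lambda>i. 0"]) (auto simp: root_comb_zero)

lemma xm_string_in_wt_on:
  assumes J: "J \<subseteq> I" and j: "j \<in> J" and ne: "(act (xm j) ^^ k) v0 \<noteq> 0"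
  shows "(\<lambda>x. lam x - of_nat k * alpha j x) \<in> wt_on J"
proof -
  have jI: "j \<in> I" using J j by auto
  have "(\<lambda>i. of_nat (if i = j then k else 0)) = (\<lambda>i. if i = j then of_nat k else (0::complex))" by auto
  then have e: "(\<lambda>x. lam x - of_nat k * alpha j x) = (\<lambda>x. lam x - root_comb (\<lambda>i. of_nat (if i = j then k else 0)) x)"
    by (simp only: root_comb_single[OF jI])
  have "(act (xm j) ^^ k) v0 \<in> weight_space H vscale act (\<lambda>x. lam x - of_nat k * alpha j x)"
    using weight_space_funpow[OF xm_root_vector[OF jI] v0_weight, of k] by simp
  then have "(\<lambda>x. lam x - of_nat k * alpha j x) \<in> wt"
    using weight_in_weights[OF _ _ ne] below_dual unfolding e by blast
  then show ?thesis
    unfolding wt_on_iff[OF J] using e j by (intro conjI exI[of _ "\<lambda>i. if i = j then k else 0"]) auto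
qed

lemma xp_locally_nilpotent:
  assumes "i \<in> I"
  shows "locally_nilpotent (xp i)"
proof -
  have "(act (xp i) ^^ 1) v0 = 0" using v0_primitive[OF assms] by simp
  then show ?thesis
    using v0_generates[OF nilpotent_vectors_submodule[OF ad_xp_nilpotent[OF assms]]]
    unfolding locally_nilpotent_def by blast
qed

lemma xm_locally_nilpotent:
  assumes "i \<in> I" "(act (xm i) ^^ k) v0 = 0"
  shows "locally_nilpotent (xm i)"
  using v0_generates[OF nilpotent_vectors_submodule[OF ad_xm_nilpotent[OF assms(1)]]] assms(2)
  unfolding locally_nilpotent_def by blast

text \<open>The label is quantified existentially, in the form in which
  \<open>primitive_vector_label\<close> delivers it; \<open>integrable_nodes_eq\<close> translates
  to \<open>hw_label\<close>.\<close>

definition integrable_nodes :: "'i set" where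
  "integrable_nodes = {i \<in> I. \<exists>n. lam (h i) = of_nat n \<and> (act (xm i) ^^ Suc n) v0 = 0}"

lemma integrable_nodes_subset: "integrable_nodes \<subseteq> I"
  by (auto simp: integrable_nodes_def)

lemma h_v0: "i \<in> I \<Longrightarrow> act (h i) v0 = vscale (lam (h i)) v0"
  using v0_weight coroot_in_H by (simp add: weight_space_def)

text \<open>Any vanishing power will do, because the first one to vanish has exponent lam (h i) +
  1.\<close>

lemma integrable_node_if_nilpotent:
  assumes "i \<in> I" "(act (xm i) ^^ k) v0 = 0"
  shows "i \<in> integrable_nodes"
proof -
  obtain q where "lam (h i) = of_nat q" "(act (xm i) ^^ Suc q) v0 = 0"
    by (rule primitive_vector_label[OF sl2_relations(1,2)[OF assms(1)] v0_primitive[OF assms(1)]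
        h_v0[OF assms(1)] v0_nonzero assms(2)])
  then show ?thesis using assms(1) by (auto simp: integrable_nodes_def)
qed

section \<open>Stability and finiteness of the sets of weights\<close>

lemma weyl_stable_wt:
  assumes "J \<subseteq> integrable_nodes"
  shows "weyl_stable alpha h J wt"
proof (rule weyl_stableI)
  fix j mu assume j: "j \<in> J" and mu: "mu \<in> wt"
  then obtain n where n: "j \<in> I" "(act (xm j) ^^ Suc n) v0 = 0"
    using assms by (auto simp: integrable_nodes_def)
  show "simple_reflection alpha h j mu \<in> wt"
    by (rule simple_reflection_weight[OF n(1) mu xp_locally_nilpotent[OF n(1)] xm_locally_nilpotent[OF n]])
qed

lemma weyl_stable_wt_on:
  assumes J: "J \<subseteq> I" and s: "weyl_stable alpha h J wt"
  shows "weyl_stable alpha h J (wt_on J)"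
proof (rule weyl_stableI)
  fix j mu assume j: "j \<in> J" and mu: "mu \<in> wt_on J"
  obtain c where c: "mu = (\<lambda>x. lam x - root_comb (\<lambda>i. of_nat (c i)) x)" "\<And>i. i \<notin> J \<Longrightarrow> c i = 0"
    using mu wt_on_iff[OF J] by auto
  have jI: "j \<in> I" using j J by auto
  let ?s = "simple_reflection alpha h j mu"
  have s: "?s \<in> wt" using weyl_stableD[OF s j] mu wt_on_iff[OF J] by blast
  obtain d where d: "?s = (\<lambda>x. lam x - root_comb (\<lambda>i. of_nat (d i)) x)" using weight_below[OF s] .
  have "?s = (\<lambda>x. lam x - (root_comb (\<lambda>i. of_nat (c i)) x + mu (h j) * alpha j x))"
    unfolding simple_reflection_def by (simp add: c(1) diff_diff_eq)
  then have "(\<lambda>x. lam x - root_comb (\<lambda>i. of_nat (c i) + (if i = j then mu (h j) else 0)) x) =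
      (\<lambda>x. lam x - root_comb (\<lambda>i. of_nat (d i)) x)"
    unfolding root_comb_add[symmetric] root_comb_single[OF jI] d[symmetric] by simp
  from below_inject[OF this] have cd: "of_nat (c i) + (if i = j then mu (h j) else 0) = of_nat (d i)"
    if "i \<in> I" for i using that .
  \<comment> \<open>\<open>wt_on_iff\<close> asks for coefficients that vanish off J, also at
    indices outside I, where the comparison says nothing about d; there they are reset to 0.\<close>
  have "?s = (\<lambda>x. lam x - root_comb (\<lambda>i. of_nat (if i \<in> I then d i else 0)) x)"
    unfolding d by (simp add: root_comb_def)
  moreover have "(if i \<in> I then d i else 0) = 0" if "i \<notin> J" for i
  proof (cases "i \<in> I")
    case True
    have "i \<noteq> j" using that j by auto
    then have "(of_nat (d i) :: complex) = 0" using cd[OF True] c(2)[OF that] by simp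
    then show ?thesis by simp
  qed simp
  ultimately show "?s \<in> wt_on J"
    unfolding wt_on_iff[OF J] using s by (intro conjI exI[of _ "\<lambda>i. if i \<in> I then d i else 0"]) auto
qed

text \<open>That s_j lam is a weight makes lam (h j) a natural number n. If the power n + 1 did not
  kill v0, then lam - (n+1) alpha_j would be a weight, and its reflection lam + alpha_j would be a
  weight not below lam.\<close>

lemma integrable_if_weyl_stable:
  assumes J: "J \<subseteq> I" and s: "weyl_stable alpha h J (wt_on J)"
  shows "J \<subseteq> integrable_nodes"
proof
  fix j assume j: "j \<in> J"
  then have jI: "j \<in> I" using J by auto
  have "simple_reflection alpha h j lam \<in> wt_on J" using weyl_stableD[OF s j lam_in_wt_on[OF J]] .
  then obtain c where c: "simple_reflection alpha h j lam = (\<lambda>x. lam x - root_comb (\<lambda>i. of_nat (c i)) x)"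
    using wt_on_iff[OF J] by blast
  then have "(\<lambda>x. lam x - root_comb (\<lambda>i. if i = j then lam (h j) else 0) x) =
      (\<lambda>x. lam x - root_comb (\<lambda>i. of_nat (c i)) x)"
    unfolding root_comb_single[OF jI] by (simp add: simple_reflection_def)
  from below_inject[OF this jI] have n: "lam (h j) = of_nat (c j)" by simp
  have "(act (xm j) ^^ Suc (c j)) v0 = 0"
  proof (rule ccontr)
    assume "(act (xm j) ^^ Suc (c j)) v0 \<noteq> 0"
    from weyl_stableD[OF s j xm_string_in_wt_on[OF J j this]]
    have "simple_reflection alpha h j (\<lambda>x. lam x - of_nat (Suc (c j)) * alpha j x) \<in> wt"
      using wt_on_iff[OF J] by blast
    also have "simple_reflection alpha h j (\<lambda>x. lam x - of_nat (Suc (c j)) * alpha j x) =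
        (\<lambda>x. lam x + alpha j x)"
      by (simp add: simple_reflection_def n coroot[OF jI] fun_eq_iff algebra_simps)
    finally obtain d where "(\<lambda>x. lam x + alpha j x) = (\<lambda>x. lam x - root_comb (\<lambda>i. of_nat (d i)) x)"
      using weight_below by blast
    then have "(\<lambda>x. lam x - root_comb (\<lambda>i. if i = j then -1 else 0) x) =
        (\<lambda>x. lam x - root_comb (\<lambda>i. of_nat (d i)) x)"
      unfolding root_comb_single[OF jI] by simp
    from below_inject[OF this jI] have "of_nat (d j) = (- 1 :: complex)" by simp
    then have "of_nat (Suc (d j)) = (0::complex)" by simp
    then show False by (simp only: of_nat_eq_0_iff)
  qed
  with n jI show "j \<in> integrable_nodes" by (auto simp: integrable_nodes_def)
qed

lemma integrable_if_finite:
  assumes J: "J \<subseteq> I" and f: "finite (wt_on J)"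
  shows "J \<subseteq> integrable_nodes"
proof
  fix j assume j: "j \<in> J"
  then have jI: "j \<in> I" using J by auto
  have "\<exists>k. (act (xm j) ^^ k) v0 = 0"
  proof (rule ccontr)
    assume ne: "\<nexists>k. (act (xm j) ^^ k) v0 = 0"
    have "range (\<lambda>k x. lam x - of_nat k * alpha j x) \<subseteq> wt_on J"
      using xm_string_in_wt_on[OF J j] ne by blast
    moreover have "inj (\<lambda>k x. lam x - of_nat k * alpha j x)"
    proof (rule injI)
      fix k l assume "(\<lambda>x. lam x - of_nat k * alpha j x) = (\<lambda>x. lam x - of_nat l * alpha j x)"
      from fun_cong[OF this, of "h j"] show "k = l" using coroot[OF jI] by simp
    qed
    ultimately have "finite (UNIV :: nat set)" by (intro finite_imageD[OF finite_subset[OF _ f]])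
    then show False by simp
  qed
  then show "j \<in> integrable_nodes" using integrable_node_if_nilpotent[OF jI] by blast
qed

text \<open>If \<open>w\<close> sends \<open>\<Delta>\<^sub>J\<close> to negative roots and \<open>\<mu> = \<lambda> - \<Sum> c\<^sub>j \<alpha>\<^sub>j\<close>, then
  \<open>w \<mu> = w \<lambda> + \<Sum> c\<^sub>j (- w \<alpha>\<^sub>j) \<le> \<lambda>\<close> bounds the coefficients.\<close>

lemma finite_wt_on:
  assumes Ji: "J \<subseteq> integrable_nodes"
  shows "finite (wt_on J)"
proof -
  have J: "J \<subseteq> I" using Ji integrable_nodes_subset by auto
  have finJ: "finite J" using J finite_index finite_subset by blast
  have stable: "weyl_stable alpha h J wt" using weyl_stable_wt[OF Ji] .
  obtain w where w: "w \<in> weyl_group alpha h J"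
    and neg: "\<And>j. j \<in> J \<Longrightarrow> (\<lambda>x. - w (alpha j) x) \<in> nonneg_cone alpha I"
    using longest_element[OF J] by blast
  have wwt: "w mu \<in> wt" if "mu \<in> wt" for mu using stable w that by (auto simp: weyl_stable_def)
  have "\<exists>d. (\<lambda>x. - w (alpha j) x) = root_comb (\<lambda>i. of_nat (d i))" if "j \<in> J" for j
    using neg[OF that] nonneg_cone_iff[OF subset_refl] by blast
  then obtain d where d: "\<And>j. j \<in> J \<Longrightarrow> (\<lambda>x. - w (alpha j) x) = root_comb (\<lambda>i. of_nat (d j i))"
    by metis
  \<comment> \<open>As w alpha_j is a root, it has a nonzero coefficient; p j will be the index of
    one.\<close>
  have "\<exists>i\<in>I. d j i \<noteq> 0" if "j \<in> J" for j
  proof (rule ccontr)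
    assume "\<not> (\<exists>i\<in>I. d j i \<noteq> 0)"
    then have "(\<lambda>x. - w (alpha j) x) = (\<lambda>x. 0)" unfolding d[OF that] by (simp add: root_comb_def)
    then have "w (alpha j) = (\<lambda>x. 0)" by (simp add: fun_eq_iff)
    moreover have "w (alpha j) \<in> roots scale brk H"
      using weyl_group_root[OF w J] alpha_root J that by blast
    ultimately show False using root_nonzero by blast
  qed
  then obtain p where p: "\<And>j. j \<in> J \<Longrightarrow> p j \<in> I \<and> d j (p j) \<noteq> 0" by metis
  obtain a where a: "w lam = (\<lambda>x. lam x - root_comb (\<lambda>i. of_nat (a i)) x)"
    using weight_below[OF wwt[OF lam_in_wt]] .
  \<comment> \<open>At p j the coefficients of w mu give a = b + \<Sum> c d in natural numbers, with
    b natural because w mu is again a weight. So c j \<le> a (p j), and the sum of a over I bounds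
    all these values at once.\<close>
  have bound: "c j \<le> sum a I"
    if mu: "mu \<in> wt" "mu = (\<lambda>x. lam x - root_comb (\<lambda>i. of_nat (c i)) x)" "\<forall>i. i \<notin> J \<longrightarrow> c i = 0"
      and j: "j \<in> J" for mu c j
  proof -
    obtain b where b: "w mu = (\<lambda>x. lam x - root_comb (\<lambda>i. of_nat (b i)) x)"
      using weight_below[OF wwt[OF mu(1)]] .
    have "root_comb (\<lambda>i. of_nat (c i)) x = (\<Sum>j\<in>J. of_nat (c j) * alpha j x)" for x
      unfolding root_comb_def using J finite_index mu(3) by (intro sum.mono_neutral_cong_right) auto
    then have "mu = (\<lambda>x. lam x + (\<Sum>j\<in>J. (- of_nat (c j)) * alpha j x))"
      by (simp add: mu(2) sum_negf)
    then have "w mu = (\<lambda>x. w lam x + (\<Sum>j\<in>J. (- of_nat (c j)) * w (alpha j) x))"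
      by (simp only: weyl_group_sum[OF w finJ])
    also have "\<dots> = (\<lambda>x. w lam x + (\<Sum>j\<in>J. of_nat (c j) * root_comb (\<lambda>i. of_nat (d j i)) x))"
      by (intro ext arg_cong2[where f = "(+)"] refl sum.cong) (simp add: d[symmetric])
    also have "\<dots> = (\<lambda>x. w lam x + root_comb (\<lambda>i. of_nat (\<Sum>j\<in>J. c j * d j i)) x)"
    proof (intro ext arg_cong2[where f = "(+)"] refl)
      fix x
      show "(\<Sum>j\<in>J. of_nat (c j) * root_comb (\<lambda>i. of_nat (d j i)) x)
          = root_comb (\<lambda>i. of_nat (\<Sum>j\<in>J. c j * d j i)) x"
        unfolding root_comb_def sum_distrib_left of_nat_sum sum_distrib_right
        by (subst sum.swap) (simp add: mult.assoc)
    qed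
    finally have "(\<lambda>x. lam x - root_comb (\<lambda>i. of_nat (b i)) x) =
        (\<lambda>x. lam x - root_comb (\<lambda>i. of_nat (a i)) x + root_comb (\<lambda>i. of_nat (\<Sum>j\<in>J. c j * d j i)) x)"
      unfolding a b .
    then have "(\<lambda>x. lam x - root_comb (\<lambda>i. of_nat (a i)) x) =
        (\<lambda>x. lam x - root_comb (\<lambda>i. of_nat (b i) + of_nat (\<Sum>j\<in>J. c j * d j i)) x)"
      unfolding root_comb_add[symmetric] by (simp add: fun_eq_iff algebra_simps)
    from below_inject[OF this] p[OF j]
    have "(of_nat (a (p j)) :: complex) = of_nat (b (p j) + (\<Sum>k\<in>J. c k * d k (p j)))" by simp
    then have "a (p j) = b (p j) + (\<Sum>k\<in>J. c k * d k (p j))" by (simp only: of_nat_eq_iff)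
    moreover have "c j * d j (p j) \<le> (\<Sum>k\<in>J. c k * d k (p j))"
      using j finJ by (intro member_le_sum[of j J "\<lambda>k. c k * d k (p j)"]) auto
    moreover have "c j \<le> c j * d j (p j)" using p[OF j] by simp
    moreover have "a (p j) \<le> sum a I" using p[OF j] finite_index by (intro member_le_sum) auto
    ultimately show ?thesis by linarith
  qed
  let ?C = "{c. \<forall>i. (i \<in> J \<longrightarrow> c i \<in> {..sum a I}) \<and> (i \<notin> J \<longrightarrow> c i = 0)}"
  have "wt_on J \<subseteq> (\<lambda>c x. lam x - root_comb (\<lambda>i. of_nat (c i)) x) ` ?C"
  proof
    fix mu assume "mu \<in> wt_on J"
    then obtain c where c: "mu \<in> wt" "mu = (\<lambda>x. lam x - root_comb (\<lambda>i. of_nat (c i)) x)"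
      "\<forall>i. i \<notin> J \<longrightarrow> c i = 0" using wt_on_iff[OF J] by blast
    show "mu \<in> (\<lambda>c x. lam x - root_comb (\<lambda>i. of_nat (c i)) x) ` ?C"
      using bound[OF c] c(3) by (intro image_eqI[where x = c]) (auto simp: c(2))
  qed
  moreover have "finite ?C" by (rule finite_set_of_finite_funs[OF finJ finite_atMost])
  ultimately show ?thesis using finite_subset by blast
qed

lemma integrability_set: "is_integrability_set scale H I alpha h lam vscale act integrable_nodes"
  unfolding is_integrability_set_def
proof (intro conjI allI impI integrable_nodes_subset)
  fix J assume J: "J \<subseteq> I"
  show "J \<subseteq> integrable_nodes \<longleftrightarrow> finite (wt_on J)"
    using finite_wt_on integrable_if_finite[OF J] by (rule iffI)
  show "J \<subseteq> integrable_nodes \<longleftrightarrow> weyl_stable alpha h J (wt_on J)"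
    using weyl_stable_wt_on[OF J weyl_stable_wt] integrable_if_weyl_stable[OF J] by (rule iffI)
  show "J \<subseteq> integrable_nodes \<longleftrightarrow> weyl_stable alpha h J wt"
    using weyl_stable_wt integrable_if_weyl_stable[OF J weyl_stable_wt_on[OF J]] by (rule iffI)
qed

lemma integrability_set_unique:
  assumes "is_integrability_set scale H I alpha h lam vscale act J0"
  shows "J0 = integrable_nodes"
proof -
  have "J0 \<subseteq> I" using assms by (simp add: is_integrability_set_def)
  moreover have "J \<subseteq> J0 \<longleftrightarrow> J \<subseteq> integrable_nodes" if "J \<subseteq> I" for J
    using that assms integrability_set by (simp add: is_integrability_set_def)
  ultimately show ?thesis using integrable_nodes_subset by blast
qed

lemma integrable_node_if_simple:
  assumes simple: simple_module and i: "i \<in> I" and n: "lam (h i) = of_nat n"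
  shows "i \<in> integrable_nodes"
proof -
  let ?u = "(act (xm i) ^^ Suc n) v0"
  have other: "act (xp j) ((act (xm i) ^^ k) v0) = 0" if "j \<in> I" "j \<noteq> i" for j k
  proof (induction k)
    case (Suc k)
    let ?w = "(act (xm i) ^^ k) v0"
    have "act (xp j) (act (xm i) ?w) = act (brk (xp j) (xm i)) ?w + act (xm i) (act (xp j) ?w)"
      by (simp add: act_brk)
    then show ?case using Suc brk_xp_xm[OF that(1) i] that by (simp add: act_left_zero actm.zero)
  qed (use v0_primitive that in simp)
  \<comment> \<open>The exponent n + 1 enters here: the factor lam (h i) - n of
    \<open>string_raise\<close> vanishes.\<close>
  have "act (xp i) ?u = 0"
    using string_raise[OF sl2_relations(1,2)[OF i] v0_primitive[OF i] h_v0[OF i], of n] n by simp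
  with other have prim: "act (xp j) ?u = 0" if "j \<in> I" for j using that by blast
  have wt: "?u \<in> weight_space H vscale act (\<lambda>x. lam x + of_nat (Suc n) * (- alpha i x))"
    by (rule weight_space_funpow[OF xm_root_vector[OF i] v0_weight])
  have "?u = 0"
  proof (rule ccontr)
    assume ne: "?u \<noteq> 0"
    have "?u \<in> neg_span ?u" using neg_word_in_span[of "[]" ?u] by simp
    with ne have "neg_span ?u = UNIV"
      using simple primitive_submodule[OF wt prim] unfolding simple_module_def by blast
    \<comment> \<open>If the submodule were everything, it would contain v0, and lam would lie below
      lam - (n+1) alpha_i.\<close>
    then obtain c where c: "\<And>x. x \<in> H \<Longrightarrow>
        lam x = lam x + of_nat (Suc n) * (- alpha i x) - root_comb (\<lambda>i. of_nat (c i)) x"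
      using neg_span_weight[OF wt v0_weight v0_nonzero] by auto
    have "root_comb (\<lambda>k. (if k = i then of_nat (Suc n) else 0) + of_nat (c k)) x = root_comb (\<lambda>k. 0) x"
      if "x \<in> H" for x
      using c[OF that] unfolding root_comb_add[symmetric] root_comb_single[OF i] root_comb_zero
      by (simp add: algebra_simps)
    from root_comb_inject[OF this i] have "of_nat (Suc n + c i) = (0::complex)" by (simp add: add.assoc)
    then show False by (simp only: of_nat_eq_0_iff)
  qed
  with i n show ?thesis by (auto simp: integrable_nodes_def)
qed

end


section \<open>Cyclic modules as quotients of the free algebra\<close>

lemma free_algebra_induct [case_names single add]:
  fixes u :: "'g free_algebra"
  assumes single: "\<And>xs c. P (Poly_Mapping.single (FWord xs) c)"
    and add: "\<And>u w. P u \<Longrightarrow> P w \<Longrightarrow> P (u + w)"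
  shows "P u"
proof (induction u rule: update_induct)
  case const
  show ?case using single[of "[]" 0] by simp
next
  case (update f a b)
  obtain xs where xs: "a = FWord xs" by (cases a)
  have "Poly_Mapping.update a b f = f + Poly_Mapping.single a b"
    using update.hyps(1)
    by (intro poly_mapping_eqI) (auto simp: lookup_update lookup_add lookup_single when_def in_keys_iff)
  then show ?case using add[OF update.IH single[of xs b]] xs by simp
qed

lemma single_word_Cons:
  "Poly_Mapping.single (FWord (x # xs)) c = fgen x * Poly_Mapping.single (FWord xs) c"
  by (simp add: fgen_def mult_single)

lemma single_word_Nil: "Poly_Mapping.single (FWord []) c = fscalar c"
  by (simp add: fscalar_def zero_fword_def)

context lie_module
begin

context
  fixes phi :: "'g free_algebra \<Rightarrow> 'v" and K :: "'g free_algebra set"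
  assumes phi: "surjection_with_kernel vscale act phi K"
begin

lemma phi_add: "phi (u + w) = phi u + phi w"
  and phi_fscalar: "phi (fscalar c * u) = vscale c (phi u)"
  and phi_fgen: "phi (fgen x * u) = act x (phi u)"
  and phi_surj: "\<exists>u. v = phi u"
  and phi_kernel: "phi u = 0 \<longleftrightarrow> u \<in> K"
  using phi by (auto simp: surjection_with_kernel_def)

lemma phi_diff: "phi (u - w) = phi u - phi w"
  using phi_add[of "u - w" w] by simp

lemma phi_fgen_power: "phi (fgen x ^ n) = (act x ^^ n) (phi 1)"
  by (induction n) (simp_all add: phi_fgen)

lemma phi_one_generates:
  assumes S: "submodule S" "phi 1 \<in> S"
  shows "S = UNIV"
proof -
  have sub: "V.subspace S" using S by (simp add: submodule_def)
  have "phi u \<in> S" for u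
  proof (induction u rule: free_algebra_induct)
    case (single xs c)
    show ?case
    proof (induction xs)
      case Nil
      then show ?case
        using phi_fscalar[of c 1] V.subspace_scale[OF sub S(2)] by (simp add: single_word_Nil)
    next
      case (Cons x xs)
      then show ?case using S by (simp add: single_word_Cons phi_fgen submodule_def)
    qed
  next
    case (add u w)
    then show ?case using V.subspace_add[OF sub] by (simp add: phi_add)
  qed
  then show ?thesis using phi_surj by (metis UNIV_eq_I)
qed

end

end

lemma (in semisimple_lie_algebra) xp_in_nilradical: "i \<in> I \<Longrightarrow> xp i \<in> nilradical_pos scale brk H I alpha"
  unfolding nilradical_pos_def positive_roots_def
  by (intro span_base UN_I[of "alpha i"] xp_root_vector IntI alpha_root alpha_in_cone)

lemma highest_weight_setup_of_quotient:
  assumes g: "semisimple_lie_algebra scale brk H I alpha xp xm h" and lam: "lam \<in> dual_space scale H"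
    and m: "lie_module scale brk vscale act" and nz: "(UNIV :: 'v::ab_group_add set) \<noteq> {0}"
    and phi: "surjection_with_kernel vscale act (phi :: _ \<Rightarrow> 'v) K" and K: "verma_ideal scale brk H I alpha lam \<subseteq> K"
  shows "highest_weight_setup scale brk H I alpha xp xm h vscale act lam (phi 1)"
proof -
  interpret semisimple_lie_algebra scale brk H I alpha xp xm h by (rule g)
  interpret lie_module scale brk vscale act by (rule m)
  note p = phi_add[OF phi] phi_fscalar[OF phi] phi_fgen[OF phi] phi_diff[OF phi]
  have k: "phi u = 0" if "u \<in> fgen ` nilradical_pos scale brk H I alpha \<union> {fgen x - fscalar (lam x) | x. x \<in> H}" for u
  proof -
    have "u \<in> verma_ideal scale brk H I alpha lam"
      unfolding verma_ideal_def by (rule hull_inc) (use that in blast)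
    then show ?thesis using phi_kernel[OF phi] K by blast
  qed
  show ?thesis
  proof unfold_locales
    show "lam \<in> dual_space scale H" by (rule lam)
    show "phi 1 \<noteq> 0"
    proof
      assume "phi 1 = 0"
      moreover have "submodule {0}" by (simp add: submodule_def actm.zero)
      ultimately show False using phi_one_generates[OF phi] nz by blast
    qed
    show "phi 1 \<in> weight_space H vscale act lam"
      unfolding weight_space_def
    proof safe
      fix x assume "x \<in> H"
      then have "phi (fgen x * 1 - fscalar (lam x) * 1) = 0" using k by auto
      then show "act x (phi 1) = vscale (lam x) (phi 1)" unfolding p by simp
    qed
    show "act (xp i) (phi 1) = 0" if "i \<in> I" for i
      using k[of "fgen (xp i)"] xp_in_nilradical[OF that] p(3)[of "xp i" 1] by simp
    show "S = UNIV" if "submodule S" "phi 1 \<in> S" for S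
      using phi_one_generates[OF phi] that by blast
  qed
qed

lemma hw_label_eqI: "lam (h i) = of_nat n \<Longrightarrow> hw_label h lam i = n"
  unfolding hw_label_def by (rule the_equality) auto

lemma (in highest_weight_setup) integrable_nodes_eq:
  "integrable_nodes = {i \<in> integral_nodes I h lam. (act (xm i) ^^ (hw_label h lam i + 1)) v0 = 0}"
proof -
  have "i \<in> integral_nodes I h lam \<and> (act (xm i) ^^ (hw_label h lam i + 1)) v0 = 0 \<longleftrightarrow>
      i \<in> I \<and> (\<exists>n. lam (h i) = of_nat n \<and> (act (xm i) ^^ Suc n) v0 = 0)" for i
    by (auto simp: integral_nodes_def hw_label_eqI elim!: Nats_cases)
  then show ?thesis unfolding integrable_nodes_def by blast
qed


section \<open>Weight components of the triangular decomposition\<close>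

text \<open>Induction on the number of weight vectors from S1 that make up u. The second span is
  stable under H, so x u - nu(b)(x) u stays in it and takes one vector less. It is therefore 0, so u
  itself has weight nu(b) and \<open>weight_vector_in_span_eq_zero\<close> applies.\<close>

lemma (in lie_module) weight_spans_Int:
  assumes u: "u \<in> V.span (\<Union>nu\<in>S1. weight_space H vscale act nu)"
    "u \<in> V.span (\<Union>nu\<in>S2. weight_space H vscale act nu)"
    and d: "\<And>mu nu. mu \<in> S1 \<Longrightarrow> nu \<in> S2 \<Longrightarrow> \<exists>x\<in>H. mu x \<noteq> nu x"
  shows "u = 0"
proof -
  let ?W = "V.span (\<Union>nu\<in>S2. weight_space H vscale act nu)"
  have stable: "act x w \<in> ?W" if "x \<in> H" "w \<in> ?W" for x w
  proof -
    have "V.subspace {w. act x w \<in> ?W}"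
      using V.subspace_span[of "\<Union>nu\<in>S2. weight_space H vscale act nu"] unfolding V.subspace_def
      by (auto simp: actm.zero act_add_right act_scale_right)
    moreover have "act x w \<in> ?W" if "w \<in> weight_space H vscale act nu" "nu \<in> S2" for w nu
    proof -
      have "act x w = vscale (nu x) w" using that \<open>x \<in> H\<close> by (simp add: weight_space_def)
      moreover have "w \<in> ?W" using that by (intro V.span_base) auto
      ultimately show ?thesis using V.span_scale by simp
    qed
    ultimately have "?W \<subseteq> {w. act x w \<in> ?W}" by (intro V.span_minimal) auto
    then show ?thesis using that by auto
  qed
  have *: "u = 0" if "finite T" "\<And>a. a \<in> T \<Longrightarrow> nu a \<in> S1 \<and> a \<in> weight_space H vscale act (nu a)"
    "u = (\<Sum>a\<in>T. vscale (r a) a)" "u \<in> ?W" for T nu r u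
    using that
  proof (induction T arbitrary: r u rule: finite_induct)
    case (insert b T)
    have "u \<in> weight_space H vscale act (nu b)"
      unfolding weight_space_def
    proof safe
      fix x assume x: "x \<in> H"
      have 2: "act x a = vscale (nu a x) a" if "a \<in> insert b T" for a
        using insert.prems(1)[OF that] x by (simp add: weight_space_def)
      have "act x u - vscale (nu b x) u = (\<Sum>a\<in>insert b T. vscale (r a * (nu a x - nu b x)) a)"
        unfolding insert.prems(2) actm.sum V.scale_sum_right sum_subtractf[symmetric]
        by (rule sum.cong) (auto simp: act_scale_right 2 V.scale_left_diff_distrib right_diff_distrib mult.commute)
      also have "\<dots> = (\<Sum>a\<in>T. vscale (r a * (nu a x - nu b x)) a)" using insert.hyps by simp
      finally have e: "act x u - vscale (nu b x) u = (\<Sum>a\<in>T. vscale (r a * (nu a x - nu b x)) a)" .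
      have "act x u - vscale (nu b x) u \<in> ?W"
        using stable[OF x insert.prems(3)] V.span_scale[OF insert.prems(3)] V.span_diff by blast
      from insert.IH[OF _ e this] have "act x u - vscale (nu b x) u = 0" using insert.prems(1) by simp
      then show "act x u = vscale (nu b x) u" by simp
    qed
    then show ?case
    proof (rule weight_vector_in_span_eq_zero[OF _ insert.prems(3)])
      fix mu assume "mu \<in> S2"
      then have "\<exists>x\<in>H. nu b x \<noteq> mu x" using d[of "nu b" mu] insert.prems(1)[of b] by blast
      then show "\<exists>x\<in>H. mu x \<noteq> nu b x" by metis
    qed
  qed simp
  obtain T r where T: "finite T" "T \<subseteq> (\<Union>nu\<in>S1. weight_space H vscale act nu)"
    "u = (\<Sum>a\<in>T. vscale (r a) a)"
    using u(1) unfolding V.span_explicit by auto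
  obtain nu where nu: "\<And>a. a \<in> T \<Longrightarrow> nu a \<in> S1 \<and> a \<in> weight_space H vscale act (nu a)"
    using T(2) by (metis UN_E subsetD)
  show ?thesis by (rule *[OF T(1) nu T(3) u(2)])
qed

context semisimple_lie_algebra
begin

text \<open>All nonzero elements of the cone, not only roots: the set is closed under addition, so
  brackets can be followed without asking which sums are roots.\<close>

definition pos_cone :: "('g \<Rightarrow> complex) set" where
  "pos_cone = {root_comb (\<lambda>i. of_nat (c i)) | c. \<exists>i\<in>I. c i \<noteq> 0}"

definition neg_cone :: "('g \<Rightarrow> complex) set" where
  "neg_cone = {\<lambda>x. - beta x | beta. beta \<in> pos_cone}"

definition weight_sum :: "('g \<Rightarrow> complex) set \<Rightarrow> 'g set" where
  "weight_sum S = span (\<Union>mu\<in>S. weight_space H scale brk mu)"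

lemma weight_sum_subspace: "subspace (weight_sum S)"
  by (simp add: weight_sum_def)

lemma weight_sum_mono: "S \<subseteq> S' \<Longrightarrow> weight_sum S \<subseteq> weight_sum S'"
  unfolding weight_sum_def by (intro span_mono) auto

lemma weight_sum_base: "x \<in> weight_space H scale brk mu \<Longrightarrow> mu \<in> S \<Longrightarrow> x \<in> weight_sum S"
  unfolding weight_sum_def by (rule span_base) auto

lemma weight_sum_Int:
  assumes "x \<in> weight_sum S1" "x \<in> weight_sum S2"
    "\<And>mu nu. mu \<in> S1 \<Longrightarrow> nu \<in> S2 \<Longrightarrow> \<exists>x\<in>H. mu x \<noteq> nu x"
  shows "x = 0"
  using ad.weight_spans_Int assms unfolding weight_sum_def by blast

lemma weight_sum_brk:
  assumes x: "x \<in> weight_sum S1" and y: "y \<in> weight_sum S2"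
    and s: "\<And>mu nu. mu \<in> S1 \<Longrightarrow> nu \<in> S2 \<Longrightarrow> (\<lambda>z. nu z + mu z) \<in> S"
  shows "brk x y \<in> weight_sum S"
proof -
  let ?Z = "weight_sum S"
  have sub: "subspace {y. brk x y \<in> ?Z}" for x
    using weight_sum_subspace[of S] unfolding subspace_def
    by (auto simp: brk_add_right brk_scale_right ad.actm.zero)
  have sub': "subspace {x. brk x y \<in> ?Z}" for y
    using weight_sum_subspace[of S] unfolding subspace_def
    by (auto simp: brk_add_left brk_scale_left ad.act_left_zero)
  have 1: "brk x y \<in> ?Z" if x: "x \<in> weight_space H scale brk mu" "mu \<in> S1" for x mu
  proof -
    have "(\<Union>nu\<in>S2. weight_space H scale brk nu) \<subseteq> {y. brk x y \<in> ?Z}"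
    proof safe
      fix nu y assume "nu \<in> S2" "y \<in> weight_space H scale brk nu"
      then show "brk x y \<in> ?Z" using ad.weight_space_act[OF x(1)] s[OF x(2)] weight_sum_base by blast
    qed
    from span_minimal[OF this sub] y show ?thesis by (auto simp: weight_sum_def)
  qed
  have "(\<Union>mu\<in>S1. weight_space H scale brk mu) \<subseteq> {x. brk x y \<in> ?Z}" using 1 by blast
  from span_minimal[OF this sub'] x show ?thesis unfolding weight_sum_def[of S1] by blast
qed

lemma alpha_pos_cone: "i \<in> I \<Longrightarrow> alpha i \<in> pos_cone"
  unfolding pos_cone_def using alpha_root_comb[of i] by (intro CollectI exI[of _ "\<lambda>k. if k = i then 1 else 0"]) auto

lemma pos_cone_add: "beta \<in> pos_cone \<Longrightarrow> gamma \<in> pos_cone \<Longrightarrow> (\<lambda>x. gamma x + beta x) \<in> pos_cone"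
proof -
  assume "beta \<in> pos_cone" "gamma \<in> pos_cone"
  then obtain c d i where c: "beta = root_comb (\<lambda>i. of_nat (c i))" "gamma = root_comb (\<lambda>i. of_nat (d i))"
    "i \<in> I" "d i \<noteq> 0" unfolding pos_cone_def by blast
  have "(\<lambda>x. gamma x + beta x) = root_comb (\<lambda>i. of_nat (d i + c i))"
    by (simp add: c root_comb_add)
  then show "(\<lambda>x. gamma x + beta x) \<in> pos_cone"
    unfolding pos_cone_def using c(3,4) by (intro CollectI exI[of _ "\<lambda>i. d i + c i"]) auto
qed

lemma neg_cone_add: "beta \<in> neg_cone \<Longrightarrow> gamma \<in> neg_cone \<Longrightarrow> (\<lambda>x. gamma x + beta x) \<in> neg_cone"
proof -
  assume "beta \<in> neg_cone" "gamma \<in> neg_cone"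
  then obtain b c where "beta = (\<lambda>x. - b x)" "gamma = (\<lambda>x. - c x)" "b \<in> pos_cone" "c \<in> pos_cone"
    by (auto simp: neg_cone_def)
  then show ?thesis unfolding neg_cone_def using pos_cone_add[of b c]
    by (intro CollectI exI[of _ "\<lambda>x. c x + b x"]) auto
qed

lemma pos_cone_nonzero:
  assumes "beta \<in> pos_cone" shows "\<exists>x\<in>H. beta x \<noteq> 0"
proof (rule ccontr)
  assume n: "\<not> ?thesis"
  obtain c i where c: "beta = root_comb (\<lambda>i. of_nat (c i))" "i \<in> I" "c i \<noteq> 0"
    using assms by (auto simp: pos_cone_def)
  have "root_comb (\<lambda>i. of_nat (c i)) x = root_comb (\<lambda>i. 0) x" if "x \<in> H" for x
    using n that c(1) by (simp add: root_comb_zero)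
  from root_comb_inject[OF this c(2)] c(3) show False by simp
qed

lemma neg_cone_nonzero:
  assumes "beta \<in> neg_cone" shows "\<exists>x\<in>H. beta x \<noteq> 0"
  using assms pos_cone_nonzero by (auto simp: neg_cone_def)

lemma pos_neg_cone_differ:
  assumes "beta \<in> pos_cone" "gamma \<in> neg_cone" shows "\<exists>x\<in>H. beta x \<noteq> gamma x"
proof -
  obtain c where c: "gamma = (\<lambda>x. - c x)" "c \<in> pos_cone" using assms(2) by (auto simp: neg_cone_def)
  obtain x where "x \<in> H" "c x + beta x \<noteq> 0" using pos_cone_nonzero[OF pos_cone_add[OF assms(1) c(2)]] by auto
  then show ?thesis unfolding c(1) by (intro bexI[of _ x]) (auto simp: add_eq_0_iff)
qed

text \<open>Both summands would need a positive coefficient at i, against a total of 1. Hence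
  brackets of negative weight vectors have no component of weight -alpha_i.\<close>

lemma pos_cone_sum_not_simple:
  assumes "beta \<in> pos_cone" "gamma \<in> pos_cone" "i \<in> I"
  shows "\<exists>x\<in>H. gamma x + beta x \<noteq> alpha i x"
proof (rule ccontr)
  assume n: "\<not> ?thesis"
  obtain c j where c: "beta = root_comb (\<lambda>i. of_nat (c i))" "j \<in> I" "c j \<noteq> 0"
    using assms(1) by (auto simp: pos_cone_def)
  obtain d k where d: "gamma = root_comb (\<lambda>i. of_nat (d i))" "k \<in> I" "d k \<noteq> 0"
    using assms(2) by (auto simp: pos_cone_def)
  have "root_comb (\<lambda>k. of_nat (d k + c k)) x = root_comb (\<lambda>k. of_nat (if k = i then 1 else 0)) x" if "x \<in> H" for x
    using n that unfolding c(1) d(1) alpha_root_comb[OF assms(3)] by (simp add: root_comb_add)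
  from root_comb_inject[OF this] have "d m + c m = (if m = i then 1 else 0)" if "m \<in> I" for m
    using that by (simp only: of_nat_eq_iff)
  from this[OF c(2)] this[OF d(2)] c(3) d(3) show False by (auto split: if_splits)
qed

lemma nilradical_pos_weight_sum: "nilradical_pos scale brk H I alpha \<subseteq> weight_sum pos_cone"
  unfolding nilradical_pos_def weight_sum_def
proof (intro span_mono UN_mono subset_refl)
  show "positive_roots scale brk H I alpha \<subseteq> pos_cone"
  proof
    fix beta assume b: "beta \<in> positive_roots scale brk H I alpha"
    then obtain c where c: "beta = root_comb (\<lambda>i. of_nat (c i))"
      using nonneg_cone_iff[OF subset_refl] by (auto simp: positive_roots_def)
    have "\<exists>i\<in>I. c i \<noteq> 0"
    proof (rule ccontr)
      assume "\<not> ?thesis"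
      then have "beta = (\<lambda>x. 0)" by (simp add: c root_comb_def)
      then show False using b root_nonzero by (auto simp: positive_roots_def)
    qed
    then show "beta \<in> pos_cone" using c unfolding pos_cone_def by blast
  qed
qed

lemma H_weight_sum: "x \<in> H \<Longrightarrow> x \<in> weight_sum {\<lambda>x. 0}"
  using weight_sum_base[OF H_weight_zero] by simp

text \<open>The weights in \<open>neg_cone\<close>, 0 and \<open>pos_cone\<close> are separated on
  H, so the components are peeled off one after the other.\<close>

lemma triangular_sum_eq_zero:
  assumes x: "x1 \<in> weight_sum neg_cone" "x0 \<in> H" "x2 \<in> weight_sum pos_cone" and s: "x1 + x0 + x2 = 0"
  shows "x1 = 0" "x0 = 0" "x2 = 0"
proof -
  have neg: "- a \<in> weight_sum S" if "a \<in> weight_sum S" for a S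
    using subspace_neg[OF weight_sum_subspace that] .
  have x0: "x0 \<in> weight_sum {\<lambda>x. 0}" using H_weight_sum x(2) .
  have "x1 = - (x0 + x2)" using s by (simp only: add.assoc eq_neg_iff_add_eq_0)
  moreover have "x0 + x2 \<in> weight_sum (insert (\<lambda>x. 0) pos_cone)"
    using weight_sum_mono[of "{\<lambda>x. 0}" "insert (\<lambda>x. 0) pos_cone"] weight_sum_mono[of pos_cone "insert (\<lambda>x. 0) pos_cone"]
      x0 x(3) by (intro subspace_add[OF weight_sum_subspace]) auto
  ultimately have "x1 \<in> weight_sum (insert (\<lambda>x. 0) pos_cone)" using neg by (simp only:)
  then show x1: "x1 = 0"
  proof (rule weight_sum_Int[OF _ x(1)])
    fix mu nu assume "mu \<in> insert (\<lambda>x. 0) pos_cone" "nu \<in> neg_cone"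
    then show "\<exists>x\<in>H. mu x \<noteq> nu x" using pos_neg_cone_differ neg_cone_nonzero by (metis insertE)
  qed
  have "x0 = - x2" using s x1 by (simp add: eq_neg_iff_add_eq_0)
  then have "x0 \<in> weight_sum pos_cone" using neg x(3) by simp
  then show "x0 = 0"
  proof (rule weight_sum_Int[OF _ x0])
    fix mu nu :: "'g \<Rightarrow> complex" assume "mu \<in> pos_cone" "nu \<in> {\<lambda>x. 0}"
    then show "\<exists>x\<in>H. mu x \<noteq> nu x" using pos_cone_nonzero by auto
  qed
  then show "x2 = 0" using s x1 by simp
qed

end


section \<open>The contragredient model\<close>

text \<open>A function \<open>\<xi>\<close> of words is a linear form on the free algebra in the \<open>x\<^sup>-\<^sub>i\<close>, and the operators
  below are the transposes of the action on this algebra as the Verma module of the Lie algebra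
  without Serre relations. Transposition reverses products, whence the order in \<open>op_brk\<close>.\<close>

definition smul :: "complex \<Rightarrow> ('w \<Rightarrow> complex) \<Rightarrow> 'w \<Rightarrow> complex" where
  "smul a \<xi> = (\<lambda>w. a * \<xi> w)"

type_synonym 'w oper = "('w \<Rightarrow> complex) \<Rightarrow> 'w \<Rightarrow> complex"

definition op_smul :: "complex \<Rightarrow> 'w oper \<Rightarrow> 'w oper" where
  "op_smul a T = (\<lambda>\<xi>. smul a (T \<xi>))"

definition op_brk :: "'w oper \<Rightarrow> 'w oper \<Rightarrow> 'w oper" where
  "op_brk T S = (\<lambda>\<xi>. S (T \<xi>) - T (S \<xi>))"

definition op_linear :: "'w oper \<Rightarrow> bool" where
  "op_linear T \<longleftrightarrow> (\<forall>\<xi> \<eta>. T (\<xi> + \<eta>) = T \<xi> + T \<eta>) \<and> (\<forall>a \<xi>. T (smul a \<xi>) = smul a (T \<xi>))"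

lemma smul_add: "smul a (\<xi> + \<eta>) = smul a \<xi> + smul a \<eta>"
  by (simp add: smul_def fun_eq_iff distrib_left)

lemma smul_diff: "smul a (\<xi> - \<eta>) = smul a \<xi> - smul a \<eta>"
  by (simp add: smul_def fun_eq_iff right_diff_distrib)

lemma smul_smul: "smul a (smul b \<xi>) = smul (a * b) \<xi>"
  by (simp add: smul_def fun_eq_iff mult.assoc)

lemma smul_simps [simp]: "smul 1 \<xi> = \<xi>" "smul 0 \<xi> = 0" "smul a 0 = 0" "smul (-1) \<xi> = - \<xi>"
  by (simp_all add: smul_def fun_eq_iff)

lemma op_linear_add: "op_linear T \<Longrightarrow> T (\<xi> + \<eta>) = T \<xi> + T \<eta>"
  by (simp add: op_linear_def)

lemma op_linear_smul: "op_linear T \<Longrightarrow> T (smul a \<xi>) = smul a (T \<xi>)"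
  by (simp add: op_linear_def)

lemma op_linear_zero: "op_linear T \<Longrightarrow> T 0 = 0"
  using op_linear_smul[of T 0 0] by simp

lemma op_linear_uminus: "op_linear T \<Longrightarrow> T (- \<xi>) = - T \<xi>"
  using op_linear_smul[of T "-1" \<xi>] by simp

lemma op_linear_diff: "op_linear T \<Longrightarrow> T (\<xi> - \<eta>) = T \<xi> - T \<eta>"
  using op_linear_add[of T \<xi> "- \<eta>"] op_linear_uminus[of T \<eta>] by simp

lemmas op_linear_simps = op_linear_add op_linear_smul op_linear_zero op_linear_uminus op_linear_diff

lemma op_linear_0: "op_linear 0"
  by (simp add: op_linear_def)

lemma op_linear_plus: "op_linear T \<Longrightarrow> op_linear S \<Longrightarrow> op_linear (T + S)"
  by (simp add: op_linear_def smul_add)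

lemma op_linear_op_smul: "op_linear T \<Longrightarrow> op_linear (op_smul a T)"
  by (simp add: op_linear_def op_smul_def smul_add smul_smul mult.commute)

lemma op_linear_op_brk: "op_linear T \<Longrightarrow> op_linear S \<Longrightarrow> op_linear (op_brk T S)"
  by (simp add: op_linear_def op_brk_def smul_diff)

lemma op_smul_add: "op_smul a (T + S) = op_smul a T + op_smul a S"
  by (rule ext) (simp add: op_smul_def smul_add)

lemma op_smul_minus_one: "op_smul (-1) T = - T"
  by (rule ext) (simp add: op_smul_def)

lemma op_brk_swap: "op_brk S T = - op_brk T S"
  by (rule ext) (simp add: op_brk_def)

lemma op_brk_zero:
  assumes "op_linear T"
  shows "op_brk T 0 = 0"
  by (rule ext) (simp add: op_brk_def op_linear_zero[OF assms])

lemma op_brk_add_right: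
  assumes "op_linear T"
  shows "op_brk T (S + S') = op_brk T S + op_brk T S'"
  by (rule ext) (simp add: op_brk_def op_linear_add[OF assms])

lemma op_brk_add_left:
  assumes "op_linear T"
  shows "op_brk (S + S') T = op_brk S T + op_brk S' T"
  by (rule ext) (simp add: op_brk_def op_linear_add[OF assms])

lemma op_brk_smul_right: "op_linear T \<Longrightarrow> op_brk T (op_smul a S) = op_smul a (op_brk T S)"
  by (rule ext) (simp add: op_brk_def op_smul_def op_linear_smul smul_diff)

lemma op_brk_smul_left: "op_linear T \<Longrightarrow> op_brk (op_smul a S) T = op_smul a (op_brk S T)"
  by (rule ext) (simp add: op_brk_def op_smul_def op_linear_smul smul_diff)

lemma op_brk_jacobi:
  assumes "op_linear U" "op_linear T" "op_linear S"
  shows "op_brk U (op_brk T S) = op_brk (op_brk U T) S + op_brk T (op_brk U S)"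
  by (rule ext) (simp add: op_brk_def op_linear_simps[OF assms(1)] op_linear_simps[OF assms(2)]
      op_linear_simps[OF assms(3)])

definition lower :: "'i \<Rightarrow> 'i list oper" where
  "lower j \<xi> = (\<lambda>w. \<xi> (j # w))"

lemma op_linear_lower: "op_linear (lower j)"
  by (simp add: op_linear_def lower_def smul_def fun_eq_iff)

lemma lower_funpow: "(lower j ^^ n) \<xi> = (\<lambda>w. \<xi> (replicate n j @ w))"
proof (induction n)
  case (Suc n)
  then show ?case by (simp add: lower_def fun_eq_iff) (metis append_Cons append_assoc replicate_app_Cons_same)
qed simp

context lie_algebra
begin

text \<open>The Lie subalgebra generated by A in the product of the Lie algebra with the operators.
  It is a relation, since one element may be paired with several operators.\<close>

inductive pair_alg :: "('g \<times> 'w oper) set \<Rightarrow> 'g \<Rightarrow> 'w oper \<Rightarrow> bool" for A where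
  zero: "pair_alg A 0 0"
| gen: "(x, T) \<in> A \<Longrightarrow> pair_alg A x T"
| add: "pair_alg A x T \<Longrightarrow> pair_alg A y S \<Longrightarrow> pair_alg A (x + y) (T + S)"
| smul: "pair_alg A x T \<Longrightarrow> pair_alg A (scale a x) (op_smul a T)"
| brk: "pair_alg A x T \<Longrightarrow> pair_alg A y S \<Longrightarrow> pair_alg A (brk x y) (op_brk T S)"

lemma pair_alg_mono: "pair_alg A x T \<Longrightarrow> A \<subseteq> B \<Longrightarrow> pair_alg B x T"
  by (induction rule: pair_alg.induct) (auto intro: pair_alg.intros)

lemma pair_alg_uminus: "pair_alg A x T \<Longrightarrow> pair_alg A (- x) (- T)"
  using pair_alg.smul[of A x T "-1"] by (simp add: op_smul_minus_one)

lemma pair_alg_diff: "pair_alg A x T \<Longrightarrow> pair_alg A y S \<Longrightarrow> pair_alg A (x - y) (T - S)"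
  using pair_alg.add[of A x T "- y" "- S"] pair_alg_uminus[of A y S] by simp

lemma pair_alg_linear:
  assumes "pair_alg A x T" "\<And>x T. (x, T) \<in> A \<Longrightarrow> op_linear T"
  shows "op_linear T"
  using assms
  by (induction rule: pair_alg.induct)
    (auto intro: op_linear_0 op_linear_plus op_linear_op_smul op_linear_op_brk)

end

section \<open>Transposed operators of the generators on forms on words\<close>

locale dual_verma = semisimple_lie_algebra scale brk H I alpha xp xm h
  for scale :: "complex \<Rightarrow> 'g::ab_group_add \<Rightarrow> 'g" and brk :: "'g \<Rightarrow> 'g \<Rightarrow> 'g"
    and H :: "'g set" and I :: "'i set" and alpha :: "'i \<Rightarrow> 'g \<Rightarrow> complex" and xp xm h :: "'i \<Rightarrow> 'g" +
  fixes lam :: "'g \<Rightarrow> complex"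
  assumes lam_dual: "lam \<in> dual_space scale H"
begin

text \<open>Letters outside \<open>I\<close> are given weight \<open>0\<close> and the Lie algebra element \<open>0\<close>, so that every word is
  allowed.\<close>

definition letter_weight :: "'i \<Rightarrow> 'g \<Rightarrow> complex" where
  "letter_weight j x = (if j \<in> I then alpha j x else 0)"

definition letter_elem :: "'i \<Rightarrow> 'g" where
  "letter_elem j = (if j \<in> I then xm j else 0)"

definition word_weight :: "'i list \<Rightarrow> 'g \<Rightarrow> complex" where
  "word_weight w x = lam x - (\<Sum>j\<leftarrow>w. letter_weight j x)"

definition cartan_op :: "'g \<Rightarrow> 'i list oper" where
  "cartan_op x \<xi> = (\<lambda>w. word_weight w x * \<xi> w)"

text \<open>Transpose of the rule x+_k (x-_j u) = x-_j (x+_k u) + \<delta>_jk h_k u, with x+_k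
  killing the empty word; h_k acts on a word by \<open>word_weight\<close>.\<close>

fun raise :: "'i \<Rightarrow> 'i list oper" where
  "raise k \<xi> [] = 0"
| "raise k \<xi> (j # w) = raise k (lower j \<xi>) w + (if j = k then word_weight w (h k) * \<xi> w else 0)"

lemma word_weight_simps [simp]:
  "word_weight [] x = lam x" "word_weight (j # w) x = word_weight w x - letter_weight j x"
  by (simp_all add: word_weight_def)

lemma word_weight_add: "x \<in> H \<Longrightarrow> y \<in> H \<Longrightarrow> word_weight w (x + y) = word_weight w x + word_weight w y"
  and word_weight_scale: "x \<in> H \<Longrightarrow> word_weight w (scale a x) = a * word_weight w x"
proof -
  have l: "lam (x + y) = lam x + lam y" "letter_weight j (x + y) = letter_weight j x + letter_weight j y"
    if "x \<in> H" "y \<in> H" for x y j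
    using that lam_dual alpha_dual[of j] by (auto simp: dual_space_def letter_weight_def)
  have s: "lam (scale a x) = a * lam x" "letter_weight j (scale a x) = a * letter_weight j x"
    if "x \<in> H" for x j
    using that lam_dual alpha_dual[of j] by (auto simp: dual_space_def letter_weight_def)
  show "x \<in> H \<Longrightarrow> y \<in> H \<Longrightarrow> word_weight w (x + y) = word_weight w x + word_weight w y"
    by (induction w) (auto simp: l)
  show "x \<in> H \<Longrightarrow> word_weight w (scale a x) = a * word_weight w x"
    by (induction w) (auto simp: s right_diff_distrib)
qed

lemma cartan_op_add: "x \<in> H \<Longrightarrow> y \<in> H \<Longrightarrow> cartan_op (x + y) = cartan_op x + cartan_op y"
  by (simp add: cartan_op_def fun_eq_iff word_weight_add distrib_right)

lemma cartan_op_scale: "x \<in> H \<Longrightarrow> cartan_op (scale a x) = op_smul a (cartan_op x)"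
  by (simp add: cartan_op_def op_smul_def smul_def fun_eq_iff word_weight_scale mult.assoc)

lemma H_zero: "0 \<in> H"
  and H_add: "x \<in> H \<Longrightarrow> y \<in> H \<Longrightarrow> x + y \<in> H"
  and H_scale: "x \<in> H \<Longrightarrow> scale a x \<in> H"
  using H_subspace by (auto simp: subspace_def)

lemma cartan_op_zero: "cartan_op 0 = 0"
  using cartan_op_scale[OF H_zero, of 0] by (simp add: op_smul_def fun_eq_iff)

lemma op_linear_cartan_op: "op_linear (cartan_op x)"
  by (simp add: op_linear_def cartan_op_def smul_def fun_eq_iff algebra_simps)

lemma op_linear_raise: "op_linear (raise k)"
proof -
  have "raise k (\<xi> + \<eta>) w = raise k \<xi> w + raise k \<eta> w" for \<xi> \<eta> w
    by (induction w arbitrary: \<xi> \<eta>) (auto simp: op_linear_add[OF op_linear_lower] distrib_left)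
  moreover have "raise k (smul a \<xi>) w = a * raise k \<xi> w" for a \<xi> w
  proof (induction w arbitrary: \<xi>)
    case (Cons j w)
    show ?case
      by (simp add: op_linear_smul[OF op_linear_lower] Cons) (simp add: smul_def distrib_left)
  qed simp
  ultimately show ?thesis by (simp add: op_linear_def fun_eq_iff smul_def)
qed

lemma op_brk_cartan_lower: "op_brk (cartan_op x) (lower j) = op_smul (- letter_weight j x) (lower j)"
  by (simp add: op_brk_def cartan_op_def lower_def op_smul_def smul_def fun_eq_iff algebra_simps)

lemma op_brk_raise_lower: "op_brk (raise k) (lower j) = (if j = k then cartan_op (h k) else 0)"
  by (simp add: op_brk_def cartan_op_def lower_def fun_eq_iff)

lemma op_brk_cartan_raise:
  assumes "k \<in> I"
  shows "op_brk (cartan_op x) (raise k) = op_smul (alpha k x) (raise k)"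
proof -
  have "raise k (cartan_op x \<xi>) w - word_weight w x * raise k \<xi> w = alpha k x * raise k \<xi> w" for \<xi> w
  proof (induction w arbitrary: \<xi>)
    case (Cons j w)
    have "lower j (cartan_op x \<xi>) = cartan_op x (lower j \<xi>) + smul (- letter_weight j x) (lower j \<xi>)"
      by (simp add: cartan_op_def lower_def smul_def fun_eq_iff algebra_simps)
    then have e: "raise k (lower j (cartan_op x \<xi>)) w =
        raise k (cartan_op x (lower j \<xi>)) w - letter_weight j x * raise k (lower j \<xi>) w"
      by (simp add: op_linear_simps[OF op_linear_raise]) (simp add: smul_def)
    have IH: "raise k (cartan_op x (lower j \<xi>)) w =
        word_weight w x * raise k (lower j \<xi>) w + alpha k x * raise k (lower j \<xi>) w"
      using Cons[of "lower j \<xi>"] by (simp add: algebra_simps)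
    show ?case
      using assms by (simp add: e IH) (auto simp: cartan_op_def letter_weight_def algebra_simps)
  qed simp
  then show ?thesis
    by (simp add: op_brk_def op_smul_def smul_def fun_eq_iff) (simp add: cartan_op_def)
qed

section \<open>Negative, positive and Borel parts of the algebra of pairs\<close>

definition neg_gens :: "('g \<times> 'i list oper) set" where
  "neg_gens = range (\<lambda>j. (letter_elem j, lower j))"

definition pos_gens :: "('g \<times> 'i list oper) set" where
  "pos_gens = (\<lambda>k. (xp k, raise k)) ` I"

text \<open>The pairs in A are eigenvectors of each (z, \<open>cartan_op z\<close>), with the same
  eigenvalue in both components. This makes the algebra generated by A stable under bracketing with
  these pairs.\<close>

definition cartan_stable :: "('g \<times> 'i list oper) set \<Rightarrow> bool" where
  "cartan_stable A \<longleftrightarrow> (\<forall>(x, T)\<in>A. op_linear T \<and>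
     (\<forall>z\<in>H. \<exists>a. brk z x = scale a x \<and> op_brk (cartan_op z) T = op_smul a T))"

lemma cartan_stable_neg_gens: "cartan_stable neg_gens"
proof -
  have "brk z (letter_elem j) = scale (- letter_weight j z) (letter_elem j)" if "z \<in> H" for j z
    using that brk_H_xm[of j z] by (simp add: letter_elem_def letter_weight_def ad.actm.zero)
  then show ?thesis
    unfolding cartan_stable_def neg_gens_def using op_linear_lower op_brk_cartan_lower by fast
qed

lemma cartan_stable_pos_gens: "cartan_stable pos_gens"
  unfolding cartan_stable_def pos_gens_def
  using op_linear_raise op_brk_cartan_raise brk_H_xp by fast

lemma cartan_stable_linear: "cartan_stable A \<Longrightarrow> pair_alg A x T \<Longrightarrow> op_linear T"
  using pair_alg_linear unfolding cartan_stable_def by blast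

lemma brk_derivation: "brk y (brk x z) = brk (brk y x) z + brk x (brk y z)"
  using ad.act_brk[of y x z] by (simp add: algebra_simps)

lemma pair_alg_cartan:
  assumes A: "cartan_stable A" and z: "z \<in> H" and a: "pair_alg A x T"
  shows "pair_alg A (brk z x) (op_brk (cartan_op z) T)"
  using a
proof induction
  case zero
  show ?case
    unfolding ad.actm.zero op_brk_zero[OF op_linear_cartan_op] by (rule pair_alg.zero)
next
  case (gen x T)
  then obtain a where "brk z x = scale a x" "op_brk (cartan_op z) T = op_smul a T"
    using A z unfolding cartan_stable_def by fast
  then show ?case using pair_alg.smul[OF pair_alg.gen[OF gen]] by simp
next
  case (add x T y S)
  show ?case
    unfolding brk_add_right op_brk_add_right[OF op_linear_cartan_op] by (rule pair_alg.add[OF add.IH])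
next
  case (smul x T a)
  then show ?case
    by (simp add: brk_scale_right op_brk_smul_right op_linear_cartan_op pair_alg.smul)
next
  case (brk x T y S)
  show ?case
    unfolding brk_derivation[of z x y]
      op_brk_jacobi[OF op_linear_cartan_op cartan_stable_linear[OF A brk.hyps(1)] cartan_stable_linear[OF A brk.hyps(2)]]
    by (intro pair_alg.add pair_alg.brk brk)
qed

text \<open>For \<open>neg_gens\<close> and \<open>pos_gens\<close> these are the analogues of h +
  n- and h + n+.\<close>

definition borel_alg :: "('g \<times> 'i list oper) set \<Rightarrow> 'g \<Rightarrow> 'i list oper \<Rightarrow> bool" where
  "borel_alg A x T \<longleftrightarrow> (\<exists>x1 x0 T1. x = x1 + x0 \<and> T = T1 + cartan_op x0 \<and> pair_alg A x1 T1 \<and> x0 \<in> H)"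

lemma borel_algI: "pair_alg A x1 T1 \<Longrightarrow> x0 \<in> H \<Longrightarrow> borel_alg A (x1 + x0) (T1 + cartan_op x0)"
  unfolding borel_alg_def by blast

lemma borel_alg_pair: "pair_alg A x T \<Longrightarrow> borel_alg A x T"
  using borel_algI[OF _ H_zero, of A x T] by (simp add: cartan_op_zero)

lemma borel_alg_cartan: "x \<in> H \<Longrightarrow> borel_alg A x (cartan_op x)"
  using borel_algI[OF pair_alg.zero, of x A] by simp

lemma borel_alg_add: "borel_alg A x T \<Longrightarrow> borel_alg A y S \<Longrightarrow> borel_alg A (x + y) (T + S)"
proof -
  assume "borel_alg A x T" "borel_alg A y S"
  then obtain x1 x0 T1 y1 y0 S1 where e: "x = x1 + x0" "T = T1 + cartan_op x0" "y = y1 + y0" "S = S1 + cartan_op y0"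
    and p: "pair_alg A x1 T1" "x0 \<in> H" "pair_alg A y1 S1" "y0 \<in> H"
    unfolding borel_alg_def by blast
  show ?thesis
    using borel_algI[OF pair_alg.add[OF p(1,3)] H_add[OF p(2,4)]]
    unfolding e cartan_op_add[OF p(2,4)] by (simp only: add.assoc add.left_commute add.commute)
qed

lemma borel_alg_smul: "borel_alg A x T \<Longrightarrow> borel_alg A (scale a x) (op_smul a T)"
proof -
  assume "borel_alg A x T"
  then obtain x1 x0 T1 where e: "x = x1 + x0" "T = T1 + cartan_op x0" and p: "pair_alg A x1 T1" "x0 \<in> H"
    unfolding borel_alg_def by blast
  show ?thesis
    using borel_algI[OF pair_alg.smul[OF p(1)] H_scale[OF p(2)], of a a]
    unfolding e cartan_op_scale[OF p(2)] by (simp only: op_smul_add scale_right_distrib)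
qed

lemma borel_alg_brk_left:
  assumes A: "cartan_stable A" and b: "borel_alg A x T" and p: "pair_alg A y S"
  shows "borel_alg A (brk x y) (op_brk T S)"
proof -
  obtain x1 x0 T1 where e: "x = x1 + x0" "T = T1 + cartan_op x0" and q: "pair_alg A x1 T1" "x0 \<in> H"
    using b unfolding borel_alg_def by blast
  show ?thesis
    unfolding e brk_add_left op_brk_add_left[OF cartan_stable_linear[OF A p]]
    by (intro borel_alg_pair pair_alg.add pair_alg.brk q p pair_alg_cartan[OF A])
qed

lemma borel_alg_brk_right:
  assumes A: "cartan_stable A" and b: "borel_alg A x T" and p: "pair_alg A y S"
  shows "borel_alg A (brk y x) (op_brk S T)"
  using borel_alg_smul[OF borel_alg_brk_left[OF assms], of "-1"]
  by (simp add: op_smul_minus_one brk_swap[of y x] op_brk_swap[of S T])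

text \<open>Bracketing with (y, U) is a derivation, and the Borel part absorbs brackets with the
  algebra generated by A, so the images of the generators decide. It serves for x+_k acting on n-
  and for x-_j acting on n+.\<close>

lemma borel_alg_bracket:
  assumes A: "cartan_stable A" and U: "op_linear U"
    and gens: "\<And>x T. (x, T) \<in> A \<Longrightarrow> borel_alg A (brk y x) (op_brk U T)"
    and p: "pair_alg A x T"
  shows "borel_alg A (brk y x) (op_brk U T)"
  using p
proof induction
  case zero
  show ?case
    unfolding ad.actm.zero op_brk_zero[OF U] by (rule borel_alg_pair[OF pair_alg.zero])
next
  case (gen x T)
  then show ?case by (rule gens)
next
  case (add x T y S)
  show ?case unfolding brk_add_right op_brk_add_right[OF U] by (rule borel_alg_add[OF add.IH])
next
  case (smul x T a)
  then show ?case by (simp add: brk_scale_right op_brk_smul_right[OF U] borel_alg_smul)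
next
  case (brk x T z S)
  show ?case
    unfolding brk_derivation[of y x z]
      op_brk_jacobi[OF U cartan_stable_linear[OF A brk.hyps(1)] cartan_stable_linear[OF A brk.hyps(2)]]
    by (intro borel_alg_add borel_alg_brk_left[OF A] borel_alg_brk_right[OF A] brk)
qed

section \<open>Triangular decomposition of the algebra of pairs\<close>

definition tri_alg :: "'g \<Rightarrow> 'i list oper \<Rightarrow> bool" where
  "tri_alg x T \<longleftrightarrow> (\<exists>x1 x0 x2 T1 T2. x = x1 + x0 + x2 \<and> T = T1 + cartan_op x0 + T2 \<and>
     pair_alg neg_gens x1 T1 \<and> x0 \<in> H \<and> pair_alg pos_gens x2 T2)"

lemma tri_algI:
  "pair_alg neg_gens x1 T1 \<Longrightarrow> x0 \<in> H \<Longrightarrow> pair_alg pos_gens x2 T2 \<Longrightarrow>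
    tri_alg (x1 + x0 + x2) (T1 + cartan_op x0 + T2)"
  unfolding tri_alg_def by blast

lemma tri_alg_neg: "borel_alg neg_gens x T \<Longrightarrow> tri_alg x T"
  unfolding borel_alg_def using tri_algI[OF _ _ pair_alg.zero] by fastforce

lemma tri_alg_pos: "borel_alg pos_gens x T \<Longrightarrow> tri_alg x T"
  unfolding borel_alg_def using tri_algI[OF pair_alg.zero] by (fastforce simp: add.commute)

lemma tri_alg_add: "tri_alg x T \<Longrightarrow> tri_alg y S \<Longrightarrow> tri_alg (x + y) (T + S)"
proof -
  assume "tri_alg x T" "tri_alg y S"
  then obtain x1 x0 x2 T1 T2 y1 y0 y2 S1 S2 where
    e: "x = x1 + x0 + x2" "T = T1 + cartan_op x0 + T2" "y = y1 + y0 + y2" "S = S1 + cartan_op y0 + S2"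
    and p: "pair_alg neg_gens x1 T1" "x0 \<in> H" "pair_alg pos_gens x2 T2"
      "pair_alg neg_gens y1 S1" "y0 \<in> H" "pair_alg pos_gens y2 S2"
    unfolding tri_alg_def by blast
  show ?thesis
    using tri_algI[OF pair_alg.add[OF p(1,4)] H_add[OF p(2,5)] pair_alg.add[OF p(3,6)]]
    unfolding e cartan_op_add[OF p(2,5)] by (simp only: add.assoc add.left_commute add.commute)
qed

lemma tri_alg_smul: "tri_alg x T \<Longrightarrow> tri_alg (scale a x) (op_smul a T)"
proof -
  assume "tri_alg x T"
  then obtain x1 x0 x2 T1 T2 where
    e: "x = x1 + x0 + x2" "T = T1 + cartan_op x0 + T2"
    and p: "pair_alg neg_gens x1 T1" "x0 \<in> H" "pair_alg pos_gens x2 T2"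
    unfolding tri_alg_def by blast
  show ?thesis
    using tri_algI[OF pair_alg.smul[OF p(1)] H_scale[OF p(2)] pair_alg.smul[OF p(3)], of a a a]
    unfolding e cartan_op_scale[OF p(2)] by (simp only: op_smul_add scale_right_distrib)
qed

lemma tri_alg_diff: "tri_alg x T \<Longrightarrow> tri_alg y S \<Longrightarrow> tri_alg (x - y) (T - S)"
  using tri_alg_add[of x T "- y" "- S"] tri_alg_smul[of y S "-1"] by (simp add: op_smul_minus_one)

lemma tri_alg_linear:
  assumes "tri_alg x T"
  shows "op_linear T"
  using assms unfolding tri_alg_def
  by (auto intro!: op_linear_plus op_linear_cartan_op
      dest: cartan_stable_linear[OF cartan_stable_neg_gens] cartan_stable_linear[OF cartan_stable_pos_gens])

abbreviation gens :: "('g \<times> 'i list oper) set" where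
  "gens \<equiv> neg_gens \<union> pos_gens"

lemma gens_linear: "pair_alg gens x T \<Longrightarrow> op_linear T"
  by (rule pair_alg_linear)
    (use cartan_stable_neg_gens cartan_stable_pos_gens in \<open>auto simp: cartan_stable_def\<close>)

lemma letter_brk:
  assumes k: "k \<in> I"
  shows "brk (xp k) (letter_elem j) = (if j = k then h k else 0)"
  using brk_xp_xm[OF k] k by (auto simp: letter_elem_def ad.actm.zero)

text \<open>A negative generator preserves the negative part, sends the Cartan part to multiples of
  itself and moves the positive part into h + n+; positive generators behave symmetrically.\<close>

lemma tri_alg_brk_gen:
  assumes g: "(y, U) \<in> gens" and t: "tri_alg x T"
  shows "tri_alg (brk y x) (op_brk U T)"
proof -
  obtain x1 x0 x2 T1 T2 where
    e: "x = x1 + x0 + x2" "T = T1 + cartan_op x0 + T2"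
    and p: "pair_alg neg_gens x1 T1" "x0 \<in> H" "pair_alg pos_gens x2 T2"
    using t unfolding tri_alg_def by blast
  have U: "op_linear U" using gens_linear[OF pair_alg.gen[OF g]] .
  have 0: "tri_alg (brk y x0) (op_brk U (cartan_op x0))"
  proof -
    obtain a where "brk x0 y = scale a y" "op_brk (cartan_op x0) U = op_smul a U"
      using g p(2) cartan_stable_neg_gens cartan_stable_pos_gens unfolding cartan_stable_def by fast
    then have a: "brk y x0 = scale (-1) (scale a y)" "op_brk U (cartan_op x0) = op_smul (-1) (op_smul a U)"
      using brk_swap[of y x0] op_brk_swap[of U "cartan_op x0"] by (simp_all add: op_smul_minus_one)
    have "tri_alg y U" using g tri_alg_neg[OF borel_alg_pair[OF pair_alg.gen]]
        tri_alg_pos[OF borel_alg_pair[OF pair_alg.gen]] by auto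
    then show ?thesis unfolding a by (intro tri_alg_smul)
  qed
  have "tri_alg (brk y x1) (op_brk U T1) \<and> tri_alg (brk y x2) (op_brk U T2)"
  proof (cases "(y, U) \<in> neg_gens")
    case True
    then obtain j where j: "y = letter_elem j" "U = lower j" by (auto simp: neg_gens_def)
    have "borel_alg pos_gens (brk y x2) (op_brk U T2)"
    proof (rule borel_alg_bracket[OF cartan_stable_pos_gens U _ p(3)])
      fix x T assume "(x, T) \<in> pos_gens"
      then obtain k where k: "k \<in> I" "x = xp k" "T = raise k" by (auto simp: pos_gens_def)
      have *: "brk y x = scale (-1) (if j = k then h k else 0)"
        "op_brk U T = op_smul (-1) (if j = k then cartan_op (h k) else 0)"
        using brk_swap[of y x] op_brk_swap[of U T] op_brk_raise_lower[of k j] letter_brk[OF k(1), of j]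
        by (simp_all add: op_smul_minus_one j k)
      have "borel_alg pos_gens (if j = k then h k else 0) (if j = k then cartan_op (h k) else 0)"
        using borel_alg_cartan[OF coroot_in_H[OF k(1)]] borel_alg_pair[OF pair_alg.zero] by simp
      then show "borel_alg pos_gens (brk y x) (op_brk U T)" unfolding * by (rule borel_alg_smul)
    qed
    then show ?thesis
      using tri_alg_neg[OF borel_alg_pair[OF pair_alg.brk[OF pair_alg.gen[OF True] p(1)]]] tri_alg_pos by simp
  next
    case False
    then have True: "(y, U) \<in> pos_gens" using g by simp
    then obtain k where k: "k \<in> I" "y = xp k" "U = raise k" by (auto simp: pos_gens_def)
    have "borel_alg neg_gens (brk y x1) (op_brk U T1)"
    proof (rule borel_alg_bracket[OF cartan_stable_neg_gens U _ p(1)])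
      fix x T assume "(x, T) \<in> neg_gens"
      then obtain j where j: "x = letter_elem j" "T = lower j" by (auto simp: neg_gens_def)
      show "borel_alg neg_gens (brk y x) (op_brk U T)"
        using op_brk_raise_lower[of k j] letter_brk[OF k(1), of j] borel_alg_cartan[OF coroot_in_H[OF k(1)]]
          borel_alg_pair[OF pair_alg.zero] by (simp add: j k)
    qed
    then show ?thesis
      using tri_alg_pos[OF borel_alg_pair[OF pair_alg.brk[OF pair_alg.gen[OF True] p(3)]]] tri_alg_neg by simp
  qed
  then show ?thesis
    unfolding e brk_add_right op_brk_add_right[OF U] using 0 by (intro tri_alg_add) auto
qed

lemma tri_alg_brk:
  assumes "pair_alg gens y U" "tri_alg x T"
  shows "tri_alg (brk y x) (op_brk U T)"
  using assms
proof (induction arbitrary: x T)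
  case zero
  have "op_brk 0 T = 0" by (rule ext) (simp add: op_brk_def op_linear_zero[OF tri_alg_linear[OF zero]])
  then show ?case
    unfolding ad.act_left_zero by (simp only: tri_alg_neg[OF borel_alg_pair[OF pair_alg.zero]])
next
  case (gen y U)
  then show ?case by (rule tri_alg_brk_gen)
next
  case (add y U z S)
  show ?case
    unfolding brk_add_left op_brk_add_left[OF tri_alg_linear[OF add.prems]]
    by (intro tri_alg_add add.IH add.prems)
next
  case (smul y U a)
  then show ?case
    by (simp add: brk_scale_left op_brk_smul_left[OF tri_alg_linear[OF smul.prems]] tri_alg_smul)
next
  case (brk y U z S)
  have *: "op_brk (op_brk U S) T = op_brk U (op_brk S T) - op_brk S (op_brk U T)"
    using op_brk_jacobi[OF gens_linear[OF brk.hyps(1)] gens_linear[OF brk.hyps(2)] tri_alg_linear[OF brk.prems]]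
    by simp
  show ?case
    unfolding ad.act_brk * by (intro tri_alg_diff brk.IH brk.prems)
qed

lemma gens_tri_alg:
  assumes "pair_alg gens x T"
  shows "tri_alg x T"
  using assms
proof induction
  case (gen x T)
  then show ?case using tri_alg_neg[OF borel_alg_pair[OF pair_alg.gen]]
      tri_alg_pos[OF borel_alg_pair[OF pair_alg.gen]] by auto
qed (intro tri_alg_add tri_alg_smul tri_alg_brk tri_alg_neg[OF borel_alg_pair[OF pair_alg.zero]]; assumption)+

lemma pos_gens_weight: "pair_alg pos_gens x T \<Longrightarrow> x \<in> weight_sum pos_cone"
proof (induction rule: pair_alg.induct)
  case zero
  show ?case by (rule subspace_0[OF weight_sum_subspace])
next
  case (gen x T)
  then show ?case using weight_sum_base[OF xp_root_vector alpha_pos_cone] by (auto simp: pos_gens_def)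
next
  case (brk x T y S)
  show ?case by (rule weight_sum_brk[OF brk.IH pos_cone_add])
qed (auto intro: subspace_add[OF weight_sum_subspace] subspace_scale[OF weight_sum_subspace])

text \<open>The transpose of the fact that n+ kills the highest weight vector.\<close>

lemma pos_gens_Nil: "pair_alg pos_gens x T \<Longrightarrow> T \<xi> [] = 0"
  by (induction arbitrary: \<xi> rule: pair_alg.induct)
    (auto simp: pos_gens_def op_smul_def smul_def op_brk_def)

lemma letter_elem_weight: "letter_elem j \<in> weight_sum neg_cone"
proof (cases "j \<in> I")
  case True
  have "(\<lambda>x. - alpha j x) \<in> neg_cone" using alpha_pos_cone[OF True] by (auto simp: neg_cone_def)
  then show ?thesis using weight_sum_base[OF xm_root_vector[OF True]] True by (simp add: letter_elem_def)
qed (simp add: letter_elem_def subspace_0[OF weight_sum_subspace])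

lemma neg_gens_weight: "pair_alg neg_gens x T \<Longrightarrow> x \<in> weight_sum neg_cone"
proof (induction rule: pair_alg.induct)
  case zero
  show ?case by (rule subspace_0[OF weight_sum_subspace])
next
  case (gen x T)
  then show ?case using letter_elem_weight by (auto simp: neg_gens_def)
next
  case (brk x T y S)
  show ?case by (rule weight_sum_brk[OF brk.IH neg_cone_add])
qed (auto intro: subspace_add[OF weight_sum_subspace] subspace_scale[OF weight_sum_subspace])

section \<open>Forms supported on the powers of one letter\<close>

definition power_supported :: "'i \<Rightarrow> ('i list \<Rightarrow> complex) set" where
  "power_supported i = {\<xi>. \<forall>w. \<xi> w \<noteq> 0 \<longrightarrow> set w \<subseteq> {i}}"

lemma power_supported_lower: "\<xi> \<in> power_supported i \<Longrightarrow> lower j \<xi> \<in> power_supported i"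
  by (force simp: power_supported_def lower_def)

lemma power_supported_lower_other: "\<xi> \<in> power_supported i \<Longrightarrow> j \<noteq> i \<Longrightarrow> lower j \<xi> = 0"
  by (rule ext) (force simp: power_supported_def lower_def)

lemma power_supported_smul: "\<xi> \<in> power_supported i \<Longrightarrow> smul a \<xi> \<in> power_supported i"
  by (auto simp: power_supported_def smul_def)

abbreviation other_neg_cone :: "'i \<Rightarrow> ('g \<Rightarrow> complex) set" where
  "other_neg_cone i \<equiv> {mu \<in> neg_cone. \<exists>z\<in>H. - alpha i z \<noteq> mu z}"

text \<open>On these forms other letters act as 0, and a bracket acts as the commutator of two
  multiples of \<open>lower i\<close>, again 0. Correspondingly, by
  \<open>pos_cone_sum_not_simple\<close>, a bracket has no component of weight -alpha_i, so operator
  and element share the coefficient c.\<close>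

lemma neg_gens_power_supported:
  assumes i: "i \<in> I" and p: "pair_alg neg_gens x T"
  shows "\<exists>c. (\<forall>\<xi>\<in>power_supported i. T \<xi> = smul c (lower i \<xi>)) \<and> x - scale c (xm i) \<in> weight_sum (other_neg_cone i)"
  using p
proof induction
  case zero
  show ?case
    by (intro exI[of _ 0]) (simp add: subspace_0[OF weight_sum_subspace])
next
  case (gen x T)
  then obtain j where j: "x = letter_elem j" "T = lower j" by (auto simp: neg_gens_def)
  show ?case
  proof (cases "j = i")
    case True
    then show ?thesis using i
      by (intro exI[of _ 1]) (simp add: j letter_elem_def subspace_0[OF weight_sum_subspace])
  next
    case False
    have "letter_elem j \<in> weight_sum (other_neg_cone i)"
    proof (cases "j \<in> I")
      case True
      have "\<exists>z\<in>H. - alpha i z \<noteq> - alpha j z"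
      proof (rule ccontr)
        assume n: "\<not> ?thesis"
        have "root_comb (\<lambda>k. of_nat (if k = i then 1 else 0)) z = root_comb (\<lambda>k. of_nat (if k = j then 1 else 0)) z"
          if "z \<in> H" for z
          using n that unfolding alpha_root_comb[OF i, symmetric] alpha_root_comb[OF True, symmetric] by simp
        from root_comb_inject[OF this i] False show False by simp
      qed
      then have "(\<lambda>x. - alpha j x) \<in> other_neg_cone i" using alpha_pos_cone[OF True] by (auto simp: neg_cone_def)
      then show ?thesis using weight_sum_base[OF xm_root_vector[OF True]] True by (simp add: letter_elem_def)
    qed (simp add: letter_elem_def subspace_0[OF weight_sum_subspace])
    then show ?thesis
      using power_supported_lower_other[OF _ False] by (intro exI[of _ 0]) (simp add: j)
  qed
next
  case (add x T y S)
  then obtain c d where c: "\<forall>\<xi>\<in>power_supported i. T \<xi> = smul c (lower i \<xi>)" "x - scale c (xm i) \<in> weight_sum (other_neg_cone i)"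
    and d: "\<forall>\<xi>\<in>power_supported i. S \<xi> = smul d (lower i \<xi>)" "y - scale d (xm i) \<in> weight_sum (other_neg_cone i)"
    by blast
  have "x + y - scale (c + d) (xm i) = (x - scale c (xm i)) + (y - scale d (xm i))"
    by (simp add: scale_left_distrib)
  then have "x + y - scale (c + d) (xm i) \<in> weight_sum (other_neg_cone i)"
    using subspace_add[OF weight_sum_subspace c(2) d(2)] by (simp only:)
  moreover have "(T + S) \<xi> = smul (c + d) (lower i \<xi>)" if "\<xi> \<in> power_supported i" for \<xi>
    using c(1) d(1) that by (simp add: fun_eq_iff smul_def distrib_right)
  ultimately show ?case by blast
next
  case (smul x T a)
  then obtain c where c: "\<forall>\<xi>\<in>power_supported i. T \<xi> = smul c (lower i \<xi>)" "x - scale c (xm i) \<in> weight_sum (other_neg_cone i)"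
    by blast
  have "scale a x - scale (a * c) (xm i) \<in> weight_sum (other_neg_cone i)"
    using subspace_scale[OF weight_sum_subspace c(2), of a] by (simp add: scale_right_diff_distrib)
  moreover have "op_smul a T \<xi> = smul (a * c) (lower i \<xi>)" if "\<xi> \<in> power_supported i" for \<xi>
    using c(1) that by (simp add: op_smul_def smul_smul)
  ultimately show ?case by blast
next
  case (brk x T y S)
  then obtain c d where c: "\<forall>\<xi>\<in>power_supported i. T \<xi> = smul c (lower i \<xi>)"
    and d: "\<forall>\<xi>\<in>power_supported i. S \<xi> = smul d (lower i \<xi>)"
    by blast
  have "op_brk T S \<xi> = smul 0 (lower i \<xi>)" if "\<xi> \<in> power_supported i" for \<xi>
    using c d that
    by (simp add: op_brk_def power_supported_smul power_supported_lower
        op_linear_smul[OF op_linear_lower] smul_smul mult.commute)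
  moreover have "brk x y \<in> weight_sum (other_neg_cone i)"
  proof (rule weight_sum_brk[OF neg_gens_weight[OF brk.hyps(1)] neg_gens_weight[OF brk.hyps(2)]])
    fix mu nu assume mn: "mu \<in> neg_cone" "nu \<in> neg_cone"
    then obtain b c where "mu = (\<lambda>x. - b x)" "nu = (\<lambda>x. - c x)" "b \<in> pos_cone" "c \<in> pos_cone"
      by (auto simp: neg_cone_def)
    moreover from this obtain z where "z \<in> H" "c z + b z \<noteq> alpha i z"
      using pos_cone_sum_not_simple[OF _ _ i] by blast
    ultimately have "\<exists>z\<in>H. - alpha i z \<noteq> nu z + mu z"
      by (intro bexI[of _ z]) (auto simp: algebra_simps eq_neg_iff_add_eq_0)
    then show "(\<lambda>z. nu z + mu z) \<in> other_neg_cone i" using neg_cone_add[OF mn] by simp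
  qed
  ultimately show ?case by (intro exI[of _ 0]) simp
qed

text \<open>On these functions the operator attached to an element of the Lie algebra does not depend on
  its expression through the generators.\<close>

definition well_defined :: "('i list \<Rightarrow> complex) set" where
  "well_defined = {\<xi>. \<forall>T. pair_alg gens 0 T \<longrightarrow> T \<xi> = 0}"

text \<open>Induction on the word at which T \<xi> is evaluated. At the empty word all three
  triangular parts vanish. The value at j # w is the value at w of
  \<open>op_brk T (lower j) \<xi>\<close> plus that of \<open>T (lower j \<xi>)\<close>, where both
  operators are paired with 0 and both forms are power-supported.\<close>

lemma power_supported_well_defined:
  assumes i: "i \<in> I" and x: "\<xi> \<in> power_supported i"
  shows "\<xi> \<in> well_defined"
proof -
  have "T \<xi> w = 0" if "\<xi> \<in> power_supported i" "pair_alg gens 0 T" for \<xi> T w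
    using that
  proof (induction w arbitrary: \<xi> T)
    case Nil
    obtain x1 x0 x2 T1 T2 where e: "0 = x1 + x0 + x2" "T = T1 + cartan_op x0 + T2"
      and p: "pair_alg neg_gens x1 T1" "x0 \<in> H" "pair_alg pos_gens x2 T2"
      using gens_tri_alg[OF Nil(2)] unfolding tri_alg_def by blast
    note z = triangular_sum_eq_zero[OF neg_gens_weight[OF p(1)] p(2) pos_gens_weight[OF p(3)] e(1)[symmetric]]
    obtain c where c: "T1 \<xi> = smul c (lower i \<xi>)" "x1 - scale c (xm i) \<in> weight_sum (other_neg_cone i)"
      using neg_gens_power_supported[OF i p(1)] Nil(1) by blast
    \<comment> \<open>As x1 = 0, the vector c \<open>xm i\<close> has weight -alpha_i and also lies
      in the sum of the weight spaces for other weights.\<close>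
    have "- scale c (xm i) \<in> weight_space H scale brk (\<lambda>x. - alpha i x)"
      using subspace_neg[OF ad.weight_space_subspace subspace_scale[OF ad.weight_space_subspace xm_root_vector[OF i]]] .
    then have "- scale c (xm i) \<in> weight_sum {\<lambda>x. - alpha i x}" by (rule weight_sum_base) simp
    moreover have "- scale c (xm i) \<in> weight_sum (other_neg_cone i)" using c(2) z(1) by simp
    ultimately have "- scale c (xm i) = 0" by (rule weight_sum_Int) auto
    then have "c = 0" using xm_nonzero[OF i] by simp
    then show ?case
      using c(1) pos_gens_Nil[OF p(3)] unfolding e(2) z(2) cartan_op_zero by simp
  next
    case (Cons j w)
    have "pair_alg gens (brk 0 (letter_elem j)) (op_brk T (lower j))"
      by (rule pair_alg.brk[OF Cons.prems(2) pair_alg.gen]) (simp add: neg_gens_def)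
    then have "op_brk T (lower j) \<xi> w = 0"
      using Cons.IH[OF Cons.prems(1)] by (simp add: ad.act_left_zero)
    moreover have "T (lower j \<xi>) w = 0" using Cons.IH[OF power_supported_lower[OF Cons.prems(1)] Cons.prems(2)] .
    ultimately show ?case by (simp add: op_brk_def lower_def)
  qed
  then show ?thesis using x by (auto simp: well_defined_def fun_eq_iff)
qed

lemma well_defined_add: "\<xi> \<in> well_defined \<Longrightarrow> \<eta> \<in> well_defined \<Longrightarrow> \<xi> + \<eta> \<in> well_defined"
  by (auto simp: well_defined_def op_linear_add[OF gens_linear])

lemma well_defined_smul: "\<xi> \<in> well_defined \<Longrightarrow> smul a \<xi> \<in> well_defined"
  unfolding well_defined_def
proof safe
  fix T assume "\<forall>T. pair_alg gens 0 T \<longrightarrow> T \<xi> = 0" and T: "pair_alg gens 0 T"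
  then have "T \<xi> = 0" by blast
  then show "T (smul a \<xi>) = 0" by (simp add: op_linear_smul[OF gens_linear[OF T]])
qed

text \<open>The pairs with first component 0 form an ideal: the bracket of (0, T) and (x, S) is
  another one, so S (T \<xi>) - T (S \<xi>) = 0.\<close>

lemma well_defined_closed:
  assumes p: "pair_alg gens x S" and \<xi>: "\<xi> \<in> well_defined"
  shows "S \<xi> \<in> well_defined"
  unfolding well_defined_def
proof safe
  fix T assume T: "pair_alg gens 0 T"
  have "pair_alg gens 0 (op_brk T S)" using pair_alg.brk[OF T p] by (simp add: ad.act_left_zero)
  then have "op_brk T S \<xi> = 0" "T \<xi> = 0" using \<xi> T by (auto simp: well_defined_def)
  then show "T (S \<xi>) = 0" by (simp add: op_brk_def op_linear_zero[OF gens_linear[OF p]])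
qed

lemma well_defined_unique:
  assumes "pair_alg gens x T" "pair_alg gens x S" "\<xi> \<in> well_defined"
  shows "T \<xi> = S \<xi>"
proof -
  have "pair_alg gens 0 (T - S)" using pair_alg_diff[OF assms(1,2)] by simp
  then have "(T - S) \<xi> = 0" using assms(3) by (auto simp: well_defined_def)
  then show ?thesis by simp
qed

section \<open>The action of the Lie algebra on well-defined forms\<close>

lemma pair_alg_exists: "\<exists>T. pair_alg gens x T"
proof -
  let ?X = "{x. \<exists>T. pair_alg gens x T}"
  have "lie_subalgebra ?X"
    unfolding lie_subalgebra_def subspace_def
    using pair_alg.zero[of gens] pair_alg.add[of gens] pair_alg.smul[of gens] pair_alg.brk[of gens] by blast
  moreover have "xp ` I \<union> xm ` I \<subseteq> ?X"
  proof safe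
    fix i assume i: "i \<in> I"
    have "pair_alg gens (xp i) (raise i)" using i by (intro pair_alg.gen) (auto simp: pos_gens_def)
    then show "\<exists>T. pair_alg gens (xp i) T" by blast
    have "pair_alg gens (letter_elem i) (lower i)" by (intro pair_alg.gen) (auto simp: neg_gens_def)
    then show "\<exists>T. pair_alg gens (xm i) T" using i unfolding letter_elem_def by auto
  qed
  ultimately have "lie_subalgebra hull (xp ` I \<union> xm ` I) \<subseteq> ?X" by (intro hull_minimal)
  then show ?thesis unfolding generators by auto
qed

text \<open>An arbitrary choice; by \<open>oper_eqI\<close> all choices agree on
  \<open>well_defined\<close>.\<close>

definition oper :: "'g \<Rightarrow> 'i list oper" where
  "oper x = (SOME T. pair_alg gens x T)"

lemma oper_pair: "pair_alg gens x (oper x)"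
  unfolding oper_def using pair_alg_exists by (rule someI_ex)

lemma oper_eqI: "pair_alg gens x T \<Longrightarrow> \<xi> \<in> well_defined \<Longrightarrow> oper x \<xi> = T \<xi>"
  using well_defined_unique[OF oper_pair] .

lemma oper_well_defined: "\<xi> \<in> well_defined \<Longrightarrow> oper x \<xi> \<in> well_defined"
  using well_defined_closed[OF oper_pair] .

lemma op_linear_oper: "op_linear (oper x)"
  by (rule gens_linear[OF oper_pair])

lemma oper_xm: "i \<in> I \<Longrightarrow> \<xi> \<in> well_defined \<Longrightarrow> oper (xm i) \<xi> = lower i \<xi>"
proof (rule oper_eqI)
  assume "i \<in> I"
  then show "pair_alg gens (xm i) (lower i)"
    by (intro pair_alg.gen) (auto simp: neg_gens_def letter_elem_def)
qed

lemma oper_tri: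
  assumes "\<xi> \<in> well_defined"
  obtains x1 x0 x2 where "x = x1 + x0 + x2" "x1 \<in> weight_sum neg_cone" "x0 \<in> H" "x2 \<in> weight_sum pos_cone"
    "x1 = 0 \<Longrightarrow> oper x \<xi> [] = lam x0 * \<xi> []"
proof -
  obtain x1 x0 x2 T1 T2 where e: "x = x1 + x0 + x2" "oper x = T1 + cartan_op x0 + T2"
    and p: "pair_alg neg_gens x1 T1" "x0 \<in> H" "pair_alg pos_gens x2 T2"
    using gens_tri_alg[OF oper_pair] unfolding tri_alg_def by blast
  have "oper x \<xi> [] = lam x0 * \<xi> []" if "x1 = 0"
  proof -
    \<comment> \<open>From x1 = 0 it does not follow that T1 = 0, but (0, T1) is one of the pairs
      whose operators kill \<open>well_defined\<close>.\<close>
    have "pair_alg gens 0 T1" using pair_alg_mono[OF p(1)] that by auto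
    then have "T1 \<xi> = 0" using assms by (auto simp: well_defined_def)
    then show ?thesis using pos_gens_Nil[OF p(3)] by (simp add: e(2) cartan_op_def)
  qed
  then show ?thesis using that[OF e(1) neg_gens_weight[OF p(1)] p(2) pos_gens_weight[OF p(3)]] by blast
qed

text \<open>The decomposition of x obtained from the generators is compared with its position among
  the root spaces: subtracting x from x2 leaves a triangular decomposition of 0.\<close>

lemma oper_nilradical_Nil:
  assumes x: "x \<in> nilradical_pos scale brk H I alpha" and \<xi>: "\<xi> \<in> well_defined"
  shows "oper x \<xi> [] = 0"
proof -
  obtain x1 x0 x2 where e: "x = x1 + x0 + x2" and p: "x1 \<in> weight_sum neg_cone" "x0 \<in> H" "x2 \<in> weight_sum pos_cone"
    and o: "x1 = 0 \<Longrightarrow> oper x \<xi> [] = lam x0 * \<xi> []"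
    using oper_tri[OF \<xi>] by metis
  have "x2 - x \<in> weight_sum pos_cone"
    using subspace_diff[OF weight_sum_subspace p(3)] x nilradical_pos_weight_sum by blast
  moreover have "x1 + x0 + (x2 - x) = 0" by (simp add: e)
  ultimately have "x1 = 0" "x0 = 0" using triangular_sum_eq_zero p by blast+
  moreover have "lam 0 = 0" using word_weight_scale[OF H_zero, of "[]" 0] by simp
  ultimately show ?thesis using o by simp
qed

lemma oper_cartan_Nil:
  assumes x: "x \<in> H" and \<xi>: "\<xi> \<in> well_defined"
  shows "oper x \<xi> [] = lam x * \<xi> []"
proof -
  obtain x1 x0 x2 where e: "x = x1 + x0 + x2" and p: "x1 \<in> weight_sum neg_cone" "x0 \<in> H" "x2 \<in> weight_sum pos_cone"
    and o: "x1 = 0 \<Longrightarrow> oper x \<xi> [] = lam x0 * \<xi> []"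
    using oper_tri[OF \<xi>] by metis
  have "x0 - x \<in> H" using subspace_diff[OF H_subspace p(2) x] .
  moreover have "x1 + (x0 - x) + x2 = 0" by (simp add: e algebra_simps)
  ultimately have "x1 = 0" "x0 - x = 0" using triangular_sum_eq_zero p by blast+
  then show ?thesis using o by simp
qed


subsection \<open>Parabolic Verma modules\<close>

text \<open>Transposition reverses products, so the leftmost letter is applied first; hence
  \<open>fold\<close>, and the order of factors in \<open>rep_mult\<close>.\<close>

fun word_oper :: "'g fword \<Rightarrow> 'i list oper" where
  "word_oper (FWord xs) = fold oper xs"

definition rep :: "'g free_algebra \<Rightarrow> 'i list oper" where
  "rep u \<xi> = (\<lambda>w. \<Sum>k\<in>Poly_Mapping.keys u. Poly_Mapping.lookup u k * word_oper k \<xi> w)"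

lemma op_linear_word_oper: "op_linear (word_oper k)"
proof (cases k)
  case (FWord xs)
  have "op_linear (fold oper xs)"
    by (induction xs) (auto simp: op_linear_def op_linear_simps[OF op_linear_oper])
  then show ?thesis by (simp add: FWord)
qed

lemma word_oper_well_defined: "\<xi> \<in> well_defined \<Longrightarrow> word_oper k \<xi> \<in> well_defined"
proof (cases k)
  case (FWord xs)
  show "\<xi> \<in> well_defined \<Longrightarrow> word_oper k \<xi> \<in> well_defined"
    unfolding FWord by (induction xs arbitrary: \<xi>) (auto simp: oper_well_defined)
qed

lemma word_oper_plus: "word_oper (k + l) \<xi> = word_oper l (word_oper k \<xi>)"
  by (cases k; cases l) simp

lemma rep_add: "rep (u + v) \<xi> = rep u \<xi> + rep v \<xi>"
  unfolding rep_def
proof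
  fix w
  show "(\<Sum>k\<in>Poly_Mapping.keys (u + v). Poly_Mapping.lookup (u + v) k * word_oper k \<xi> w) =
      ((\<lambda>w. \<Sum>k\<in>Poly_Mapping.keys u. Poly_Mapping.lookup u k * word_oper k \<xi> w) +
       (\<lambda>w. \<Sum>k\<in>Poly_Mapping.keys v. Poly_Mapping.lookup v k * word_oper k \<xi> w)) w"
    unfolding plus_fun_apply
    by (rule setsum_keys_plus_distrib[of "\<lambda>k a. a * word_oper k \<xi> w"]) (simp_all add: distrib_right)
qed

lemma rep_single: "rep (Poly_Mapping.single k c) \<xi> = smul c (word_oper k \<xi>)"
  by (rule ext) (simp add: rep_def smul_def)

lemma rep_diff: "rep (u - v) \<xi> = rep u \<xi> - rep v \<xi>"
  using rep_add[of "u - v" v \<xi>] by simp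

lemma op_linear_rep: "op_linear (rep u)"
proof (induction u rule: free_algebra_induct)
  case (single xs c)
  show ?case
    using op_linear_op_smul[OF op_linear_word_oper, of c "FWord xs"] unfolding op_smul_def rep_single[symmetric] .
next
  case (add u w)
  have "rep (u + w) = rep u + rep w" by (rule ext) (simp add: rep_add)
  then show ?case using op_linear_plus[OF add] by (simp only:)
qed

lemma rep_mult: "rep (u * v) \<xi> = rep v (rep u \<xi>)"
proof (induction u rule: free_algebra_induct)
  case (single xs c)
  show ?case
  proof (induction v rule: free_algebra_induct)
    case (single ys d)
    show ?case
      by (simp only: mult_single rep_single word_oper_plus op_linear_smul[OF op_linear_word_oper] smul_smul mult.commute)
  next
    case (add u w)
    then show ?case by (simp add: distrib_left rep_add)
  qed
next
  case (add u w)
  then show ?case unfolding distrib_right rep_add op_linear_add[OF op_linear_rep] by simp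
qed

lemma rep_well_defined:
  assumes "\<xi> \<in> well_defined"
  shows "rep u \<xi> \<in> well_defined"
  by (induction u rule: free_algebra_induct)
    (auto simp only: rep_single rep_add intro: well_defined_add well_defined_smul word_oper_well_defined assms)

lemma rep_fgen: "rep (fgen x) \<xi> = oper x \<xi>"
  by (simp add: fgen_def rep_single)

lemma rep_fscalar: "rep (fscalar c) \<xi> = smul c \<xi>"
  by (simp add: fscalar_def rep_single zero_fword_def)

lemma rep_fgen_power: "rep (fgen x ^ n) \<xi> = (oper x ^^ n) \<xi>"
proof (induction n arbitrary: \<xi>)
  case 0
  show ?case using rep_fscalar[of 1 \<xi>] by (simp add: fscalar_def)
next
  case (Suc n)
  then show ?case by (simp add: rep_mult rep_fgen funpow_swap1)
qed

lemma rep_xm_power: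
  assumes i: "i \<in> I" and \<xi>: "\<xi> \<in> well_defined"
  shows "rep (fgen (xm i) ^ n) \<xi> w = \<xi> (replicate n i @ w)"
proof -
  have "(oper (xm i) ^^ n) \<xi> = (lower i ^^ n) \<xi> \<and> (oper (xm i) ^^ n) \<xi> \<in> well_defined"
  proof (induction n)
    case (Suc n)
    show ?case
      using oper_xm[OF i conjunct2[OF Suc]] oper_well_defined[OF conjunct2[OF Suc], of "xm i"] conjunct1[OF Suc]
      by simp
  qed (use \<xi> in simp)
  then show ?thesis by (simp add: rep_fgen_power lower_funpow)
qed

text \<open>The three kinds of relators match the rules \<open>add\<close>, \<open>smul\<close> and
  \<open>brk\<close> of \<open>pair_alg\<close>, and \<open>oper_eqI\<close> identifies the
  operators built by these rules with the chosen ones.\<close>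

lemma uea_ideal_rep:
  assumes u: "u \<in> uea_ideal scale brk" and \<xi>: "\<xi> \<in> well_defined"
  shows "rep u \<xi> = 0"
proof -
  let ?L = "{u. \<forall>\<xi>\<in>well_defined. rep u \<xi> = 0}"
  have zero: "rep 0 \<xi> = 0" for \<xi> by (rule ext) (simp add: rep_def)
  have ideal: "two_sided_ideal ?L"
    unfolding two_sided_ideal_def left_ideal_def
    by (auto simp: zero rep_add rep_mult rep_well_defined op_linear_zero[OF op_linear_rep])
  have 1: "fgen (x + y) - fgen x - fgen y \<in> ?L" for x y
    using oper_eqI[OF pair_alg.add[OF oper_pair[of x] oper_pair[of y]]] by (auto simp: rep_diff rep_fgen)
  have 2: "fgen (scale c x) - fscalar c * fgen x \<in> ?L" for c x
    using oper_eqI[OF pair_alg.smul[OF oper_pair[of x], of c]]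
    by (auto simp: rep_diff rep_mult rep_fgen rep_fscalar op_smul_def op_linear_smul[OF op_linear_oper])
  have 3: "fgen x * fgen y - fgen y * fgen x - fgen (brk x y) \<in> ?L" for x y
    using oper_eqI[OF pair_alg.brk[OF oper_pair[of x] oper_pair[of y]]]
    by (auto simp: rep_diff rep_mult rep_fgen op_brk_def)
  have "uea_ideal scale brk \<subseteq> ?L"
    unfolding uea_ideal_def
  proof (rule hull_minimal)
    show "two_sided_ideal ?L" by (rule ideal)
  qed (use 1 2 3 in blast)
  then show ?thesis using u \<xi> by blast
qed

context
  fixes J' :: "'i set"
  assumes J': "J' \<subseteq> integral_nodes I h lam"
begin

abbreviation exponent :: "'i \<Rightarrow> nat" where
  "exponent j \<equiv> hw_label h lam j + 1"

text \<open>The forms that vanish on the left ideal of the word algebra generated by the given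
  powers. A power stands at the end of the word because it is applied to the highest weight vector
  first.\<close>

definition annihilated :: "('i list \<Rightarrow> complex) set" where
  "annihilated = {\<xi>. \<forall>j\<in>J'. \<forall>w. \<xi> (w @ replicate (exponent j) j) = 0}"

text \<open>Transpose of \<open>string_raise\<close>. The factor lam (h j) - n vanishes at n = lam
  (h j), which makes \<open>annihilated\<close> stable under \<open>raise\<close>.\<close>

lemma raise_replicate:
  assumes j: "j \<in> I"
  shows "raise k \<xi> (replicate (Suc n) j) =
    (if k = j then of_nat (Suc n) * (lam (h j) - of_nat n) * \<xi> (replicate n j) else 0)"
proof -
  have w: "word_weight (replicate n j) (h j) = lam (h j) - 2 * of_nat n" for n
    using j coroot[OF j] by (induction n) (auto simp: letter_weight_def algebra_simps)
  show ?thesis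
  proof (induction n arbitrary: \<xi>)
    case (Suc n)
    have l: "lower j \<xi> (replicate n j) = \<xi> (replicate (Suc n) j)" by (simp add: lower_def)
    have "raise k \<xi> (replicate (Suc (Suc n)) j) = raise k (lower j \<xi>) (replicate (Suc n) j) +
        (if j = k then word_weight (replicate (Suc n) j) (h k) * \<xi> (replicate (Suc n) j) else 0)"
      by simp
    also have "\<dots> = (if k = j then of_nat (Suc (Suc n)) * (lam (h j) - of_nat (Suc n)) * \<xi> (replicate (Suc n) j) else 0)"
      unfolding Suc by (auto simp: w l algebra_simps simp del: replicate_Suc)
    finally show ?case .
  qed simp
qed

lemma annihilated_lower: "\<xi> \<in> annihilated \<Longrightarrow> lower j \<xi> \<in> annihilated"
  unfolding annihilated_def lower_def by (auto simp flip: append_Cons)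

lemma annihilated_raise:
  assumes "\<xi> \<in> annihilated"
  shows "raise k \<xi> \<in> annihilated"
proof -
  have "raise k \<xi> (w @ replicate (exponent j) j) = 0" if "\<xi> \<in> annihilated" "j \<in> J'" for w \<xi> j
    using that(1)
  proof (induction w arbitrary: \<xi>)
    case Nil
    have "j \<in> I" "lam (h j) \<in> \<nat>" using J' that(2) by (auto simp: integral_nodes_def)
    then obtain m where "j \<in> I" "lam (h j) = of_nat m" by (auto elim: Nats_cases)
    then have j: "j \<in> I" "lam (h j) = of_nat (hw_label h lam j)"
      using hw_label_eqI[of lam h j m] by auto
    show ?case using raise_replicate[OF j(1), of k \<xi> "hw_label h lam j"] j(2) by simp
  next
    case (Cons a w)
    have "\<xi> (w @ replicate (exponent j) j) = 0"
      using Cons.prems that(2) by (simp only: annihilated_def) blast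
    then show ?case using Cons.IH[OF annihilated_lower[OF Cons.prems]] by simp
  qed
  from this[OF assms] show ?thesis by (simp only: annihilated_def) blast
qed

lemma annihilated_closed:
  assumes "pair_alg gens x T" "\<xi> \<in> annihilated"
  shows "T \<xi> \<in> annihilated"
  using assms
proof (induction arbitrary: \<xi>)
  case (gen x T)
  then show ?case using annihilated_lower annihilated_raise by (auto simp: neg_gens_def pos_gens_def)
next
  case (brk x T y S)
  have "S (T \<xi>) \<in> annihilated" "T (S \<xi>) \<in> annihilated" using brk by blast+
  then show ?case by (simp add: op_brk_def annihilated_def)
qed (auto simp: annihilated_def op_smul_def smul_def)

text \<open>The elements u whose value at the empty word vanishes for all forms in \<open>?D\<close>
  form a left ideal, because \<open>?D\<close> is stable under \<open>rep\<close>: r u on \<xi> is u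
  on \<open>rep r \<xi>\<close>. It then remains to test the generators of the ideal.\<close>

lemma parabolic_verma_ideal_rep:
  assumes u: "u \<in> parabolic_verma_ideal scale brk H I alpha xm h lam J'"
    and \<xi>: "\<xi> \<in> well_defined" "\<xi> \<in> annihilated"
  shows "rep u \<xi> [] = 0"
proof -
  let ?D = "well_defined \<inter> annihilated"
  let ?L = "{u. \<forall>\<xi>\<in>?D. rep u \<xi> [] = 0}"
  have rep_D: "rep u \<xi> \<in> ?D" if "\<xi> \<in> ?D" for u \<xi>
  proof (induction u rule: free_algebra_induct)
    case (single xs c)
    have "fold oper xs \<xi> \<in> ?D"
      using that by (induction xs arbitrary: \<xi>) (auto simp: oper_well_defined annihilated_closed[OF oper_pair])
    then show ?case unfolding rep_single using well_defined_smul by (auto simp: annihilated_def smul_def)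
  next
    case (add u w)
    then show ?case unfolding rep_add by (intro IntI well_defined_add) (auto simp: annihilated_def)
  qed
  have zero: "rep 0 \<xi> = 0" for \<xi> by (rule ext) (simp add: rep_def)
  have ideal: "left_ideal ?L"
    unfolding left_ideal_def using rep_D by (auto simp: zero rep_add rep_mult)
  have 1: "uea_ideal scale brk \<subseteq> ?L" using uea_ideal_rep by auto
  have 2: "fgen ` nilradical_pos scale brk H I alpha \<subseteq> ?L"
    using oper_nilradical_Nil by (auto simp: rep_fgen)
  have 3: "fgen x - fscalar (lam x) \<in> ?L" if "x \<in> H" for x
    using oper_cartan_Nil[OF that] by (auto simp: rep_diff rep_fgen rep_fscalar smul_def)
  have "verma_ideal scale brk H I alpha lam \<subseteq> ?L"
    unfolding verma_ideal_def
  proof (rule hull_minimal)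
    show "left_ideal ?L" by (rule ideal)
  qed (use 1 2 3 in blast)
  moreover have "fgen (xm j) ^ exponent j \<in> ?L" if j: "j \<in> J'" for j
  proof -
    have "j \<in> I" using j J' by (auto simp: integral_nodes_def)
    moreover have "\<xi> (replicate (exponent j) j) = 0" if "\<xi> \<in> annihilated" for \<xi>
      using that j unfolding annihilated_def by (metis (mono_tags, lifting) append_Nil mem_Collect_eq)
    ultimately show ?thesis by (simp add: rep_xm_power del: power_Suc replicate_Suc add_Suc_right)
  qed
  ultimately have "parabolic_verma_ideal scale brk H I alpha xm h lam J' \<subseteq> ?L"
    unfolding parabolic_verma_ideal_def
  proof (intro hull_minimal)
    show "left_ideal ?L" by (rule ideal)
  qed blast
  then show ?thesis using u \<xi> by blast
qed

lemma power_in_parabolic_verma_ideal: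
  assumes i: "i \<in> I" and p: "fgen (xm i) ^ n \<in> parabolic_verma_ideal scale brk H I alpha xm h lam J'"
  shows "i \<in> J'"
proof (rule ccontr)
  assume n: "i \<notin> J'"
  define \<xi> :: "'i list \<Rightarrow> complex" where "\<xi> w = (if w = replicate n i then 1 else 0)" for w
  have "\<xi> \<in> power_supported i" by (auto simp: power_supported_def \<xi>_def)
  then have wd: "\<xi> \<in> well_defined" by (rule power_supported_well_defined[OF i])
  \<comment> \<open>The exponent is at least 1, so the letter j, different from i, does
    occur.\<close>
  have "w @ replicate (exponent j) j \<noteq> replicate n i" if "j \<in> J'" for w j
  proof
    assume "w @ replicate (exponent j) j = replicate n i"
    moreover have "j \<in> set (w @ replicate (exponent j) j)" by simp
    ultimately have "j \<in> set (replicate n i)" by (simp only:)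
    then show False using n that by (auto split: if_splits)
  qed
  then have "\<xi> \<in> annihilated" by (simp add: annihilated_def \<xi>_def)
  from parabolic_verma_ideal_rep[OF p wd this] show False
    by (simp add: rep_xm_power[OF i wd] \<xi>_def)
qed

end

end

theorem theorem1:
  fixes scale :: "complex \<Rightarrow> 'g::ab_group_add \<Rightarrow> 'g"
    and brk :: "'g \<Rightarrow> 'g \<Rightarrow> 'g"
    and H :: "'g set"
    and I :: "'i set"
    and alpha :: "'i \<Rightarrow> 'g \<Rightarrow> complex"
    and xp xm h :: "'i \<Rightarrow> 'g"
    and lam :: "'g \<Rightarrow> complex"
    and vscale :: "complex \<Rightarrow> 'v::ab_group_add \<Rightarrow> 'v"
    and act :: "'g \<Rightarrow> 'v \<Rightarrow> 'v"
    and v :: 'v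
  assumes "semisimple_lie_algebra scale brk H I alpha xp xm h"
    and "lam \<in> dual_space scale H"
    and "highest_weight_module scale brk H I alpha lam vscale act"
    and "weight_space H vscale act lam = module.span vscale {v}"
  shows "(\<exists>!J0. is_integrability_set scale H I alpha h lam vscale act J0) \<and>
    (\<forall>J0. is_integrability_set scale H I alpha h lam vscale act J0 \<longrightarrow>
       J0 = {i \<in> integral_nodes I h lam. (act (xm i) ^^ (hw_label h lam i + 1)) v = 0} \<and>
       (\<forall>J'. J' \<subseteq> integral_nodes I h lam \<and>
          is_parabolic_verma_module scale brk H I alpha xm h lam J' vscale act \<longrightarrow> J0 = J') \<and>
       (is_simple_highest_weight_module scale brk H I alpha lam vscale act \<longrightarrow>
          J0 = integral_nodes I h lam))"
proof -
  interpret semisimple_lie_algebra scale brk H I alpha xp xm h by (rule assms(1))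
  obtain phi K where m: "lie_module scale brk vscale act" and nz: "(UNIV :: 'v set) \<noteq> {0}"
    and phi: "surjection_with_kernel vscale act phi K" "verma_ideal scale brk H I alpha lam \<subseteq> K"
    using assms(3) unfolding highest_weight_module_def by blast
  define v0 where "v0 = phi 1"
  interpret M: highest_weight_setup scale brk H I alpha xp xm h vscale act lam v0
    unfolding v0_def by (rule highest_weight_setup_of_quotient[OF assms(1,2) m nz phi])
  have unique: "J0 = M.integrable_nodes" if "is_integrability_set scale H I alpha h lam vscale act J0" for J0
    using M.integrability_set_unique[OF that] .
  \<comment> \<open>The given v and the image v0 of 1 differ by a nonzero scalar, which leaves the
    vanishing of powers unchanged.\<close>
  have "v0 \<in> M.V.span {v}" using M.v0_weight assms(4) by simp
  then obtain a where a: "v0 = vscale a v" by (auto simp: M.V.span_singleton)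
  then have "a \<noteq> 0" using M.v0_nonzero by auto
  then have zero_iff: "(act x ^^ k) v0 = 0 \<longleftrightarrow> (act x ^^ k) v = 0" for x k
    unfolding a M.funpow_act_scale by simp
  have parabolic: "M.integrable_nodes = J'"
    if J': "J' \<subseteq> integral_nodes I h lam"
      and p: "is_parabolic_verma_module scale brk H I alpha xm h lam J' vscale act" for J'
  proof -
    let ?P = "parabolic_verma_ideal scale brk H I alpha xm h lam J'"
    obtain psi where psi: "surjection_with_kernel vscale act psi ?P"
      using p unfolding is_parabolic_verma_module_def by blast
    have "verma_ideal scale brk H I alpha lam \<subseteq> ?P"
      unfolding parabolic_verma_ideal_def by (rule order_trans[OF _ hull_subset]) simp
    \<comment> \<open>The parabolic presentation has its own generator \<open>psi 1\<close>. The
      integrability set depends only on the weights of the module, so by uniqueness it can be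
      computed from this generator, where vanishing means membership in \<open>?P\<close>.\<close>
    then interpret P: highest_weight_setup scale brk H I alpha xp xm h vscale act lam "psi 1"
      by (rule highest_weight_setup_of_quotient[OF assms(1,2) m nz psi])
    interpret D: dual_verma scale brk H I alpha xp xm h lam
      by unfold_locales (rule assms(2))
    have mem: "(act (xm i) ^^ n) (psi 1) = 0 \<longleftrightarrow> fgen (xm i) ^ n \<in> ?P" for i n
      using M.phi_kernel[OF psi] M.phi_fgen_power[OF psi] by metis
    have gen: "fgen (xm i) ^ (hw_label h lam i + 1) \<in> ?P" if "i \<in> J'" for i
      unfolding parabolic_verma_ideal_def by (rule hull_inc) (use that in blast)
    have "integral_nodes I h lam \<subseteq> I" by (auto simp: integral_nodes_def)
    then have "P.integrable_nodes = J'"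
      unfolding P.integrable_nodes_eq mem
      using J' gen D.power_in_parabolic_verma_ideal[OF J'] by blast
    then show ?thesis using unique[OF P.integrability_set] by simp
  qed
  have simple: "M.integrable_nodes = integral_nodes I h lam"
    if "is_simple_highest_weight_module scale brk H I alpha lam vscale act"
  proof -
    have s: "M.simple_module" using that by (simp add: is_simple_highest_weight_module_def)
    have "i \<in> M.integrable_nodes" if i: "i \<in> integral_nodes I h lam" for i
    proof -
      obtain n where "i \<in> I" "lam (h i) = of_nat n"
        using i by (auto simp: integral_nodes_def elim: Nats_cases)
      then show ?thesis by (rule M.integrable_node_if_simple[OF s])
    qed
    then show ?thesis unfolding M.integrable_nodes_eq by blast
  qed
  have nodes: "M.integrable_nodes = {i \<in> integral_nodes I h lam. (act (xm i) ^^ (hw_label h lam i + 1)) v = 0}"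
    unfolding M.integrable_nodes_eq zero_iff ..
  show ?thesis
  proof (intro conjI allI impI)
    show "\<exists>!J0. is_integrability_set scale H I alpha h lam vscale act J0"
      using M.integrability_set unique by blast
  next
    fix J0 assume J0: "is_integrability_set scale H I alpha h lam vscale act J0"
    show "J0 = {i \<in> integral_nodes I h lam. (act (xm i) ^^ (hw_label h lam i + 1)) v = 0}"
      using unique[OF J0] nodes by simp
    show "J0 = J'" if "J' \<subseteq> integral_nodes I h lam \<and>
        is_parabolic_verma_module scale brk H I alpha xm h lam J' vscale act" for J'
      using unique[OF J0] parabolic that by simp
    show "J0 = integral_nodes I h lam"
      if "is_simple_highest_weight_module scale brk H I alpha lam vscale act"
      using unique[OF J0] simple[OF that] by simp
  qed
qed

end
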